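(* Let $(M,\nabla)$ be an affine manifold, let $\Phi$ be a smooth symmetric $2$-tensor on $M$, and let $g_{\nabla,\Phi}$ be the deformed Riemannian extension on the cotangent bundle $T^*M$. The following assertions are equivalent: (1) $(M,\nabla)$ is an affine projective Osserman manifold. (2) $(T^*M,g_{\nabla,\Phi})$ is a spacelike projective Osserman manifold. (3) $(T^*M,g_{\nabla,\Phi})$ is a timelike projective Osserman manifold.
   Context: An affine manifold $(M,\nabla)$ is a smooth manifold $M$ with a torsion-free connection $\nabla$ on $TM$. Let $\mathcal{R}(x,y)=\nabla_x\nabla_y-\nabla_y\nabla_x-\nabla_{[x,y]}$ be its curvature operator. The Jacobi operator of $x\in T_PM$ is the endomorphism $\mathcal{J}(x):y\mapsto\mathcal{R}(y,x)x$ of $T_PM$; for a pseudo-Riemannian manifold, $\mathcal{J}$ is defined using the Levi-Civita connection. For a linear map $T$ of a finite-dimensional real vector space, $\operatorname{Spec}\{T\}\subset\mathbb{C}$ is the set of complex roots of the characteristic polynomial $\det(T-\lambda\operatorname{Id})$. $(M,\nabla)$ is an affine projective Osserman manifold if for any pair of non-zero tangent vectors $x,y\in TM$ (possibly with different base points) there is a real number $s(x,y)\ne0$ with $\operatorname{Spec}\{\mathcal{J}(y)\}=s(x,y)\cdot\operatorname{Spec}\{\mathcal{J}(x)\}\ne\{0\}$. A pseudo-Riemannian manifold $(N,g)$ is spacelike (resp. timelike) projective Osserman if for any pair of vectors $x,y$ in $S^+(N,g)$ (resp. $S^-(N,g)$), where $S^\pm(N,g)=\{\xi\in TN:g(\xi,\xi)=\pm1\}$,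 there is a real number $s(x,y)\ne0$ with $\operatorname{Spec}\{\mathcal{J}(y)\}=s(x,y)\cdot\operatorname{Spec}\{\mathcal{J}(x)\}\ne\{0\}$. Deformed Riemannian extension: let $m=\dim M$, let $(x^1,\dots,x^m)$ be local coordinates on $M$, let $\Gamma_{ij}{}^k$ be the Christoffel symbols of $\nabla$, $\nabla_{\partial_{x_i}}\partial_{x_j}=\sum_k\Gamma_{ij}{}^k\partial_{x_k}$, and let $\Phi=\sum_{i,j}\Phi_{ij}\,dx^i\circ dx^j$. Writing $\omega\in T^*M$ as $\omega=\sum_i y_i\,dx^i$ gives local coordinates $(x^1,\dots,x^m,y_1,\dots,y_m)$ on $T^*M$; write $\partial_{y^i}$ for the coordinate vector field $\partial/\partial y_i$. The metric $g_{\nabla,\Phi}$ of neutral signature $(m,m)$ on $T^*M$ is given locally by $$g_{\nabla,\Phi}(\partial_{x_i},\partial_{x_j})=-2\sum_k y_k\Gamma_{ij}{}^k(x)+\Phi_{ij}(x),\quad g_{\nabla,\Phi}(\partial_{x_i},\partial_{y^j})=\delta_i^j,\quad g_{\nabla,\Phi}(\partial_{y^i},\partial_{y^j})=0;$$ it is independent of the choice of coordinates. *)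

theory Defs
  imports "HOL-Analysis.Analysis"
begin

section \<open>Smooth maps between Euclidean spaces\<close>

text \<open>For open \<open>S\<close>, \<open>Ck_on k S f\<close> says that all iterated directional derivatives of \<open>f\<close>
  of order at most \<open>k\<close> exist (as Frechet derivatives) and are continuous on \<open>S\<close>.\<close>

fun Ck_on :: "nat \<Rightarrow> 'a::euclidean_space set \<Rightarrow> ('a \<Rightarrow> 'b::real_normed_vector) \<Rightarrow> bool" where
  "Ck_on 0 S f \<longleftrightarrow> continuous_on S f"
| "Ck_on (Suc k) S f \<longleftrightarrow>
     (\<forall>x\<in>S. f differentiable (at x)) \<and> (\<forall>v. Ck_on k S (\<lambda>x. frechet_derivative f (at x) v))"

definition smooth_on :: "'a::euclidean_space set \<Rightarrow> ('a \<Rightarrow> 'b::real_normed_vector) \<Rightarrow> bool" where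
  "smooth_on S f \<longleftrightarrow> (\<forall>k. Ck_on k S f)"


section \<open>Smooth manifolds\<close>

text \<open>A chart is a domain together with a coordinate map; only the values of the map on the domain
  matter. A manifold is given by an atlas, which determines both its set of points and its
  topology.\<close>

type_synonym ('a, 'n) chart = "'a set \<times> ('a \<Rightarrow> real^'n)"

abbreviation cdom :: "('a, 'n) chart \<Rightarrow> 'a set" where "cdom \<equiv> fst"
abbreviation cmap :: "('a, 'n) chart \<Rightarrow> 'a \<Rightarrow> real^'n" where "cmap \<equiv> snd"

definition cinv :: "('a, 'n) chart \<Rightarrow> real^'n \<Rightarrow> 'a" where
  "cinv c = inv_into (cdom c) (cmap c)"

definition transition :: "('a, 'n) chart \<Rightarrow> ('a, 'n) chart \<Rightarrow> real^'n \<Rightarrow> real^'n" where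
  "transition c d = cmap d \<circ> cinv c"

definition points :: "('a, 'n) chart set \<Rightarrow> 'a set" where
  "points A = (\<Union>c\<in>A. cdom c)"

definition smooth_atlas :: "('a, 'n::finite) chart set \<Rightarrow> bool" where
  "smooth_atlas A \<longleftrightarrow>
     (\<forall>c\<in>A. inj_on (cmap c) (cdom c) \<and> open (cmap c ` cdom c)) \<and>
     (\<forall>c\<in>A. \<forall>d\<in>A. open (cmap c ` (cdom c \<inter> cdom d)) \<and>
        smooth_on (cmap c ` (cdom c \<inter> cdom d)) (transition c d))"

definition atlas_topology :: "('a, 'n::finite) chart set \<Rightarrow> 'a topology" where
  "atlas_topology A =
     topology (\<lambda>U. U \<subseteq> points A \<and> (\<forall>c\<in>A. open (cmap c ` (U \<inter> cdom c))))"

lemma openin_atlas_topology: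
  assumes "smooth_atlas A"
  shows "openin (atlas_topology A) U \<longleftrightarrow>
    U \<subseteq> points A \<and> (\<forall>c\<in>A. open (cmap c ` (U \<inter> cdom c)))"
proof -
  have "istopology (\<lambda>U. U \<subseteq> points A \<and> (\<forall>c\<in>A. open (cmap c ` (U \<inter> cdom c))))"
    unfolding istopology_def
  proof (intro conjI allI impI ballI)
    fix S T c
    assume S: "S \<subseteq> points A \<and> (\<forall>c\<in>A. open (cmap c ` (S \<inter> cdom c)))"
      and T: "T \<subseteq> points A \<and> (\<forall>c\<in>A. open (cmap c ` (T \<inter> cdom c)))"
    show "S \<inter> T \<subseteq> points A" using S by blast
    assume c: "c \<in> A"
    then have "inj_on (cmap c) (cdom c)" using assms by (auto simp: smooth_atlas_def)
    then have "cmap c ` (S \<inter> T \<inter> cdom c) = cmap c ` (S \<inter> cdom c) \<inter> cmap c ` (T \<inter> cdom c)"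
      by (auto simp: inj_on_def)
    then show "open (cmap c ` (S \<inter> T \<inter> cdom c))" using S T c by auto
  next
    fix K c
    assume K: "\<forall>S\<in>K. S \<subseteq> points A \<and> (\<forall>c\<in>A. open (cmap c ` (S \<inter> cdom c)))"
    show "\<Union>K \<subseteq> points A" using K by blast
    assume c: "c \<in> A"
    have "cmap c ` (\<Union>K \<inter> cdom c) = (\<Union>S\<in>K. cmap c ` (S \<inter> cdom c))" by blast
    then show "open (cmap c ` (\<Union>K \<inter> cdom c))" using K c by auto
  qed
  then show ?thesis by (simp add: atlas_topology_def topology_inverse')
qed

definition smooth_manifold :: "('a, 'n::finite) chart set \<Rightarrow> bool" where
  "smooth_manifold A \<longleftrightarrow>
     smooth_atlas A \<and> Hausdorff_space (atlas_topology A) \<and> second_countable (atlas_topology A)"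

definition smooth_fun :: "('a, 'n::finite) chart set \<Rightarrow> 'a set \<Rightarrow> ('a \<Rightarrow> real) \<Rightarrow> bool" where
  "smooth_fun A U f \<longleftrightarrow> openin (atlas_topology A) U \<and>
     (\<forall>c\<in>A. smooth_on (cmap c ` (U \<inter> cdom c)) (f \<circ> cinv c))"


section \<open>Tangent vectors and vector fields\<close>

text \<open>Every point \<open>p\<close> has a chosen chart \<open>chart_at A p\<close>, and the tangent space at \<open>p\<close> is realised as
  \<open>real^'n\<close>: a vector is its list of components in the chart chosen at \<open>p\<close>. Its components in
  another chart around \<open>p\<close> are obtained by applying the Jacobian of the transition map. Nothing
  is assumed about how the chosen chart varies with \<open>p\<close>, so smoothness of a vector field always
  refers to its components in a fixed chart.\<close>

definition chart_at :: "('a, 'n) chart set \<Rightarrow> 'a \<Rightarrow> ('a, 'n) chart" where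
  "chart_at A p = (SOME c. c \<in> A \<and> p \<in> cdom c)"

definition components ::
    "('a, 'n::finite) chart set \<Rightarrow> ('a, 'n) chart \<Rightarrow> 'a \<Rightarrow> real^'n \<Rightarrow> real^'n" where
  "components A c p v =
     frechet_derivative (transition (chart_at A p) c) (at (cmap (chart_at A p) p)) v"

definition coord_field ::
    "('a, 'n::finite) chart set \<Rightarrow> ('a, 'n) chart \<Rightarrow> 'n \<Rightarrow> 'a \<Rightarrow> real^'n" where
  "coord_field A c i p =
     frechet_derivative (transition c (chart_at A p)) (at (cmap c p)) (axis i 1)"

definition smooth_vf :: "('a, 'n::finite) chart set \<Rightarrow> 'a set \<Rightarrow> ('a \<Rightarrow> real^'n) \<Rightarrow> bool" where
  "smooth_vf A U X \<longleftrightarrow> openin (atlas_topology A) U \<and>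
     (\<forall>c\<in>A. smooth_on (cmap c ` (U \<inter> cdom c)) (\<lambda>z. components A c (cinv c z) (X (cinv c z))))"

definition dir_deriv ::
    "('a, 'n::finite) chart set \<Rightarrow> ('a \<Rightarrow> real^'n) \<Rightarrow> ('a \<Rightarrow> real) \<Rightarrow> 'a \<Rightarrow> real" where
  "dir_deriv A X f p =
     (let c = chart_at A p in frechet_derivative (f \<circ> cinv c) (at (cmap c p)) (X p))"

text \<open>\<open>[X,Y]\<^sup>k = X(Y\<^sup>k) - Y(X\<^sup>k)\<close>, computed at \<open>p\<close> in the chart chosen at \<open>p\<close>.\<close>

definition lie_bracket ::
    "('a, 'n::finite) chart set \<Rightarrow> ('a \<Rightarrow> real^'n) \<Rightarrow> ('a \<Rightarrow> real^'n) \<Rightarrow> 'a \<Rightarrow> real^'n" where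
  "lie_bracket A X Y p =
     (let c = chart_at A p;
          comp = (\<lambda>Z z. components A c (cinv c z) (Z (cinv c z)))
      in frechet_derivative (comp Y) (at (cmap c p)) (X p)
         - frechet_derivative (comp X) (at (cmap c p)) (Y p))"


section \<open>Connections, curvature and Jacobi operators\<close>

text \<open>A connection maps smooth vector fields \<open>X\<close>, \<open>Y\<close> on an open set \<open>U\<close> to a smooth vector field
  \<open>D X Y\<close> on \<open>U\<close>, compatibly with restriction to smaller open sets (second clause). Fields are
  total functions, but values outside \<open>U\<close> play no role.\<close>

type_synonym ('a, 'n) cov_deriv = "('a \<Rightarrow> real^'n) \<Rightarrow> ('a \<Rightarrow> real^'n) \<Rightarrow> 'a \<Rightarrow> real^'n"

definition connection :: "('a, 'n::finite) chart set \<Rightarrow> ('a, 'n) cov_deriv \<Rightarrow> bool" where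
  "connection A D \<longleftrightarrow>
     (\<forall>U X Y. smooth_vf A U X \<and> smooth_vf A U Y \<longrightarrow> smooth_vf A U (D X Y)) \<and>
     (\<forall>U X X' Y Y'. smooth_vf A U X \<and> smooth_vf A U X' \<and> smooth_vf A U Y \<and> smooth_vf A U Y' \<and>
        (\<forall>p\<in>U. X p = X' p \<and> Y p = Y' p) \<longrightarrow> (\<forall>p\<in>U. D X Y p = D X' Y' p)) \<and>
     (\<forall>U X X' Y. smooth_vf A U X \<and> smooth_vf A U X' \<and> smooth_vf A U Y \<longrightarrow>
        (\<forall>p\<in>U. D (\<lambda>q. X q + X' q) Y p = D X Y p + D X' Y p)) \<and>
     (\<forall>U f X Y. smooth_fun A U f \<and> smooth_vf A U X \<and> smooth_vf A U Y \<longrightarrow>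
        (\<forall>p\<in>U. D (\<lambda>q. f q *\<^sub>R X q) Y p = f p *\<^sub>R D X Y p)) \<and>
     (\<forall>U X Y Y'. smooth_vf A U X \<and> smooth_vf A U Y \<and> smooth_vf A U Y' \<longrightarrow>
        (\<forall>p\<in>U. D X (\<lambda>q. Y q + Y' q) p = D X Y p + D X Y' p)) \<and>
     (\<forall>U f X Y. smooth_fun A U f \<and> smooth_vf A U X \<and> smooth_vf A U Y \<longrightarrow>
        (\<forall>p\<in>U. D X (\<lambda>q. f q *\<^sub>R Y q) p = dir_deriv A X f p *\<^sub>R Y p + f p *\<^sub>R D X Y p))"

definition torsion_free :: "('a, 'n::finite) chart set \<Rightarrow> ('a, 'n) cov_deriv \<Rightarrow> bool" where
  "torsion_free A D \<longleftrightarrow>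
     (\<forall>U X Y. smooth_vf A U X \<and> smooth_vf A U Y \<longrightarrow>
        (\<forall>p\<in>U. D X Y p - D Y X p = lie_bracket A X Y p))"

definition affine_manifold :: "('a, 'n::finite) chart set \<Rightarrow> ('a, 'n) cov_deriv \<Rightarrow> bool" where
  "affine_manifold A D \<longleftrightarrow> smooth_manifold A \<and> connection A D \<and> torsion_free A D"

definition curvature ::
    "('a, 'n::finite) chart set \<Rightarrow> ('a, 'n) cov_deriv \<Rightarrow> ('a \<Rightarrow> real^'n) \<Rightarrow> ('a \<Rightarrow> real^'n) \<Rightarrow>
     ('a \<Rightarrow> real^'n) \<Rightarrow> 'a \<Rightarrow> real^'n" where
  "curvature A D X Y Z p =
     D X (D Y Z) p - D Y (D X Z) p - D (lie_bracket A X Y) Z p"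

text \<open>\<open>\<J>(x) y = \<R>(y,x) x\<close>, where \<open>\<R>\<close> is evaluated on tangent vectors at \<open>p\<close> through arbitrary
  extensions to smooth vector fields near \<open>p\<close>; by tensoriality the value does not depend on
  the extensions.\<close>

definition jacobi ::
    "('a, 'n::finite) chart set \<Rightarrow> ('a, 'n) cov_deriv \<Rightarrow> 'a \<Rightarrow> real^'n \<Rightarrow> real^'n \<Rightarrow> real^'n" where
  "jacobi A D p x y =
     (THE w. \<forall>U X Y. p \<in> U \<and> smooth_vf A U X \<and> smooth_vf A U Y \<and> X p = x \<and> Y p = y \<longrightarrow>
        curvature A D Y X X p = w)"

definition Spec :: "(real^'n \<Rightarrow> real^'n::finite) \<Rightarrow> complex set" where
  "Spec T = {\<mu>. det ((\<chi> i j. complex_of_real (matrix T $ i $ j)) - mat \<mu>) = 0}"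


section \<open>Tensor fields of type (0,2) and the Levi-Civita connection\<close>

type_synonym ('a, 'n) two_tensor = "'a \<Rightarrow> real^'n \<Rightarrow> real^'n \<Rightarrow> real"

definition smooth_symmetric_tensor ::
    "('a, 'n::finite) chart set \<Rightarrow> ('a, 'n) two_tensor \<Rightarrow> bool" where
  "smooth_symmetric_tensor A \<Phi> \<longleftrightarrow>
     (\<forall>p\<in>points A. bilinear (\<Phi> p) \<and> (\<forall>u v. \<Phi> p u v = \<Phi> p v u)) \<and>
     (\<forall>U X Y. smooth_vf A U X \<and> smooth_vf A U Y \<longrightarrow> smooth_fun A U (\<lambda>p. \<Phi> p (X p) (Y p)))"

definition metric_connection ::
    "('a, 'n::finite) chart set \<Rightarrow> ('a, 'n) two_tensor \<Rightarrow> ('a, 'n) cov_deriv \<Rightarrow> bool" where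
  "metric_connection A g D \<longleftrightarrow>
     (\<forall>U X Y Z. smooth_vf A U X \<and> smooth_vf A U Y \<and> smooth_vf A U Z \<longrightarrow>
        (\<forall>p\<in>U. dir_deriv A X (\<lambda>q. g q (Y q) (Z q)) p
           = g p (D X Y p) (Z p) + g p (Y p) (D X Z p)))"

text \<open>The Levi-Civita connection is unique on smooth vector fields; the choice below only concerns
  the irrelevant values on junk arguments and outside the domains of the fields.\<close>

definition levi_civita ::
    "('a, 'n::finite) chart set \<Rightarrow> ('a, 'n) two_tensor \<Rightarrow> ('a, 'n) cov_deriv" where
  "levi_civita A g = (SOME D. connection A D \<and> torsion_free A D \<and> metric_connection A g D)"


section \<open>Projective Osserman manifolds\<close>

definition affine_projective_Osserman ::
    "('a, 'n::finite) chart set \<Rightarrow> ('a, 'n) cov_deriv \<Rightarrow> bool" where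
  "affine_projective_Osserman A D \<longleftrightarrow>
     (\<forall>p\<in>points A. \<forall>q\<in>points A. \<forall>x y. x \<noteq> 0 \<and> y \<noteq> 0 \<longrightarrow>
        (\<exists>s::real. s \<noteq> 0 \<and>
           Spec (jacobi A D q y) = (\<lambda>z. of_real s * z) ` Spec (jacobi A D p x) \<and>
           (\<lambda>z. of_real s * z) ` Spec (jacobi A D p x) \<noteq> {0}))"

definition pseudo_sphere_bundle ::
    "('a, 'n::finite) chart set \<Rightarrow> ('a, 'n) two_tensor \<Rightarrow> real \<Rightarrow> ('a \<times> (real^'n)) set" where
  "pseudo_sphere_bundle A g \<epsilon> = {(p, x). p \<in> points A \<and> g p x x = \<epsilon>}"

definition projective_Osserman_on ::
    "('a, 'n::finite) chart set \<Rightarrow> ('a, 'n) two_tensor \<Rightarrow> ('a \<times> (real^'n)) set \<Rightarrow> bool" where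
  "projective_Osserman_on A g S \<longleftrightarrow>
     (\<forall>(p, x)\<in>S. \<forall>(q, y)\<in>S.
        (\<exists>s::real. s \<noteq> 0 \<and>
           Spec (jacobi A (levi_civita A g) q y)
             = (\<lambda>z. of_real s * z) ` Spec (jacobi A (levi_civita A g) p x) \<and>
           (\<lambda>z. of_real s * z) ` Spec (jacobi A (levi_civita A g) p x) \<noteq> {0}))"

definition spacelike_projective_Osserman ::
    "('a, 'n::finite) chart set \<Rightarrow> ('a, 'n) two_tensor \<Rightarrow> bool" where
  "spacelike_projective_Osserman A g \<longleftrightarrow> projective_Osserman_on A g (pseudo_sphere_bundle A g 1)"

definition timelike_projective_Osserman ::
    "('a, 'n::finite) chart set \<Rightarrow> ('a, 'n) two_tensor \<Rightarrow> bool" where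
  "timelike_projective_Osserman A g \<longleftrightarrow> projective_Osserman_on A g (pseudo_sphere_bundle A g (- 1))"


section \<open>The cotangent bundle and the deformed Riemannian extension\<close>

text \<open>A point of the cotangent bundle is a pair of a base point \<open>p\<close> and a linear form on the tangent
  space at \<open>p\<close>. In the chart induced by a chart \<open>c\<close> of the base, the coordinates indexed by
  \<open>Inl\<close> are the \<open>x\<^sup>i\<close> and those indexed by \<open>Inr\<close> are the \<open>y\<^sub>i = \<omega>(\<partial>\<^sub>x\<^sub>i)\<close>.\<close>

type_synonym ('a, 'm) cotangent = "'a \<times> ((real^'m) \<Rightarrow>\<^sub>L real)"

definition cotangent_chart ::
    "('a, 'm::finite) chart set \<Rightarrow> ('a, 'm) chart \<Rightarrow> (('a, 'm) cotangent, 'm + 'm) chart" where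
  "cotangent_chart A c =
     (cdom c \<times> UNIV,
      \<lambda>(p, \<omega>). \<chi> k. case k of Inl i \<Rightarrow> cmap c p $ i
                          | Inr i \<Rightarrow> blinfun_apply \<omega> (coord_field A c i p))"

definition cotangent_bundle ::
    "('a, 'm::finite) chart set \<Rightarrow> (('a, 'm) cotangent, 'm + 'm) chart set" where
  "cotangent_bundle A = cotangent_chart A ` A"

text \<open>\<open>christoffel A D c i j k p\<close> is \<open>\<Gamma>\<^sub>i\<^sub>j\<^sup>k(p)\<close> in the chart \<open>c\<close>.\<close>

definition christoffel ::
    "('a, 'm::finite) chart set \<Rightarrow> ('a, 'm) cov_deriv \<Rightarrow> ('a, 'm) chart \<Rightarrow> 'm \<Rightarrow> 'm \<Rightarrow> 'm \<Rightarrow> 'a \<Rightarrow> real"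
  where
  "christoffel A D c i j k p = components A c p (D (coord_field A c i) (coord_field A c j) p) $ k"

definition extension_coeff ::
    "('a, 'm::finite) chart set \<Rightarrow> ('a, 'm) cov_deriv \<Rightarrow> ('a, 'm) two_tensor \<Rightarrow> ('a, 'm) chart \<Rightarrow>
     ('a, 'm) cotangent \<Rightarrow> 'm + 'm \<Rightarrow> 'm + 'm \<Rightarrow> real" where
  "extension_coeff A D \<Phi> c \<xi> a b =
     (case (a, b) of
        (Inl i, Inl j) \<Rightarrow>
          - 2 * (\<Sum>k\<in>UNIV. cmap (cotangent_chart A c) \<xi> $ Inr k * christoffel A D c i j k (fst \<xi>))
          + \<Phi> (fst \<xi>) (coord_field A c i (fst \<xi>)) (coord_field A c j (fst \<xi>))
      | (Inl i, Inr j) \<Rightarrow> (if i = j then 1 else 0)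
      | (Inr i, Inl j) \<Rightarrow> (if i = j then 1 else 0)
      | (Inr i, Inr j) \<Rightarrow> 0)"

text \<open>The metric is evaluated at \<open>\<xi> = (p, \<omega>)\<close> in the induced coordinates of the chart chosen at
  \<open>p\<close>; any other chart of the atlas around \<open>p\<close> gives the same value.\<close>

definition riemannian_extension ::
    "('a, 'm::finite) chart set \<Rightarrow> ('a, 'm) cov_deriv \<Rightarrow> ('a, 'm) two_tensor \<Rightarrow>
     (('a, 'm) cotangent, 'm + 'm) two_tensor" where
  "riemannian_extension A D \<Phi> \<xi> u v =
     (let c = chart_at A (fst \<xi>);
          u' = components (cotangent_bundle A) (cotangent_chart A c) \<xi> u;
          v' = components (cotangent_bundle A) (cotangent_chart A c) \<xi> v
      in \<Sum>a\<in>UNIV. \<Sum>b\<in>UNIV. extension_coeff A D \<Phi> c \<xi> a b * u' $ a * v' $ b)"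

end

theory Submission
  imports Defs
begin

text \<open>The three conditions are equivalent because they speak about the same family of spectra.

  Let \<open>(x,y)\<close> be coordinates on the cotangent bundle induced by coordinates \<open>x\<close> on the base, and write a tangent vector
  as \<open>(u,a)\<close>, with base part \<open>u\<close> and fibre part \<open>a\<close>. If \<open>\<Gamma>\<close> is the Christoffel map of the base, the
  Levi-Civita connection of the deformed Riemannian extension has the Christoffel map
  \<open>((u,a),(v,b)) \<mapsto> (\<Gamma>(u,v), - a(\<Gamma>(v,\<cdot>)) - b(\<Gamma>(u,\<cdot>)) + k(x,y)(u,v))\<close>,
  where \<open>k\<close> is affine in \<open>y\<close> (\<open>metric_compatible_christ\<close>). Substituting this into the coordinate formula for the curvature
  shows that the Jacobi operator of \<open>(u,a)\<close> is block triangular: on the base it induces the Jacobi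
  operator of \<open>u\<close> (\<open>base_local_curv_christ\<close>), and on the vertical space its transpose
  (\<open>fibre_local_curv_christ_vertical\<close>). A matrix and its transpose have the same eigenvalues, so the spectrum
  is the one of the Jacobi operator of \<open>u\<close> on the base (\<open>Spec_extension_jacobi\<close>).

  If \<open>(u,a)\<close> has length \<open>\<plusminus>1\<close> then \<open>u \<noteq> 0\<close>, since vertical vectors are null. Conversely every \<open>u \<noteq> 0\<close> lifts to a vector of
  any given length, as the length of \<open>(u,a)\<close> is \<open>2 a(u)\<close> plus a term without \<open>a\<close>. So the spectra over the unit
  spacelike vectors, those over the unit timelike vectors, and those over the nonzero vectors of the base form
  the same family, and each of the three conditions compares the members of this family
  pairwise (\<open>affine_iff_projective_Osserman_on\<close>).

  Connections are given as operators on vector fields and the Jacobi operator through extensions of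
  vectors to fields. The bridge to coordinates is that a connection is represented in every chart by a
  Christoffel map (\<open>represents_christoffel_map\<close>), which gives the coordinate formulas for the curvature and the Jacobi
  operator (\<open>jacobi_components\<close>). In the other direction, compatible Christoffel maps in the charts glue to the
  Levi-Civita connection (\<open>levi_civita_represented\<close>): the Koszul formula forces them to obey the transformation
  law. The symmetry of second derivatives enters three times: in this law, in the cancellation that makes the
  curvature a tensor, and in the independence of the chart for the symmetry of the Christoffel maps.\<close>

section \<open>Smooth maps\<close>

abbreviation dd :: "('a::real_normed_vector \<Rightarrow> 'b::real_normed_vector) \<Rightarrow> 'a \<Rightarrow> 'a \<Rightarrow> 'b" where
  "dd f z \<equiv> frechet_derivative f (at z)"

text \<open>Two functions that agree near a point have the same set of derivatives there, so the choice made
  by the derivative operator is the same, even if that set is empty.\<close>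

lemma dd_cong:
  assumes "open S" "z \<in> S" "\<And>x. x \<in> S \<Longrightarrow> f x = g x"
  shows "dd f z = dd g z"
proof -
  have "(f has_derivative f') (at z) \<longleftrightarrow> (g has_derivative f') (at z)" for f'
    using assms has_derivative_transform_within_open[of f f' z UNIV S g]
      has_derivative_transform_within_open[of g f' z UNIV S f] by auto
  then show ?thesis by (simp add: frechet_derivative_def)
qed

lemma differentiable_cong:
  assumes "open S" "z \<in> S" "\<And>x. x \<in> S \<Longrightarrow> f x = g x" "f differentiable (at z)"
  shows "g differentiable (at z)"
  using assms has_derivative_transform_within_open[of f _ z UNIV S g]
  unfolding differentiable_def by blast

lemma dd_eq: "(f has_derivative f') (at z) \<Longrightarrow> dd f z = f'"
  using frechet_derivative_at by metis

lemma dd_works: "f differentiable (at z) \<Longrightarrow> (f has_derivative dd f z) (at z)"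
  by (simp add: frechet_derivative_works)

lemma dd_linear_comp:
  "bounded_linear L \<Longrightarrow> f differentiable (at z) \<Longrightarrow> dd (\<lambda>x. L (f x)) z v = L (dd f z v)"
  by (rule fun_cong[OF dd_eq]) (auto intro: bounded_linear.has_derivative dd_works)

lemma dd_chain:
  assumes "g differentiable (at z)" "f differentiable (at (g z))"
  shows "dd (\<lambda>x. f (g x)) z v = dd f (g z) (dd g z v)"
  using frechet_derivative_compose[OF assms] by (simp add: o_def fun_eq_iff)

lemma Ck_on_cong:
  assumes "open S" "\<And>x. x \<in> S \<Longrightarrow> f x = g x"
  shows "Ck_on k S f \<longleftrightarrow> Ck_on k S g"
  using assms(2)
proof (induction k arbitrary: f g)
  case 0
  then show ?case using continuous_on_cong by force
next
  case (Suc k)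
  have "f differentiable (at x) \<longleftrightarrow> g differentiable (at x)" if "x \<in> S" for x
    using differentiable_cong[OF assms(1) that, of f g] differentiable_cong[OF assms(1) that, of g f]
      Suc.prems by auto
  moreover have "Ck_on k S (\<lambda>x. dd f x v) \<longleftrightarrow> Ck_on k S (\<lambda>x. dd g x v)" for v
    by (rule Suc.IH) (simp add: dd_cong[OF assms(1) _ Suc.prems])
  ultimately show ?case by simp
qed

lemma Ck_on_subset: "Ck_on k S f \<Longrightarrow> T \<subseteq> S \<Longrightarrow> Ck_on k T f"
  by (induction k arbitrary: f) (auto intro: continuous_on_subset)

lemma Ck_on_Suc_imp: "Ck_on (Suc k) S f \<Longrightarrow> Ck_on k S f"
proof (induction k arbitrary: f)
  case 0
  then show ?case
    by (auto intro!: continuous_at_imp_continuous_on differentiable_imp_continuous_within)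
next
  case (Suc k)
  have "Ck_on k S (\<lambda>x. dd f x v)" for v
    by (rule Suc.IH) (use Suc.prems in simp)
  then show ?case using Suc.prems by simp
qed

lemma Ck_on_const: "Ck_on k S (\<lambda>x. c)"
  by (induction k arbitrary: c) auto

lemma Ck_on_bounded_linear:
  assumes "open S" "bounded_linear L" "Ck_on k S f"
  shows "Ck_on k S (\<lambda>x. L (f x))"
  using assms(3)
proof (induction k arbitrary: f)
  case 0
  then show ?case
    using bounded_linear.continuous_on[OF assms(2)] by auto
next
  case (Suc k)
  then have d: "\<And>x. x \<in> S \<Longrightarrow> f differentiable (at x)" by simp
  have "Ck_on k S (\<lambda>x. dd (\<lambda>x. L (f x)) x v)" for v
    using Ck_on_cong[OF assms(1), of "\<lambda>x. dd (\<lambda>x. L (f x)) x v" "\<lambda>x. L (dd f x v)" k]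
      Suc dd_linear_comp[OF assms(2) d] by simp
  moreover have "(\<lambda>x. L (f x)) differentiable (at x)" if "x \<in> S" for x
    using d[OF that] bounded_linear.has_derivative[OF assms(2)] unfolding differentiable_def by blast
  ultimately show ?case by simp
qed

lemma Ck_on_add:
  assumes "open S" "Ck_on k S f" "Ck_on k S g"
  shows "Ck_on k S (\<lambda>x. f x + g x)"
  using assms(2,3)
proof (induction k arbitrary: f g)
  case 0
  then show ?case by (auto intro: continuous_on_add)
next
  case (Suc k)
  then have d: "\<And>x. x \<in> S \<Longrightarrow> f differentiable (at x)" "\<And>x. x \<in> S \<Longrightarrow> g differentiable (at x)"
    by auto
  have "dd (\<lambda>x. f x + g x) x v = dd f x v + dd g x v" if "x \<in> S" for x v
    by (rule fun_cong[OF dd_eq]) (auto intro!: derivative_intros dd_works d that)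
  then have "Ck_on k S (\<lambda>x. dd (\<lambda>x. f x + g x) x v)" for v
    using Ck_on_cong[OF assms(1), of "\<lambda>x. dd (\<lambda>x. f x + g x) x v" "\<lambda>x. dd f x v + dd g x v" k]
      Suc by simp
  with d show ?case by (auto intro: differentiable_add)
qed

lemma Ck_on_scaleR:
  assumes "open S" "Ck_on k S f" "Ck_on k S g"
  shows "Ck_on k S (\<lambda>x. f x *\<^sub>R g x)"
  using assms(2,3)
proof (induction k arbitrary: f g)
  case 0
  then show ?case by (auto intro: continuous_on_scaleR)
next
  case (Suc k)
  then have d: "\<And>x. x \<in> S \<Longrightarrow> f differentiable (at x)" "\<And>x. x \<in> S \<Longrightarrow> g differentiable (at x)"
    by auto
  have "dd (\<lambda>x. f x *\<^sub>R g x) x v = f x *\<^sub>R dd g x v + dd f x v *\<^sub>R g x" if "x \<in> S" for x v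
    by (rule fun_cong[OF dd_eq]) (auto intro!: has_derivative_scaleR dd_works d that)
  moreover have "Ck_on k S (\<lambda>x. f x *\<^sub>R dd g x v + dd f x v *\<^sub>R g x)" for v
    using Suc.prems Ck_on_Suc_imp[OF Suc.prems(1)] Ck_on_Suc_imp[OF Suc.prems(2)]
    by (intro Ck_on_add assms(1) Suc.IH) auto
  ultimately have "Ck_on k S (\<lambda>x. dd (\<lambda>x. f x *\<^sub>R g x) x v)" for v
    using Ck_on_cong[OF assms(1), of "\<lambda>x. dd (\<lambda>x. f x *\<^sub>R g x) x v"] by simp
  moreover have "(\<lambda>x. f x *\<^sub>R g x) differentiable (at x)" if "x \<in> S" for x
    using has_derivative_scaleR[OF dd_works[OF d(1)[OF that]] dd_works[OF d(2)[OF that]]]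
    unfolding differentiable_def by blast
  ultimately show ?case by simp
qed

lemma Ck_on_sum:
  assumes "open S" "\<And>i. i \<in> I \<Longrightarrow> Ck_on k S (f i)"
  shows "Ck_on k S (\<lambda>x. \<Sum>i\<in>I. f i x)"
  using assms(2)
  by (induction I rule: infinite_finite_induct) (auto intro: Ck_on_const Ck_on_add assms(1))

lemma linear_eq_sum_Basis:
  fixes L :: "'a::euclidean_space \<Rightarrow> 'b::real_vector"
  assumes "linear L"
  shows "L u = (\<Sum>b\<in>Basis. (u \<bullet> b) *\<^sub>R L b)"
proof -
  have "L u = L (\<Sum>b\<in>Basis. (u \<bullet> b) *\<^sub>R b)" by (simp add: euclidean_representation)
  also have "\<dots> = (\<Sum>b\<in>Basis. (u \<bullet> b) *\<^sub>R L b)"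
    by (simp add: linear_sum[OF assms] linear_cmul[OF assms])
  finally show ?thesis .
qed

lemma Ck_on_compose:
  fixes f :: "'b::euclidean_space \<Rightarrow> 'c::real_normed_vector" and g :: "'a::euclidean_space \<Rightarrow> 'b"
  assumes "open S" "open T" "g ` S \<subseteq> T" "Ck_on k S g" "Ck_on k T f"
  shows "Ck_on k S (\<lambda>x. f (g x))"
  using assms(4,5)
proof (induction k arbitrary: f)
  case 0
  then show ?case using continuous_on_compose2[of T f S g] assms(3) by auto
next
  case (Suc k)
  then have d: "\<And>x. x \<in> S \<Longrightarrow> g differentiable (at x)"
    "\<And>x. x \<in> S \<Longrightarrow> f differentiable (at (g x))"
    using assms(3) by auto
  have "dd (\<lambda>x. f (g x)) x v = (\<Sum>b\<in>Basis. (dd g x v \<bullet> b) *\<^sub>R dd f (g x) b)" if "x \<in> S" for x v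
    unfolding dd_chain[OF d[OF that]]
    by (rule linear_eq_sum_Basis[OF linear_frechet_derivative[OF d(2)[OF that]]])
  moreover have "Ck_on k S (\<lambda>x. \<Sum>b\<in>Basis. (dd g x v \<bullet> b) *\<^sub>R dd f (g x) b)" for v
    using Suc.prems
    by (intro Ck_on_sum Ck_on_scaleR assms(1) Suc.IH Ck_on_bounded_linear[where L = "\<lambda>x. x \<bullet> _"]
        Ck_on_Suc_imp[OF Suc.prems(1)] bounded_linear_inner_left) auto
  ultimately have "Ck_on k S (\<lambda>x. dd (\<lambda>x. f (g x)) x v)" for v
    using Ck_on_cong[OF assms(1), of "\<lambda>x. dd (\<lambda>x. f (g x)) x v"] by simp
  moreover have "(\<lambda>x. f (g x)) differentiable (at x)" if "x \<in> S" for x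
    using differentiable_chain_at[OF d[OF that]] by (simp add: o_def)
  ultimately show ?case by simp
qed

lemma smooth_on_cong:
  assumes "open S" "\<And>x. x \<in> S \<Longrightarrow> f x = g x"
  shows "smooth_on S f \<longleftrightarrow> smooth_on S g"
  using Ck_on_cong[OF assms] by (simp add: smooth_on_def)

lemma smooth_on_transform:
  "open S \<Longrightarrow> smooth_on S g \<Longrightarrow> (\<And>x. x \<in> S \<Longrightarrow> f x = g x) \<Longrightarrow> smooth_on S f"
  using smooth_on_cong by blast

lemma smooth_on_subset: "smooth_on S f \<Longrightarrow> T \<subseteq> S \<Longrightarrow> smooth_on T f"
  unfolding smooth_on_def by (meson Ck_on_subset)

lemma smooth_on_differentiable: "smooth_on S f \<Longrightarrow> x \<in> S \<Longrightarrow> f differentiable (at x)"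
  unfolding smooth_on_def using Ck_on.simps(2) by blast

lemma smooth_on_linear_dd: "smooth_on S f \<Longrightarrow> x \<in> S \<Longrightarrow> linear (dd f x)"
  by (simp add: smooth_on_differentiable linear_frechet_derivative)

lemma smooth_on_dd: "smooth_on S f \<Longrightarrow> smooth_on S (\<lambda>x. dd f x v)"
  unfolding smooth_on_def using Ck_on.simps(2) by blast

lemma smooth_on_continuous: "smooth_on S f \<Longrightarrow> continuous_on S f"
  unfolding smooth_on_def using Ck_on.simps(1) by blast

lemma smooth_on_const: "smooth_on S (\<lambda>x. c)"
  by (simp add: smooth_on_def Ck_on_const)

lemma smooth_on_add:
  "open S \<Longrightarrow> smooth_on S f \<Longrightarrow> smooth_on S g \<Longrightarrow> smooth_on S (\<lambda>x. f x + g x)"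
  by (simp add: smooth_on_def Ck_on_add)

lemma smooth_on_scaleR:
  "open S \<Longrightarrow> smooth_on S f \<Longrightarrow> smooth_on S g \<Longrightarrow> smooth_on S (\<lambda>x. f x *\<^sub>R g x)"
  by (simp add: smooth_on_def Ck_on_scaleR)

lemma smooth_on_sum:
  "open S \<Longrightarrow> (\<And>i. i \<in> I \<Longrightarrow> smooth_on S (f i)) \<Longrightarrow> smooth_on S (\<lambda>x. \<Sum>i\<in>I. f i x)"
  by (simp add: smooth_on_def Ck_on_sum)

lemma smooth_on_bounded_linear:
  "open S \<Longrightarrow> bounded_linear L \<Longrightarrow> smooth_on S f \<Longrightarrow> smooth_on S (\<lambda>x. L (f x))"
  by (simp add: smooth_on_def Ck_on_bounded_linear)

lemma smooth_on_uminus: "open S \<Longrightarrow> smooth_on S f \<Longrightarrow> smooth_on S (\<lambda>x. - f x)"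
  using smooth_on_bounded_linear[OF _ bounded_linear_minus[OF bounded_linear_ident]] by blast

lemma smooth_on_diff:
  "open S \<Longrightarrow> smooth_on S f \<Longrightarrow> smooth_on S g \<Longrightarrow> smooth_on S (\<lambda>x. f x - g x)"
  using smooth_on_add[OF _ _ smooth_on_uminus, of S f g] by simp

lemma smooth_on_mult:
  fixes f g :: "_ \<Rightarrow> real"
  shows "open S \<Longrightarrow> smooth_on S f \<Longrightarrow> smooth_on S g \<Longrightarrow> smooth_on S (\<lambda>x. f x * g x)"
  using smooth_on_scaleR[of S f g] by simp

lemma smooth_on_compose:
  fixes f :: "'b::euclidean_space \<Rightarrow> 'c::real_normed_vector" and g :: "'a::euclidean_space \<Rightarrow> 'b"
  shows "open S \<Longrightarrow> open T \<Longrightarrow> g ` S \<subseteq> T \<Longrightarrow> smooth_on S g \<Longrightarrow> smooth_on T f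
    \<Longrightarrow> smooth_on S (\<lambda>x. f (g x))"
  unfolding smooth_on_def using Ck_on_compose by blast

lemma smooth_on_id: "smooth_on S (\<lambda>x. x)"
proof -
  have "Ck_on k S (\<lambda>x. x)" for k by (cases k) (auto simp: Ck_on_const)
  then show ?thesis by (simp add: smooth_on_def)
qed

lemma smooth_on_vec_iff:
  fixes f :: "'a::euclidean_space \<Rightarrow> real^'n"
  assumes "open S"
  shows "smooth_on S f \<longleftrightarrow> (\<forall>i. smooth_on S (\<lambda>x. f x $ i))"
proof
  assume "smooth_on S f"
  then show "\<forall>i. smooth_on S (\<lambda>x. f x $ i)"
    using smooth_on_bounded_linear[OF assms bounded_linear_vec_nth] by blast
next
  assume "\<forall>i. smooth_on S (\<lambda>x. f x $ i)"
  then have "smooth_on S (\<lambda>x. \<Sum>i\<in>UNIV. f x $ i *\<^sub>R (axis i 1 :: real^'n))"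
    by (intro smooth_on_sum smooth_on_scaleR smooth_on_const assms) auto
  then show "smooth_on S f"
    using basis_expansion[of "f _"] by (simp add: scalar_mult_eq_scaleR)
qed

text \<open>The Leibniz rule for a family of linear maps \<open>L x\<close> applied to a moving argument. It is enough
  that \<open>x \<mapsto> L x u\<close> is differentiable for each fixed \<open>u\<close>, because \<open>L x (Y x)\<close> is a finite sum over a basis;
  so Christoffel maps and metrics can be treated as plain functions of a point and of vectors,
  without a norm on spaces of linear maps.\<close>

lemma linear_field_has_derivative:
  fixes L :: "'a::euclidean_space \<Rightarrow> 'b::euclidean_space \<Rightarrow> 'c::real_normed_vector"
  assumes "open S" "z \<in> S" and lin: "\<And>x. x \<in> S \<Longrightarrow> linear (L x)"
    and L: "\<And>u. (\<lambda>x. L x u) differentiable (at z)" and Y: "(Y has_derivative Y') (at z)"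
  shows "((\<lambda>x. L x (Y x)) has_derivative (\<lambda>w. dd (\<lambda>x. L x (Y z)) z w + L z (Y' w))) (at z)"
proof -
  have lz: "linear (L z)" using lin assms(2) by blast
  have 1: "((\<lambda>x. \<Sum>b\<in>Basis. (Y x \<bullet> b) *\<^sub>R L x b) has_derivative
     (\<lambda>w. \<Sum>b\<in>Basis. (Y z \<bullet> b) *\<^sub>R dd (\<lambda>x. L x b) z w + (Y' w \<bullet> b) *\<^sub>R L z b)) (at z)"
    by (intro has_derivative_sum has_derivative_scaleR dd_works L has_derivative_inner_left Y)
  have 2: "((\<lambda>x. \<Sum>b\<in>Basis. (Y z \<bullet> b) *\<^sub>R L x b) has_derivative
     (\<lambda>w. \<Sum>b\<in>Basis. (Y z \<bullet> b) *\<^sub>R dd (\<lambda>x. L x b) z w)) (at z)"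
    by (intro has_derivative_sum has_derivative_scaleR_right dd_works L)
  have "dd (\<lambda>x. L x (Y z)) z = dd (\<lambda>x. \<Sum>b\<in>Basis. (Y z \<bullet> b) *\<^sub>R L x b) z"
    by (intro dd_cong[OF assms(1,2)] linear_eq_sum_Basis[OF lin])
  also have "\<dots> = (\<lambda>w. \<Sum>b\<in>Basis. (Y z \<bullet> b) *\<^sub>R dd (\<lambda>x. L x b) z w)"
    by (rule dd_eq[OF 2])
  finally have 3: "dd (\<lambda>x. L x (Y z)) z w + L z (Y' w) =
      (\<Sum>b\<in>Basis. (Y z \<bullet> b) *\<^sub>R dd (\<lambda>x. L x b) z w + (Y' w \<bullet> b) *\<^sub>R L z b)" for w
    by (subst linear_eq_sum_Basis[OF lz]) (simp add: sum.distrib)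
  show ?thesis
    unfolding 3
    by (intro has_derivative_transform_within_open[OF 1 assms(1,2)]
        linear_eq_sum_Basis[OF lin, symmetric])
qed

lemma dd_linear_field:
  fixes L :: "'a::euclidean_space \<Rightarrow> 'b::euclidean_space \<Rightarrow> 'c::real_normed_vector"
  assumes "open S" "z \<in> S" "\<And>x. x \<in> S \<Longrightarrow> linear (L x)"
    and "\<And>u. (\<lambda>x. L x u) differentiable (at z)" "Y differentiable (at z)"
  shows "dd (\<lambda>x. L x (Y x)) z w = dd (\<lambda>x. L x (Y z)) z w + L z (dd Y z w)"
  using dd_eq[OF linear_field_has_derivative[OF assms(1-4) dd_works[OF assms(5)]]] by simp

lemma differentiable_linear_field:
  fixes L :: "'a::euclidean_space \<Rightarrow> 'b::euclidean_space \<Rightarrow> 'c::real_normed_vector"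
  assumes "open S" "z \<in> S" "\<And>x. x \<in> S \<Longrightarrow> linear (L x)"
    and "\<And>u. (\<lambda>x. L x u) differentiable (at z)" "Y differentiable (at z)"
  shows "(\<lambda>x. L x (Y x)) differentiable (at z)"
  using linear_field_has_derivative[OF assms(1-4) dd_works[OF assms(5)]]
  unfolding differentiable_def by blast

lemma bilinear_linear1: "bilinear B \<Longrightarrow> linear (\<lambda>u. B u v)"
  and bilinear_linear2: "bilinear B \<Longrightarrow> linear (B u)"
  by (auto simp: bilinear_def)

lemma dd_bilinear_field:
  fixes B :: "'a::euclidean_space \<Rightarrow> 'b::euclidean_space \<Rightarrow> 'd::euclidean_space \<Rightarrow> 'c::real_normed_vector"
  assumes "open S" "z \<in> S" "\<And>x. x \<in> S \<Longrightarrow> bilinear (B x)"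
    and "\<And>u v. (\<lambda>x. B x u v) differentiable (at z)"
    and "Y differentiable (at z)" "Z differentiable (at z)"
  shows "dd (\<lambda>x. B x (Y x) (Z x)) z w =
    dd (\<lambda>x. B x (Y z) (Z z)) z w + B z (dd Y z w) (Z z) + B z (Y z) (dd Z z w)"
proof -
  have B1: "linear (\<lambda>u. B x u v)" and B2: "linear (B x u)" if "x \<in> S" for x u v
    using assms(3)[OF that] by (auto simp: bilinear_def)
  have d: "(\<lambda>x. B x (Y x) v) differentiable (at z)" for v
    by (rule differentiable_linear_field[OF assms(1,2) _ _ assms(5), where L = "\<lambda>x u. B x u v"]) (auto intro: B1 assms(4))
  have "dd (\<lambda>x. B x (Y x) (Z x)) z w = dd (\<lambda>x. B x (Y x) (Z z)) z w + B z (Y z) (dd Z z w)"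
    by (rule dd_linear_field[OF assms(1,2) B2 d assms(6)])
  also have "dd (\<lambda>x. B x (Y x) (Z z)) z w = dd (\<lambda>x. B x (Y z) (Z z)) z w + B z (dd Y z w) (Z z)"
    by (rule dd_linear_field[OF assms(1,2) _ _ assms(5), where L = "\<lambda>x u. B x u (Z z)"]) (auto intro: B1 assms(4))
  finally show ?thesis by simp
qed

lemma smooth_on_linear_field:
  fixes L :: "'a::euclidean_space \<Rightarrow> 'b::euclidean_space \<Rightarrow> 'c::real_normed_vector"
  assumes "open S" "\<And>x. x \<in> S \<Longrightarrow> linear (L x)" "\<And>u. smooth_on S (\<lambda>x. L x u)" "smooth_on S Y"
  shows "smooth_on S (\<lambda>x. L x (Y x))"
proof -
  have "smooth_on S (\<lambda>x. \<Sum>b\<in>Basis. (Y x \<bullet> b) *\<^sub>R L x b)"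
    by (intro smooth_on_sum smooth_on_scaleR smooth_on_bounded_linear[where L = "\<lambda>x. x \<bullet> _"]
        bounded_linear_inner_left assms)
  then show ?thesis
    by (subst smooth_on_cong[OF assms(1) linear_eq_sum_Basis[OF assms(2)]])
qed

lemma smooth_on_bilinear_field:
  fixes B :: "'a::euclidean_space \<Rightarrow> 'b::euclidean_space \<Rightarrow> 'd::euclidean_space \<Rightarrow> 'c::real_normed_vector"
  assumes "open S" "\<And>x. x \<in> S \<Longrightarrow> bilinear (B x)" "\<And>u v. smooth_on S (\<lambda>x. B x u v)"
    and "smooth_on S Y" "smooth_on S Z"
  shows "smooth_on S (\<lambda>x. B x (Y x) (Z x))"
proof -
  have "smooth_on S (\<lambda>x. B x (Y x) v)" for v
    by (rule smooth_on_linear_field[OF assms(1) _ _ assms(4), where L = "\<lambda>x u. B x u v"])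
      (use assms in \<open>auto intro!: bilinear_linear1\<close>)
  then show ?thesis
    by (rule smooth_on_linear_field[OF assms(1) _ _ assms(5), where L = "\<lambda>x. B x (Y x)", rotated])
      (use assms bilinear_linear2 in blast)
qed

lemma smooth_on_inner:
  fixes f g :: "'a::euclidean_space \<Rightarrow> 'b::euclidean_space"
  assumes "open S" "smooth_on S f" "smooth_on S g"
  shows "smooth_on S (\<lambda>x. f x \<bullet> g x)"
  by (rule smooth_on_bilinear_field[OF assms(1) _ smooth_on_const assms(2,3)])
    (simp add: bilinear_def linear_iff inner_add_left inner_add_right)

lemma linear_dd_family:
  assumes "open S" "z \<in> S" "\<And>x. x \<in> S \<Longrightarrow> linear (L x)"
    and d: "\<And>u. (\<lambda>x. L x u) differentiable (at z)"
  shows "linear (\<lambda>u. dd (\<lambda>x. L x u) z w)"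
proof (rule linearI)
  fix u v r
  have "dd (\<lambda>x. L x (u + v)) z = dd (\<lambda>x. L x u + L x v) z"
    by (rule dd_cong[OF assms(1,2)]) (rule linear_add[OF assms(3)])
  also have "\<dots> = (\<lambda>w. dd (\<lambda>x. L x u) z w + dd (\<lambda>x. L x v) z w)"
    by (rule dd_eq) (intro has_derivative_add dd_works d)
  finally show "dd (\<lambda>x. L x (u + v)) z w = dd (\<lambda>x. L x u) z w + dd (\<lambda>x. L x v) z w"
    by simp
  have "dd (\<lambda>x. L x (r *\<^sub>R u)) z = dd (\<lambda>x. r *\<^sub>R L x u) z"
    by (rule dd_cong[OF assms(1,2)]) (rule linear_cmul[OF assms(3)])
  also have "\<dots> = (\<lambda>w. r *\<^sub>R dd (\<lambda>x. L x u) z w)"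
    by (rule dd_eq) (intro has_derivative_scaleR_right dd_works d)
  finally show "dd (\<lambda>x. L x (r *\<^sub>R u)) z w = r *\<^sub>R dd (\<lambda>x. L x u) z w"
    by simp
qed

text \<open>The next lemmas prove the symmetry of second derivatives: the second difference of a function over a
  small parallelogram is, by two applications of the mean value theorem, a mixed derivative at
  some intermediate point, and this can be done in either order of the two directions.\<close>

lemma mvt_direction:
  fixes f :: "'a::real_normed_vector \<Rightarrow> real"
  assumes "0 < t" "\<And>s. 0 \<le> s \<Longrightarrow> s \<le> t \<Longrightarrow> f differentiable (at (a + s *\<^sub>R u))"
  shows "\<exists>s. 0 < s \<and> s < t \<and> f (a + t *\<^sub>R u) - f a = t * dd f (a + s *\<^sub>R u) u"
proof -
  have 1: "((\<lambda>s. f (a + s *\<^sub>R u)) has_real_derivative dd f (a + s *\<^sub>R u) u) (at s)"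
    if "0 \<le> s" "s \<le> t" for s
  proof -
    have l: "linear (dd f (a + s *\<^sub>R u))" using assms(2) that linear_frechet_derivative by blast
    have "((\<lambda>s. f (a + s *\<^sub>R u)) has_derivative (\<lambda>h. dd f (a + s *\<^sub>R u) (h *\<^sub>R u))) (at s)"
      by (rule has_derivative_compose[where f = "\<lambda>s. a + s *\<^sub>R u" and g = f])
        (auto intro!: derivative_eq_intros dd_works assms(2) that)
    moreover have "(\<lambda>h. dd f (a + s *\<^sub>R u) (h *\<^sub>R u)) = (*) (dd f (a + s *\<^sub>R u) u)"
      by (simp add: linear_cmul[OF l] fun_eq_iff)
    ultimately show ?thesis by (simp add: has_field_derivative_def)
  qed
  have "\<exists>s. 0 < s \<and> s < t \<and> f (a + t *\<^sub>R u) - f (a + 0 *\<^sub>R u) = (t - 0) * dd f (a + s *\<^sub>R u) u"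
    using MVT2[OF assms(1), of "\<lambda>s. f (a + s *\<^sub>R u)" "\<lambda>s. dd f (a + s *\<^sub>R u) u"] 1 by blast
  then show ?thesis by simp
qed

lemma second_difference_mvt:
  fixes f :: "'a::euclidean_space \<Rightarrow> real"
  assumes "smooth_on S f" "0 < t"
    and S: "\<And>r s. 0 \<le> r \<Longrightarrow> r \<le> t \<Longrightarrow> 0 \<le> s \<Longrightarrow> s \<le> t \<Longrightarrow> z + r *\<^sub>R u + s *\<^sub>R v \<in> S"
  shows "\<exists>r s. 0 < r \<and> r < t \<and> 0 < s \<and> s < t \<and>
    f (z + t *\<^sub>R u + t *\<^sub>R v) - f (z + t *\<^sub>R u) - f (z + t *\<^sub>R v) + f z
      = t * (t * dd (\<lambda>x. dd f x u) (z + r *\<^sub>R u + s *\<^sub>R v) v)"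
proof -
  define h where "h = (\<lambda>x. f (x + t *\<^sub>R v) - f x)"
  have d: "f differentiable (at (z + r *\<^sub>R u + s *\<^sub>R v))" if "0 \<le> r" "r \<le> t" "0 \<le> s" "s \<le> t" for r s
    using smooth_on_differentiable[OF assms(1) S] that by blast
  have hd: "(h has_derivative
      (\<lambda>w. dd f (z + r *\<^sub>R u + t *\<^sub>R v) w - dd f (z + r *\<^sub>R u) w)) (at (z + r *\<^sub>R u))"
    if "0 \<le> r" "r \<le> t" for r
    unfolding h_def
  proof (rule has_derivative_diff)
    have "((\<lambda>x. x + t *\<^sub>R v) has_derivative (\<lambda>w. w)) (at (z + r *\<^sub>R u))"
      by (auto intro!: derivative_eq_intros)
    from has_derivative_compose[OF this, of f] dd_works[OF d[OF that, of t]] assms(2)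
    show "((\<lambda>x. f (x + t *\<^sub>R v)) has_derivative dd f (z + r *\<^sub>R u + t *\<^sub>R v)) (at (z + r *\<^sub>R u))"
      by simp
    show "(f has_derivative dd f (z + r *\<^sub>R u)) (at (z + r *\<^sub>R u))"
      using dd_works[OF d[OF that, of 0]] assms(2) by simp
  qed
  obtain r where r: "0 < r" "r < t" "h (z + t *\<^sub>R u) - h z = t * dd h (z + r *\<^sub>R u) u"
    using mvt_direction[OF assms(2), of h z u] hd unfolding differentiable_def by blast
  have "dd h (z + r *\<^sub>R u) u = dd f (z + r *\<^sub>R u + t *\<^sub>R v) u - dd f (z + r *\<^sub>R u) u"
    using dd_eq[OF hd[of r]] r by simp
  moreover obtain s where "0 < s" "s < t"
    "dd f (z + r *\<^sub>R u + t *\<^sub>R v) u - dd f (z + r *\<^sub>R u) u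
      = t * dd (\<lambda>x. dd f x u) (z + r *\<^sub>R u + s *\<^sub>R v) v"
    using mvt_direction[OF assms(2), of "\<lambda>x. dd f x u" "z + r *\<^sub>R u" v]
      smooth_on_differentiable[OF smooth_on_dd[OF assms(1)] S] r by auto
  ultimately show ?thesis using r by (intro exI[of _ r] exI[of _ s]) (simp add: h_def)
qed

lemma second_derivative_symmetric_real:
  fixes f :: "'a::euclidean_space \<Rightarrow> real"
  assumes "smooth_on S f" "open S" "z \<in> S"
  shows "dd (\<lambda>x. dd f x u) z v = dd (\<lambda>x. dd f x v) z u"
proof -
  obtain e where e: "0 < e" "ball z e \<subseteq> S" using assms(2,3) openE by blast
  \<comment> \<open>The parallelograms with sides \<open>t n *\<^sub>R u\<close> and \<open>t n *\<^sub>R v\<close> shrink to \<open>z\<close> and all stay inside the ball of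
    radius \<open>e\<close>, because \<open>t n * N < e\<close>.\<close>
  define N where "N = norm u + norm v + 1"
  define t where "t = (\<lambda>n::nat. e / N / 2 * inverse (real (Suc n)))"
  have N: "0 < N" by (simp add: N_def add_nonneg_pos)
  have t0: "0 < t n" for n using e N by (simp add: t_def)
  have tlim: "t \<longlonglongrightarrow> 0" unfolding t_def
    using tendsto_mult_left[OF LIMSEQ_inverse_real_of_nat, of "e / N / 2"] by simp
  have nb: "norm (r *\<^sub>R u + s *\<^sub>R v) \<le> \<tau> * N"
    if "0 \<le> r" "r \<le> \<tau>" "0 \<le> s" "s \<le> \<tau>" for r s \<tau>
  proof -
    have "norm (r *\<^sub>R u + s *\<^sub>R v) \<le> r * norm u + s * norm v"
      using norm_triangle_ineq[of "r *\<^sub>R u" "s *\<^sub>R v"] that by simp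
    also have "\<dots> \<le> \<tau> * norm u + \<tau> * norm v" using that by (intro add_mono mult_right_mono) auto
    also have "\<dots> \<le> \<tau> * N" using that by (simp add: N_def algebra_simps)
    finally show ?thesis .
  qed
  have tN: "t n * N < e" for n
  proof -
    have "t n * N = e / (2 * (n + 1))" using N by (simp add: t_def divide_simps)
    also have "\<dots> < e" using e by (simp add: field_simps add_pos_nonneg)
    finally show ?thesis .
  qed
  have inS: "z + r *\<^sub>R u + s *\<^sub>R v \<in> S" if "0 \<le> r" "r \<le> t n" "0 \<le> s" "s \<le> t n" for r s n
  proof -
    have "dist z (z + r *\<^sub>R u + s *\<^sub>R v) = norm (r *\<^sub>R u + s *\<^sub>R v)"
      using dist_norm[of "z + r *\<^sub>R u + s *\<^sub>R v" z] by (simp add: dist_commute add.assoc)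
    then have "dist z (z + r *\<^sub>R u + s *\<^sub>R v) < e"
      using nb[of r "t n" s] tN[of n] that by linarith
    then show ?thesis using e by auto
  qed
  define F where "F = (\<lambda>u v n. \<lambda>r s. (0::real) < r \<and> r < t n \<and> 0 < s \<and> s < t n \<and>
    f (z + t n *\<^sub>R u + t n *\<^sub>R v) - f (z + t n *\<^sub>R u) - f (z + t n *\<^sub>R v) + f z
      = t n * (t n * dd (\<lambda>x. dd f x u) (z + r *\<^sub>R u + s *\<^sub>R v) v))"
  have "\<forall>n. \<exists>r s. F u v n r s"
    unfolding F_def using second_difference_mvt[OF assms(1) t0] inS by blast
  then obtain r s where rs: "\<And>n. F u v n (r n) (s n)" by metis
  have inS': "z + r *\<^sub>R v + s *\<^sub>R u \<in> S" if "0 \<le> r" "r \<le> t n" "0 \<le> s" "s \<le> t n" for r s n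
    using inS[of s n r] that by (simp add: algebra_simps)
  have "\<forall>n. \<exists>r s. F v u n r s"
    unfolding F_def using second_difference_mvt[OF assms(1) t0] inS' by blast
  then obtain r' s' where rs': "\<And>n. F v u n (r' n) (s' n)" by metis
  have eq: "dd (\<lambda>x. dd f x u) (z + r n *\<^sub>R u + s n *\<^sub>R v) v
      = dd (\<lambda>x. dd f x v) (z + r' n *\<^sub>R v + s' n *\<^sub>R u) u" for n
  proof -
    have "t n * (t n * dd (\<lambda>x. dd f x u) (z + r n *\<^sub>R u + s n *\<^sub>R v) v)
      = t n * (t n * dd (\<lambda>x. dd f x v) (z + r' n *\<^sub>R v + s' n *\<^sub>R u) u)"
      using rs[of n] rs'[of n] unfolding F_def by (simp add: algebra_simps)
    then show ?thesis using t0[of n] by simp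
  qed
  have lim0: "q \<longlonglongrightarrow> 0" if "\<And>n. 0 < q n \<and> q n < t n" for q
    by (rule tendsto_sandwich[OF _ _ tendsto_const tlim]) (simp_all add: that less_imp_le always_eventually)
  have lim: "(\<lambda>n. dd (\<lambda>x. dd f x a) (z + q n *\<^sub>R a + p n *\<^sub>R b) b) \<longlonglongrightarrow> dd (\<lambda>x. dd f x a) z b"
    if "q \<longlonglongrightarrow> 0" "p \<longlonglongrightarrow> 0" for q p a b
  proof -
    have "continuous_on S (\<lambda>x. dd (\<lambda>x. dd f x a) x b)"
      by (intro smooth_on_continuous smooth_on_dd assms(1))
    then have cont: "isCont (\<lambda>x. dd (\<lambda>x. dd f x a) x b) z"
      using assms(2,3) continuous_on_eq_continuous_at by blast
    have "(\<lambda>n. z + q n *\<^sub>R a + p n *\<^sub>R b) \<longlonglongrightarrow> z + 0 *\<^sub>R a + 0 *\<^sub>R b"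
      by (intro tendsto_intros that)
    then have "(\<lambda>n. z + q n *\<^sub>R a + p n *\<^sub>R b) \<longlonglongrightarrow> z" by simp
    with cont show ?thesis by (rule isCont_tendsto_compose)
  qed
  have "(\<lambda>n. dd (\<lambda>x. dd f x u) (z + r n *\<^sub>R u + s n *\<^sub>R v) v) \<longlonglongrightarrow> dd (\<lambda>x. dd f x u) z v"
    by (intro lim lim0) (use rs in \<open>auto simp: F_def\<close>)
  moreover have "(\<lambda>n. dd (\<lambda>x. dd f x u) (z + r n *\<^sub>R u + s n *\<^sub>R v) v) \<longlonglongrightarrow> dd (\<lambda>x. dd f x v) z u"
    unfolding eq by (intro lim lim0) (use rs' in \<open>auto simp: F_def\<close>)
  ultimately show ?thesis using LIMSEQ_unique by blast
qed

text \<open>Pairing with a fixed vector reduces this to real-valued functions.\<close>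

lemma second_derivative_symmetric:
  fixes f :: "'a::euclidean_space \<Rightarrow> 'b::real_inner"
  assumes "smooth_on S f" "open S" "z \<in> S"
  shows "dd (\<lambda>x. dd f x u) z v = dd (\<lambda>x. dd f x v) z u"
proof -
  have "dd (\<lambda>x. dd f x a) z b \<bullet> c = dd (\<lambda>x. dd (\<lambda>y. f y \<bullet> c) x a) z b" for a b c
  proof -
    note bl = bounded_linear_inner_left[of c]
    have "dd (\<lambda>x. dd f x a) z b \<bullet> c = dd (\<lambda>x. dd f x a \<bullet> c) z b"
      using dd_linear_comp[OF bl smooth_on_differentiable[OF smooth_on_dd[OF assms(1)] assms(3)]]
      by simp
    also have "\<dots> = dd (\<lambda>x. dd (\<lambda>y. f y \<bullet> c) x a) z b"
      using dd_linear_comp[OF bl smooth_on_differentiable[OF assms(1)]]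
      by (subst dd_cong[OF assms(2,3)]) auto
    finally show ?thesis .
  qed
  moreover have "smooth_on S (\<lambda>y. f y \<bullet> c)" for c
    using smooth_on_bounded_linear[OF assms(2) bounded_linear_inner_left assms(1)] .
  ultimately have "dd (\<lambda>x. dd f x u) z v \<bullet> c = dd (\<lambda>x. dd f x v) z u \<bullet> c" for c
    using second_derivative_symmetric_real[OF _ assms(2,3)] by metis
  then show ?thesis by (metis vector_eq_rdot)
qed

section \<open>Charts and their transition maps\<close>

abbreviation jac :: "('a, 'n::finite) chart \<Rightarrow> ('a, 'n) chart \<Rightarrow> 'a \<Rightarrow> real^'n \<Rightarrow> real^'n" where
  "jac c d p \<equiv> dd (transition c d) (cmap c p)"

text \<open>The coordinate expression of a vector field.\<close>

definition rep :: "('a, 'n::finite) chart set \<Rightarrow> ('a, 'n) chart \<Rightarrow> ('a \<Rightarrow> real^'n) \<Rightarrow> real^'n \<Rightarrow> real^'n"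
  where "rep A c X z = components A c (cinv c z) (X (cinv c z))"

text \<open>The vector field with constant components \<open>u\<close> in the chart \<open>c\<close>. It serves two purposes: it
  extends a tangent vector to a smooth field, and at a single point it is the inverse of taking components.\<close>

definition const_field :: "('a, 'n::finite) chart set \<Rightarrow> ('a, 'n) chart \<Rightarrow> real^'n \<Rightarrow> 'a \<Rightarrow> real^'n"
  where "const_field A c u p = jac c (chart_at A p) p u"

lemma coord_field_eq: "coord_field A c i = const_field A c (axis i 1)"
  by (simp add: fun_eq_iff coord_field_def const_field_def)

context
  fixes A :: "('a, 'n::finite) chart set"
  assumes at: "smooth_atlas A"
begin

lemma chart_at_in:
  assumes "p \<in> points A"
  shows "chart_at A p \<in> A" "p \<in> cdom (chart_at A p)"
proof -
  have "\<exists>c. c \<in> A \<and> p \<in> cdom c" using assms by (auto simp: points_def)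
  from someI_ex[OF this] show "chart_at A p \<in> A" "p \<in> cdom (chart_at A p)"
    unfolding chart_at_def by blast+
qed

lemma chart_points: "c \<in> A \<Longrightarrow> p \<in> cdom c \<Longrightarrow> p \<in> points A"
  by (auto simp: points_def)

lemma cinv_cmap: "c \<in> A \<Longrightarrow> p \<in> cdom c \<Longrightarrow> cinv c (cmap c p) = p"
  using at by (auto simp: smooth_atlas_def cinv_def)

lemma open_chart: "c \<in> A \<Longrightarrow> open (cmap c ` cdom c)"
  using at by (auto simp: smooth_atlas_def)

lemma open_overlap: "c \<in> A \<Longrightarrow> d \<in> A \<Longrightarrow> open (cmap c ` (cdom c \<inter> cdom d))"
  using at by (auto simp: smooth_atlas_def)

lemma smooth_transition:
  "c \<in> A \<Longrightarrow> d \<in> A \<Longrightarrow> smooth_on (cmap c ` (cdom c \<inter> cdom d)) (transition c d)"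
  using at by (auto simp: smooth_atlas_def)

lemma transition_cmap: "c \<in> A \<Longrightarrow> p \<in> cdom c \<Longrightarrow> transition c d (cmap c p) = cmap d p"
  by (simp add: transition_def cinv_cmap)

lemma transition_differentiable:
  "c \<in> A \<Longrightarrow> d \<in> A \<Longrightarrow> p \<in> cdom c \<Longrightarrow> p \<in> cdom d \<Longrightarrow>
    transition c d differentiable (at (cmap c p))"
  using smooth_on_differentiable[OF smooth_transition[of c d]] by auto

lemma linear_jac:
  "c \<in> A \<Longrightarrow> d \<in> A \<Longrightarrow> p \<in> cdom c \<Longrightarrow> p \<in> cdom d \<Longrightarrow> linear (jac c d p)"
  using transition_differentiable linear_frechet_derivative by blast

lemma jac_self:
  assumes "c \<in> A" "p \<in> cdom c"
  shows "jac c c p u = u"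
proof -
  have "jac c c p = dd (\<lambda>z. z) (cmap c p)"
    using assms by (intro dd_cong[OF open_chart[of c]]) (auto simp: transition_cmap)
  then show ?thesis by simp
qed

lemma cmap_image_Int:
  assumes "c \<in> A" "U \<subseteq> cdom c" "V \<subseteq> cdom c"
  shows "cmap c ` (U \<inter> V) = cmap c ` U \<inter> cmap c ` V"
  using at assms by (intro inj_on_image_Int[of "cmap c" "cdom c"]) (auto simp: smooth_atlas_def)

lemma jac_comp:
  assumes "c \<in> A" "d \<in> A" "e \<in> A" "p \<in> cdom c" "p \<in> cdom d" "p \<in> cdom e"
  shows "jac d e p (jac c d p u) = jac c e p u"
proof -
  \<comment> \<open>The chain rule needs the cocycle identity on an open set, hence on the triple overlap.\<close>
  let ?S = "cmap c ` (cdom c \<inter> cdom d) \<inter> cmap c ` (cdom c \<inter> cdom e)"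
  have S: "open ?S" using open_overlap assms by blast
  have "cmap c p \<in> ?S" using assms by auto
  moreover have "transition c e z = transition d e (transition c d z)" if "z \<in> ?S" for z
  proof -
    have "cmap c ` (cdom c \<inter> cdom d \<inter> (cdom c \<inter> cdom e)) = ?S"
      using assms by (intro cmap_image_Int) auto
    with that have "z \<in> cmap c ` (cdom c \<inter> cdom d \<inter> (cdom c \<inter> cdom e))" by simp
    then obtain q where "z = cmap c q" "q \<in> cdom c" "q \<in> cdom d" "q \<in> cdom e" by blast
    then show ?thesis using assms by (simp add: transition_cmap)
  qed
  ultimately have "jac c e p = dd (\<lambda>z. transition d e (transition c d z)) (cmap c p)"
    by (intro dd_cong[OF S])
  then have "jac c e p u = dd (\<lambda>z. transition d e (transition c d z)) (cmap c p) u" by simp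
  also have "\<dots> = jac d e p (jac c d p u)"
    using assms by (subst dd_chain) (auto simp: transition_cmap transition_differentiable)
  finally show ?thesis ..
qed

lemma jac_inverse:
  assumes "c \<in> A" "d \<in> A" "p \<in> cdom c" "p \<in> cdom d"
  shows "jac d c p (jac c d p u) = u"
  using jac_comp[of c d c p u] jac_self assms by simp

lemma components_eq: "components A c p = jac (chart_at A p) c p"
  by (simp add: components_def fun_eq_iff)

lemma linear_components: "c \<in> A \<Longrightarrow> p \<in> cdom c \<Longrightarrow> linear (components A c p)"
  unfolding components_eq using chart_at_in chart_points linear_jac by blast

lemma components_chart_at: "p \<in> points A \<Longrightarrow> components A (chart_at A p) p v = v"
  unfolding components_eq using chart_at_in jac_self by blast

lemma components_jac:
  assumes "c \<in> A" "d \<in> A" "p \<in> cdom c" "p \<in> cdom d"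
  shows "jac c d p (components A c p v) = components A d p v"
  unfolding components_eq using assms chart_points chart_at_in by (intro jac_comp) auto

lemma components_const_field:
  assumes "c \<in> A" "p \<in> cdom c"
  shows "components A c p (const_field A c u p) = u"
  unfolding components_eq const_field_def
  using assms chart_points chart_at_in by (intro jac_inverse) auto

lemma const_field_components:
  assumes "c \<in> A" "p \<in> cdom c"
  shows "const_field A c (components A c p v) p = v"
  unfolding components_eq const_field_def
  using assms chart_points chart_at_in by (intro jac_inverse) auto

lemma components_inject:
  assumes "c \<in> A" "p \<in> cdom c"
  shows "components A c p v = components A c p w \<longleftrightarrow> v = w"
  using const_field_components[OF assms] by metis

lemma rep_cmap:
  "c \<in> A \<Longrightarrow> p \<in> cdom c \<Longrightarrow> rep A c X (cmap c p) = components A c p (X p)"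
  by (simp add: rep_def cinv_cmap)

lemma rep_const_field:
  "c \<in> A \<Longrightarrow> z \<in> cmap c ` cdom c \<Longrightarrow> rep A c (const_field A c u) z = u"
  by (auto simp: rep_cmap components_const_field)

lemma rep_transition:
  assumes "c \<in> A" "d \<in> A" "z \<in> cmap c ` (cdom c \<inter> cdom d)"
  shows "rep A d X (transition c d z) = dd (transition c d) z (rep A c X z)"
  using assms by (auto simp: transition_cmap rep_cmap components_jac)

section \<open>Smooth functions and vector fields in charts\<close>

lemma openin_chart_open:
  assumes "openin (atlas_topology A) U" "c \<in> A"
  shows "open (cmap c ` (U \<inter> cdom c))"
  using assms openin_atlas_topology[OF at] by blast

lemma openin_cdom: "c \<in> A \<Longrightarrow> openin (atlas_topology A) (cdom c)"
  using open_overlap by (auto simp: openin_atlas_topology[OF at] points_def Int_commute)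

lemma openin_points: "openin (atlas_topology A) U \<Longrightarrow> p \<in> U \<Longrightarrow> p \<in> points A"
  using openin_atlas_topology[OF at] by blast

lemma smooth_vf_openin: "smooth_vf A U X \<Longrightarrow> openin (atlas_topology A) U"
  by (simp add: smooth_vf_def)

lemma smooth_vf_iff:
  "smooth_vf A U X \<longleftrightarrow> openin (atlas_topology A) U \<and>
     (\<forall>c\<in>A. smooth_on (cmap c ` (U \<inter> cdom c)) (rep A c X))"
  by (simp add: smooth_vf_def rep_def[abs_def])

lemma smooth_rep: "smooth_vf A U X \<Longrightarrow> c \<in> A \<Longrightarrow> smooth_on (cmap c ` (U \<inter> cdom c)) (rep A c X)"
  by (simp add: smooth_vf_iff)

lemma smooth_vf_restrict:
  assumes "smooth_vf A U X" "openin (atlas_topology A) V" "V \<subseteq> U"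
  shows "smooth_vf A V X"
  using assms smooth_on_subset[of "cmap _ ` (U \<inter> cdom _)" _ "cmap _ ` (V \<inter> cdom _)"]
  unfolding smooth_vf_iff by (meson Int_mono image_mono order_refl)

lemma rep_cong:
  assumes "c \<in> A" "\<And>p. p \<in> U \<Longrightarrow> X p = Y p" "z \<in> cmap c ` (U \<inter> cdom c)"
  shows "rep A c X z = rep A c Y z"
  using assms by (auto simp: rep_cmap)

lemma smooth_vf_cong:
  assumes "smooth_vf A U X" "\<And>p. p \<in> U \<Longrightarrow> X p = Y p"
  shows "smooth_vf A U Y"
  unfolding smooth_vf_iff
proof (intro conjI ballI)
  show o: "openin (atlas_topology A) U" using assms(1) smooth_vf_openin by blast
  fix c assume c: "c \<in> A"
  show "smooth_on (cmap c ` (U \<inter> cdom c)) (rep A c Y)"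
    by (rule smooth_on_transform[OF openin_chart_open[OF o c] smooth_rep[OF assms(1) c]])
      (use rep_cong[OF c assms(2)] in simp)
qed

lemma smooth_vf_add:
  assumes "smooth_vf A U X" "smooth_vf A U Y"
  shows "smooth_vf A U (\<lambda>p. X p + Y p)"
  unfolding smooth_vf_iff
proof (intro conjI ballI)
  show o: "openin (atlas_topology A) U" using assms(1) smooth_vf_openin by blast
  fix c assume c: "c \<in> A"
  have "rep A c (\<lambda>p. X p + Y p) z = rep A c X z + rep A c Y z" if "z \<in> cmap c ` (U \<inter> cdom c)" for z
    using that c by (auto simp: rep_cmap linear_add[OF linear_components])
  then show "smooth_on (cmap c ` (U \<inter> cdom c)) (rep A c (\<lambda>p. X p + Y p))"
    by (rule smooth_on_transform[OF openin_chart_open[OF o c] smooth_on_add[OF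
            openin_chart_open[OF o c] smooth_rep[OF assms(1) c] smooth_rep[OF assms(2) c]]])
qed

lemma smooth_vf_scaleR:
  assumes "smooth_fun A U f" "smooth_vf A U X"
  shows "smooth_vf A U (\<lambda>p. f p *\<^sub>R X p)"
  unfolding smooth_vf_iff
proof (intro conjI ballI)
  show o: "openin (atlas_topology A) U" using assms(2) smooth_vf_openin by blast
  fix c assume c: "c \<in> A"
  have "rep A c (\<lambda>p. f p *\<^sub>R X p) z = (f \<circ> cinv c) z *\<^sub>R rep A c X z"
    if "z \<in> cmap c ` (U \<inter> cdom c)" for z
    using that c by (auto simp: rep_cmap cinv_cmap linear_cmul[OF linear_components])
  moreover have "smooth_on (cmap c ` (U \<inter> cdom c)) (f \<circ> cinv c)"
    using assms(1) c by (simp add: smooth_fun_def)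
  ultimately show "smooth_on (cmap c ` (U \<inter> cdom c)) (rep A c (\<lambda>p. f p *\<^sub>R X p))"
    by (intro smooth_on_transform[OF openin_chart_open[OF o c]
          smooth_on_scaleR[OF openin_chart_open[OF o c] _ smooth_rep[OF assms(2) c]]])
qed

lemma smooth_fun_const: "openin (atlas_topology A) U \<Longrightarrow> smooth_fun A U (\<lambda>p. r)"
  by (simp add: smooth_fun_def o_def smooth_on_const)

lemma smooth_vf_diff:
  assumes "smooth_vf A U X" "smooth_vf A U Y"
  shows "smooth_vf A U (\<lambda>p. X p - Y p)"
  using smooth_vf_add[OF assms(1) smooth_vf_scaleR[OF smooth_fun_const assms(2), of "-1"]]
    smooth_vf_openin[OF assms(1)] by simp

lemma smooth_vf_zero:
  assumes "openin (atlas_topology A) U"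
  shows "smooth_vf A U (\<lambda>p. 0)"
  unfolding smooth_vf_iff
proof (intro conjI ballI)
  show "openin (atlas_topology A) U" by fact
  fix c assume c: "c \<in> A"
  have "rep A c (\<lambda>p. 0) z = 0" if "z \<in> cmap c ` (U \<inter> cdom c)" for z
    using that c by (auto simp: rep_cmap linear_0[OF linear_components])
  then show "smooth_on (cmap c ` (U \<inter> cdom c)) (rep A c (\<lambda>p. 0))"
    by (rule smooth_on_transform[OF openin_chart_open[OF assms c] smooth_on_const])
qed

lemma smooth_vf_sum:
  assumes "openin (atlas_topology A) U" "\<And>i. i \<in> I \<Longrightarrow> smooth_vf A U (X i)"
  shows "smooth_vf A U (\<lambda>p. \<Sum>i\<in>I. X i p)"
  using assms(2)
  by (induction I rule: infinite_finite_induct) (auto intro: smooth_vf_zero assms(1) smooth_vf_add)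

text \<open>On the domain of one chart, smoothness needs to be checked in that chart only; the same holds for
  vector fields below. This is how smooth functions and fields are produced from coordinate
  expressions.\<close>

lemma smooth_fun_chart:
  assumes "c \<in> A" "openin (atlas_topology A) U" "U \<subseteq> cdom c" "smooth_on (cmap c ` U) (f \<circ> cinv c)"
  shows "smooth_fun A U f"
  unfolding smooth_fun_def
proof (intro conjI ballI)
  show "openin (atlas_topology A) U" by fact
  fix d assume d: "d \<in> A"
  have o: "open (cmap d ` (U \<inter> cdom d))" "open (cmap c ` U)"
    using openin_chart_open[OF assms(2) d] openin_chart_open[OF assms(2,1)] assms(3)
    by (auto simp: Int_absorb2)
  have "smooth_on (cmap d ` (U \<inter> cdom d)) (\<lambda>z. (f \<circ> cinv c) (transition d c z))"
    by (rule smooth_on_compose[OF o _ _ assms(4)])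
      (use d assms(3) in \<open>auto simp: transition_cmap
         intro: smooth_on_subset[OF smooth_transition[OF d assms(1)]]\<close>)
  then show "smooth_on (cmap d ` (U \<inter> cdom d)) (f \<circ> cinv d)"
    by (rule smooth_on_cong[OF o(1), THEN iffD1, rotated])
      (use d assms in \<open>auto simp: transition_cmap cinv_cmap\<close>)
qed

lemma smooth_vf_chart:
  assumes "c \<in> A" "openin (atlas_topology A) U" "U \<subseteq> cdom c" "smooth_on (cmap c ` U) (rep A c X)"
  shows "smooth_vf A U X"
  unfolding smooth_vf_iff
proof (intro conjI ballI)
  show "openin (atlas_topology A) U" by fact
  fix d assume d: "d \<in> A"
  have o: "open (cmap d ` (U \<inter> cdom d))" "open (cmap c ` U)"
    using openin_chart_open[OF assms(2) d] openin_chart_open[OF assms(2,1)] assms(3)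
    by (auto simp: Int_absorb2)
  have t: "smooth_on (cmap d ` (U \<inter> cdom d)) (transition d c)"
    by (rule smooth_on_subset[OF smooth_transition[OF d assms(1)]]) (use assms(3) in auto)
  have im: "transition d c ` cmap d ` (U \<inter> cdom d) \<subseteq> cmap c ` U"
    using d by (auto simp: transition_cmap)
  have im': "transition d c ` cmap d ` (U \<inter> cdom d) \<subseteq> cmap c ` (cdom c \<inter> cdom d)"
    using d assms(3) by (auto simp: transition_cmap)
  have *: "smooth_on (cmap d ` (U \<inter> cdom d)) (\<lambda>z. rep A c X (transition d c z))"
    by (rule smooth_on_compose[OF o im t assms(4)])
  have **: "smooth_on (cmap d ` (U \<inter> cdom d)) (\<lambda>z. dd (transition c d) (transition d c z) u)" for u
    by (rule smooth_on_compose[OF o(1) open_overlap[OF assms(1) d] im' t])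
      (rule smooth_on_dd[OF smooth_transition[OF assms(1) d]])
  have "smooth_on (cmap d ` (U \<inter> cdom d))
      (\<lambda>z. dd (transition c d) (transition d c z) (rep A c X (transition d c z)))"
    by (rule smooth_on_linear_field[OF o(1) _ ** *])
      (use d assms in \<open>auto simp: transition_cmap intro!: linear_jac\<close>)
  then show "smooth_on (cmap d ` (U \<inter> cdom d)) (rep A d X)"
    by (rule smooth_on_cong[OF o(1), THEN iffD1, rotated])
      (use d assms in \<open>auto simp: transition_cmap rep_cmap components_jac\<close>)
qed

lemma smooth_vf_const_field:
  assumes "c \<in> A"
  shows "smooth_vf A (cdom c) (const_field A c u)"
proof (rule smooth_vf_chart[OF assms openin_cdom[OF assms] order_refl])
  show "smooth_on (cmap c ` cdom c) (rep A c (const_field A c u))"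
    by (rule smooth_on_transform[OF open_chart[OF assms] smooth_on_const rep_const_field[OF assms]])
qed

lemma rep_differentiable:
  "smooth_vf A U X \<Longrightarrow> c \<in> A \<Longrightarrow> p \<in> U \<Longrightarrow> p \<in> cdom c \<Longrightarrow> rep A c X differentiable (at (cmap c p))"
  using smooth_on_differentiable[OF smooth_rep] by auto

text \<open>The directional derivative is defined through the chart chosen at the point; the chain rule makes it
  available in every chart.\<close>

lemma dir_deriv_chart:
  assumes "smooth_fun A U f" "c \<in> A" "p \<in> U" "p \<in> cdom c"
  shows "dir_deriv A X f p = dd (f \<circ> cinv c) (cmap c p) (components A c p (X p))"
proof -
  define d where "d = chart_at A p"
  have d: "d \<in> A" "p \<in> cdom d" using chart_at_in chart_points assms by (auto simp: d_def)
  have f: "(f \<circ> cinv c) differentiable (at (cmap c p))"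
    using smooth_on_differentiable[of "cmap c ` (U \<inter> cdom c)" "f \<circ> cinv c"] assms
    by (auto simp: smooth_fun_def)
  have "dir_deriv A X f p = dd (f \<circ> cinv d) (cmap d p) (X p)"
    by (simp add: dir_deriv_def d_def Let_def)
  also have "dd (f \<circ> cinv d) (cmap d p) = dd (\<lambda>z. (f \<circ> cinv c) (transition d c z)) (cmap d p)"
    by (rule dd_cong[OF open_overlap[OF d(1) assms(2)]])
      (use d assms in \<open>auto simp: transition_cmap cinv_cmap\<close>)
  also have "\<dots> (X p) = dd (f \<circ> cinv c) (cmap c p) (jac d c p (X p))"
    using d assms f by (subst dd_chain) (auto simp: transition_cmap transition_differentiable)
  finally show ?thesis by (simp add: components_eq d_def)
qed

text \<open>The derivative of a vector field is not a tensor: under a change of coordinates it picks up the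
  second derivative of the transition map. This term is what the Christoffel maps have to
  compensate.\<close>

lemma dd_rep_transition:
  assumes "smooth_vf A U X" "c \<in> A" "d \<in> A" "p \<in> U" "p \<in> cdom c" "p \<in> cdom d"
  shows "dd (rep A d X) (cmap d p) (jac c d p u) =
    dd (\<lambda>z. dd (transition c d) z (rep A c X (cmap c p))) (cmap c p) u
      + jac c d p (dd (rep A c X) (cmap c p) u)"
proof -
  let ?S = "cmap c ` (cdom c \<inter> cdom d)"
  note S = open_overlap[OF assms(2,3)] and t = smooth_transition[OF assms(2,3)]
  have z: "cmap c p \<in> ?S" using assms by auto
  have "dd (rep A d X) (cmap d p) (jac c d p u)
      = dd (\<lambda>z. rep A d X (transition c d z)) (cmap c p) u"
    using assms
    by (subst dd_chain) (auto simp: transition_cmap transition_differentiable rep_differentiable)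
  also have "\<dots> = dd (\<lambda>z. dd (transition c d) z (rep A c X z)) (cmap c p) u"
    by (subst dd_cong[OF S z rep_transition[OF assms(2,3)]]) auto
  also have "\<dots> = dd (\<lambda>z. dd (transition c d) z (rep A c X (cmap c p))) (cmap c p) u
      + jac c d p (dd (rep A c X) (cmap c p) u)"
    by (rule dd_linear_field[OF S z])
      (use smooth_on_linear_dd[OF t] smooth_on_differentiable[OF smooth_on_dd[OF t] z]
         rep_differentiable assms in auto)
  finally show ?thesis .
qed

end

section \<open>Connections in charts\<close>

text \<open>The Christoffel symbols of a chart are encoded as one bilinear map \<open>G c z u v\<close>, with value
  \<open>\<Sum>\<^sub>i\<^sub>j \<Gamma>\<^sub>i\<^sub>j\<^sup>k u\<^sub>i v\<^sub>j\<close> in the \<open>k\<close>-th component, at the coordinates \<open>z\<close>. Working with vectors instead of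
  indices lets linearity replace almost all manipulations of sums.\<close>

type_synonym ('a, 'n) christoffel_maps =
  "('a, 'n) chart \<Rightarrow> real^'n \<Rightarrow> real^'n \<Rightarrow> real^'n \<Rightarrow> real^'n"

definition christoffel_family ::
    "('a, 'n::finite) chart set \<Rightarrow> ('a, 'n) christoffel_maps \<Rightarrow> bool" where
  "christoffel_family A G \<longleftrightarrow>
     (\<forall>c\<in>A. (\<forall>z\<in>cmap c ` cdom c. bilinear (G c z)) \<and>
        (\<forall>u v. smooth_on (cmap c ` cdom c) (\<lambda>z. G c z u v)))"

definition symmetric_family ::
    "('a, 'n::finite) chart set \<Rightarrow> ('a, 'n) christoffel_maps \<Rightarrow> bool" where
  "symmetric_family A G \<longleftrightarrow> (\<forall>c\<in>A. \<forall>z\<in>cmap c ` cdom c. \<forall>u v. G c z u v = G c z v u)"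

definition christoffel_law ::
    "('a, 'n::finite) chart set \<Rightarrow> ('a, 'n) christoffel_maps \<Rightarrow> bool" where
  "christoffel_law A G \<longleftrightarrow>
     (\<forall>c\<in>A. \<forall>d\<in>A. \<forall>p\<in>cdom c \<inter> cdom d. \<forall>u v.
        jac c d p (G c (cmap c p) u v) =
          dd (\<lambda>z. dd (transition c d) z v) (cmap c p) u + G d (cmap d p) (jac c d p u) (jac c d p v))"

definition represents ::
    "('a, 'n::finite) chart set \<Rightarrow> ('a, 'n) christoffel_maps \<Rightarrow> ('a, 'n) cov_deriv \<Rightarrow> bool" where
  "represents A G D \<longleftrightarrow>
     (\<forall>U X Y. smooth_vf A U X \<and> smooth_vf A U Y \<longrightarrow> (\<forall>c\<in>A. \<forall>p\<in>U \<inter> cdom c.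
        components A c p (D X Y p) =
          dd (rep A c Y) (cmap c p) (components A c p (X p))
            + G c (cmap c p) (components A c p (X p)) (components A c p (Y p))))"

definition christoffel_map :: "('a, 'n::finite) chart set \<Rightarrow> ('a, 'n) cov_deriv \<Rightarrow> ('a, 'n) christoffel_maps" where
  "christoffel_map A D c z u v = (\<Sum>i\<in>UNIV. \<Sum>j\<in>UNIV. (u $ i * v $ j) *\<^sub>R
     components A c (cinv c z) (D (coord_field A c i) (coord_field A c j) (cinv c z)))"

lemma christoffel_familyD:
  assumes "christoffel_family A G" "c \<in> A"
  shows "z \<in> cmap c ` cdom c \<Longrightarrow> bilinear (G c z)"
    and "smooth_on (cmap c ` cdom c) (\<lambda>z. G c z u v)"
  using assms by (auto simp: christoffel_family_def)

text \<open>The coordinate formula for \<open>R(u,v)w\<close> at \<open>z\<close> in terms of the Christoffel map \<open>G\<close>.\<close>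

definition local_curv :: "(real^'n \<Rightarrow> real^'n \<Rightarrow> real^'n \<Rightarrow> real^'n) \<Rightarrow> real^'n \<Rightarrow>
    real^'n \<Rightarrow> real^'n \<Rightarrow> real^'n \<Rightarrow> real^'n::finite" where
  "local_curv G z u v w = dd (\<lambda>x. G x v w) z u - dd (\<lambda>x. G x u w) z v + G z u (G z v w) - G z v (G z u w)"

lemma linear_eq_sum_axis:
  fixes L :: "real^'n \<Rightarrow> 'b::real_vector"
  assumes "linear L"
  shows "L u = (\<Sum>i\<in>UNIV. u $ i *\<^sub>R L (axis i 1))"
proof -
  have "L u = L (\<Sum>i\<in>UNIV. u $ i *\<^sub>R axis i 1)"
    using basis_expansion[of u] by (simp add: scalar_mult_eq_scaleR)
  also have "\<dots> = (\<Sum>i\<in>UNIV. u $ i *\<^sub>R L (axis i 1))"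
    by (simp add: linear_sum[OF assms] linear_cmul[OF assms])
  finally show ?thesis .
qed

lemma bilinear_christoffel_map: "bilinear (christoffel_map A D c z)"
  unfolding bilinear_def
proof (intro conjI allI)
  show "linear (christoffel_map A D c z u)" for u
    by (rule linearI) (simp_all add: christoffel_map_def algebra_simps sum.distrib scaleR_sum_right)
  show "linear (\<lambda>u. christoffel_map A D c z u v)" for v
    by (rule linearI) (simp_all add: christoffel_map_def algebra_simps sum.distrib scaleR_sum_right)
qed

lemma connection_smooth:
  assumes "connection A D" "smooth_vf A U X" "smooth_vf A U Y"
  shows "smooth_vf A U (D X Y)"
  using assms(1)[unfolded connection_def, THEN conjunct1, rule_format, of U X Y] assms(2-3) by blast

lemma connection_cong:
  assumes "connection A D" "smooth_vf A U X" "smooth_vf A U X'" "smooth_vf A U Y" "smooth_vf A U Y'"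
    "\<And>q. q \<in> U \<Longrightarrow> X q = X' q" "\<And>q. q \<in> U \<Longrightarrow> Y q = Y' q" "p \<in> U"
  shows "D X Y p = D X' Y' p"
  using assms(1)[unfolded connection_def, THEN conjunct2, THEN conjunct1, rule_format,
      of U X X' Y Y' p] assms(2-8) by blast

lemma connection_add_left:
  assumes "connection A D" "smooth_vf A U X" "smooth_vf A U X'" "smooth_vf A U Y" "p \<in> U"
  shows "D (\<lambda>q. X q + X' q) Y p = D X Y p + D X' Y p"
  using assms(1)[unfolded connection_def, THEN conjunct2, THEN conjunct2, THEN conjunct1,
      rule_format, of U X X' Y p] assms(2-5) by blast

lemma connection_scale_left:
  assumes "connection A D" "smooth_fun A U f" "smooth_vf A U X" "smooth_vf A U Y" "p \<in> U"
  shows "D (\<lambda>q. f q *\<^sub>R X q) Y p = f p *\<^sub>R D X Y p"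
  using assms(1)[unfolded connection_def, THEN conjunct2, THEN conjunct2, THEN conjunct2, THEN conjunct1,
      rule_format, of U f X Y p] assms(2-5) by blast

lemma connection_add_right:
  assumes "connection A D" "smooth_vf A U X" "smooth_vf A U Y" "smooth_vf A U Y'" "p \<in> U"
  shows "D X (\<lambda>q. Y q + Y' q) p = D X Y p + D X Y' p"
  using assms(1)[unfolded connection_def, THEN conjunct2, THEN conjunct2, THEN conjunct2, THEN conjunct2, THEN conjunct1,
      rule_format, of U X Y Y' p] assms(2-5) by blast

lemma connection_scale_right:
  assumes "connection A D" "smooth_fun A U f" "smooth_vf A U X" "smooth_vf A U Y" "p \<in> U"
  shows "D X (\<lambda>q. f q *\<^sub>R Y q) p = dir_deriv A X f p *\<^sub>R Y p + f p *\<^sub>R D X Y p"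
  using assms(1)[unfolded connection_def, THEN conjunct2, THEN conjunct2, THEN conjunct2, THEN conjunct2, THEN conjunct2,
      rule_format, of U f X Y p] assms(2-5) by blast

lemma torsion_freeD:
  assumes "torsion_free A D" "smooth_vf A U X" "smooth_vf A U Y" "p \<in> U"
  shows "D X Y p - D Y X p = lie_bracket A X Y p"
  using assms unfolding torsion_free_def by blast

context
  fixes A :: "('a, 'n::finite) chart set"
  assumes at: "smooth_atlas A"
begin

lemma connection_sum_left:
  assumes "connection A D" "openin (atlas_topology A) U" "finite I"
    "\<And>i. i \<in> I \<Longrightarrow> smooth_vf A U (X i)" "smooth_vf A U Y" "p \<in> U"
  shows "D (\<lambda>q. \<Sum>i\<in>I. X i q) Y p = (\<Sum>i\<in>I. D (X i) Y p)"
  using assms(3,4)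
proof (induction I)
  case empty
  have "D (\<lambda>q. 0 + 0) Y p = D (\<lambda>q. 0) Y p + D (\<lambda>q. 0) Y p"
    using connection_add_left[OF assms(1) _ _ assms(5,6), of "\<lambda>q. 0" "\<lambda>q. 0"]
      smooth_vf_zero[OF at assms(2)] by simp
  then show ?case by simp
next
  case (insert i I)
  have "D (\<lambda>q. X i q + (\<Sum>i\<in>I. X i q)) Y p = D (X i) Y p + D (\<lambda>q. \<Sum>i\<in>I. X i q) Y p"
    using insert by (intro connection_add_left[OF assms(1) _ _ assms(5,6), of "X i" "\<lambda>q. \<Sum>i\<in>I. X i q"]
        smooth_vf_sum[OF at assms(2)]) auto
  then show ?case using insert by simp
qed

lemma connection_sum_right:
  assumes "connection A D" "openin (atlas_topology A) U" "finite I"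
    "\<And>i. i \<in> I \<Longrightarrow> smooth_vf A U (Y i)" "smooth_vf A U X" "p \<in> U"
  shows "D X (\<lambda>q. \<Sum>i\<in>I. Y i q) p = (\<Sum>i\<in>I. D X (Y i) p)"
  using assms(3,4)
proof (induction I)
  case empty
  have "D X (\<lambda>q. 0 + 0) p = D X (\<lambda>q. 0) p + D X (\<lambda>q. 0) p"
    using connection_add_right[OF assms(1,5) _ _ assms(6), of "\<lambda>q. 0" "\<lambda>q. 0"]
      smooth_vf_zero[OF at assms(2)] by simp
  then show ?case by simp
next
  case (insert i I)
  have "D X (\<lambda>q. Y i q + (\<Sum>i\<in>I. Y i q)) p = D X (Y i) p + D X (\<lambda>q. \<Sum>i\<in>I. Y i q) p"
    using insert by (intro connection_add_right[OF assms(1,5) _ _ assms(6), of "Y i" "\<lambda>q. \<Sum>i\<in>I. Y i q"]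
        smooth_vf_sum[OF at assms(2)]) auto
  then show ?case using insert by simp
qed

lemma field_in_coordinates:
  assumes "c \<in> A" "q \<in> cdom c"
  shows "X q = (\<Sum>i\<in>UNIV. components A c q (X q) $ i *\<^sub>R coord_field A c i q)"
proof -
  have q: "q \<in> points A" using chart_points[OF at] assms by blast
  have l: "linear (jac c (chart_at A q) q)"
    using linear_jac[OF at] assms chart_at_in[OF at q] by blast
  have "X q = const_field A c (components A c q (X q)) q"
    by (simp add: const_field_components[OF at assms])
  then show ?thesis
    unfolding const_field_def coord_field_eq using linear_eq_sum_axis[OF l] by metis
qed

lemma smooth_component:
  assumes "smooth_vf A U X" "c \<in> A" "U \<subseteq> cdom c"
  shows "smooth_fun A U (\<lambda>q. components A c q (X q) $ i)"
proof (rule smooth_fun_chart[OF at assms(2) smooth_vf_openin[OF at assms(1)] assms(3)])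
  have o: "open (cmap c ` U)" "smooth_on (cmap c ` U) (rep A c X)"
    using openin_chart_open[OF at smooth_vf_openin[OF at assms(1)] assms(2)]
      smooth_rep[OF at assms(1,2)] assms(3) by (auto simp: Int_absorb2)
  then have "smooth_on (cmap c ` U) (\<lambda>z. rep A c X z $ i)"
    using smooth_on_vec_iff by blast
  then show "smooth_on (cmap c ` U) ((\<lambda>q. components A c q (X q) $ i) \<circ> cinv c)"
    by (simp add: rep_def o_def)
qed

lemma smooth_vf_coord_field: "c \<in> A \<Longrightarrow> smooth_vf A (cdom c) (coord_field A c i)"
  unfolding coord_field_eq by (rule smooth_vf_const_field[OF at])

text \<open>A connection acts on fields, but it is determined by its values on the coordinate fields: locality
  restricts the fields to a chart domain, where they are combinations of coordinate fields with
  smooth coefficients, and then function-linearity in the first argument and the Leibniz rule in the second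
  apply.\<close>

lemma represents_christoffel_map:
  assumes con: "connection A D"
  shows "represents A (christoffel_map A D) D"
  unfolding represents_def
proof (intro allI impI ballI)
  fix U X Y c p
  assume XY: "smooth_vf A U X \<and> smooth_vf A U Y" and c: "c \<in> A" and p: "p \<in> U \<inter> cdom c"
  define V where "V = U \<inter> cdom c"
  define E where "E = coord_field A c"
  define x where "x = (\<lambda>i q. components A c q (X q) $ i)"
  define y where "y = (\<lambda>i q. components A c q (Y q) $ i)"
  have V: "openin (atlas_topology A) V"
    unfolding V_def using XY smooth_vf_openin[OF at] openin_cdom[OF at c] by (intro openin_Int) blast+
  have VU: "V \<subseteq> U" "V \<subseteq> cdom c" "p \<in> V" using p by (auto simp: V_def)
  note X = smooth_vf_restrict[OF at conjunct1[OF XY] V VU(1)]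
  note Y = smooth_vf_restrict[OF at conjunct2[OF XY] V VU(1)]
  have E: "smooth_vf A V (E i)" for i
    unfolding E_def by (rule smooth_vf_restrict[OF at smooth_vf_coord_field[OF c] V VU(2)])
  have x: "smooth_fun A V (x i)" and y: "smooth_fun A V (y i)" for i
    unfolding x_def y_def by (rule smooth_component[OF _ c VU(2)], fact)+
  have Xs: "X q = (\<Sum>i\<in>UNIV. x i q *\<^sub>R E i q)" and Ys: "Y q = (\<Sum>i\<in>UNIV. y i q *\<^sub>R E i q)"
    if "q \<in> V" for q
    unfolding x_def y_def E_def using that VU(2) by (blast intro: field_in_coordinates[OF c])+
  have xE: "smooth_vf A V (\<lambda>q. x i q *\<^sub>R E i q)" and yE: "smooth_vf A V (\<lambda>q. y i q *\<^sub>R E i q)" for i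
    by (rule smooth_vf_scaleR[OF at x E], rule smooth_vf_scaleR[OF at y E])
  have pc: "p \<in> cdom c" using p by blast
  note lin = linear_components[OF at c pc]
  have "D X Y p = D (\<lambda>q. \<Sum>i\<in>UNIV. x i q *\<^sub>R E i q) Y p"
    by (rule connection_cong[OF con X smooth_vf_sum[OF at V xE] Y Y Xs refl VU(3)])
  also have "\<dots> = (\<Sum>i\<in>UNIV. D (\<lambda>q. x i q *\<^sub>R E i q) Y p)"
    by (rule connection_sum_left[OF con V finite xE Y VU(3)])
  also have "\<dots> = (\<Sum>i\<in>UNIV. x i p *\<^sub>R D (E i) Y p)"
    by (simp add: connection_scale_left[OF con x E Y VU(3)])
  finally have 1: "D X Y p = (\<Sum>i\<in>UNIV. x i p *\<^sub>R D (E i) Y p)" .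
  have 2: "components A c p (D (E i) Y p) = dd (rep A c Y) (cmap c p) (axis i 1)
      + (\<Sum>j\<in>UNIV. y j p *\<^sub>R components A c p (D (E i) (E j) p))" for i
  proof -
    have "D (E i) Y p = D (E i) (\<lambda>q. \<Sum>j\<in>UNIV. y j q *\<^sub>R E j q) p"
      by (rule connection_cong[OF con E E Y smooth_vf_sum[OF at V yE] refl Ys VU(3)])
    also have "\<dots> = (\<Sum>j\<in>UNIV. D (E i) (\<lambda>q. y j q *\<^sub>R E j q) p)"
      by (rule connection_sum_right[OF con V finite yE E VU(3)])
    also have "\<dots> = (\<Sum>j\<in>UNIV. dir_deriv A (E i) (y j) p *\<^sub>R E j p + y j p *\<^sub>R D (E i) (E j) p)"
      by (simp add: connection_scale_right[OF con y E E VU(3)])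
    finally have "components A c p (D (E i) Y p) =
        (\<Sum>j\<in>UNIV. dir_deriv A (E i) (y j) p *\<^sub>R components A c p (E j p)
           + y j p *\<^sub>R components A c p (D (E i) (E j) p))"
      by (simp add: linear_sum[OF lin] linear_add[OF lin] linear_cmul[OF lin])
    also have "\<dots> = (\<Sum>j\<in>UNIV. dd (rep A c Y) (cmap c p) (axis i 1) $ j *\<^sub>R axis j 1)
        + (\<Sum>j\<in>UNIV. y j p *\<^sub>R components A c p (D (E i) (E j) p))"
    proof -
      have "dir_deriv A (E i) (y j) p = dd (rep A c Y) (cmap c p) (axis i 1) $ j" for j
      proof -
        have "dir_deriv A (E i) (y j) p = dd (y j \<circ> cinv c) (cmap c p) (axis i 1)"
          using dir_deriv_chart[OF at y c VU(3) pc, of "E i" j] components_const_field[OF at c pc]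
          by (simp add: E_def coord_field_eq)
        also have "y j \<circ> cinv c = (\<lambda>z. rep A c Y z $ j)"
          by (simp add: y_def rep_def o_def)
        also have "dd \<dots> (cmap c p) (axis i 1) = dd (rep A c Y) (cmap c p) (axis i 1) $ j"
          by (rule dd_linear_comp[OF bounded_linear_vec_nth])
            (rule rep_differentiable[OF at Y c VU(3) pc])
        finally show ?thesis .
      qed
      moreover have "components A c p (E j p) = axis j 1" for j
        using components_const_field[OF at c pc] by (simp add: E_def coord_field_eq)
      ultimately show ?thesis by (simp add: sum.distrib)
    qed
    also have "(\<Sum>j\<in>UNIV. dd (rep A c Y) (cmap c p) (axis i 1) $ j *\<^sub>R axis j 1)
        = dd (rep A c Y) (cmap c p) (axis i 1)"
      using basis_expansion[of "dd (rep A c Y) (cmap c p) (axis i 1)"]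
      by (simp add: scalar_mult_eq_scaleR)
    finally show ?thesis .
  qed
  have "components A c p (D X Y p) = (\<Sum>i\<in>UNIV. x i p *\<^sub>R dd (rep A c Y) (cmap c p) (axis i 1))
     + (\<Sum>i\<in>UNIV. \<Sum>j\<in>UNIV. (x i p * y j p) *\<^sub>R components A c p (D (E i) (E j) p))"
    unfolding 1 linear_sum[OF lin] linear_cmul[OF lin] 2
    by (simp add: scaleR_add_right scaleR_sum_right sum.distrib)
  also have "(\<Sum>i\<in>UNIV. x i p *\<^sub>R dd (rep A c Y) (cmap c p) (axis i 1))
      = dd (rep A c Y) (cmap c p) (components A c p (X p))"
    unfolding x_def
    by (rule linear_eq_sum_axis[OF linear_frechet_derivative[OF
            rep_differentiable[OF at Y c VU(3) pc]], symmetric])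
  finally show "components A c p (D X Y p) =
      dd (rep A c Y) (cmap c p) (components A c p (X p)) +
      christoffel_map A D c (cmap c p) (components A c p (X p)) (components A c p (Y p))"
    by (simp add: christoffel_map_def cinv_cmap[OF at c pc] x_def y_def E_def)
qed

lemma christoffel_family_christoffel_map:
  assumes "connection A D"
  shows "christoffel_family A (christoffel_map A D)"
  unfolding christoffel_family_def
proof (intro ballI conjI allI bilinear_christoffel_map)
  fix c u v assume c: "c \<in> A"
  have "smooth_on (cmap c ` cdom c) (rep A c (D (coord_field A c i) (coord_field A c j)))" for i j
    using smooth_rep[OF at connection_smooth[OF assms smooth_vf_coord_field[OF c]
          smooth_vf_coord_field[OF c]] c] by simp
  then show "smooth_on (cmap c ` cdom c) (\<lambda>z. christoffel_map A D c z u v)"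
    unfolding christoffel_map_def rep_def[symmetric]
    by (intro smooth_on_sum smooth_on_scaleR smooth_on_const open_chart[OF at c])
qed

lemma representsD:
  assumes "represents A G D" "smooth_vf A U X" "smooth_vf A U Y" "c \<in> A" "p \<in> U" "p \<in> cdom c"
  shows "components A c p (D X Y p) = dd (rep A c Y) (cmap c p) (components A c p (X p))
    + G c (cmap c p) (components A c p (X p)) (components A c p (Y p))"
  using assms unfolding represents_def by blast

lemma dd_rep_const_field:
  assumes "c \<in> A" "p \<in> cdom c"
  shows "dd (rep A c (const_field A c v)) (cmap c p) u = 0"
proof -
  have "dd (rep A c (const_field A c v)) (cmap c p) = dd (\<lambda>z. v) (cmap c p)"
    using assms rep_const_field[OF at assms(1)] by (intro dd_cong[OF open_chart[OF at assms(1)]]) auto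
  then show ?thesis by simp
qed

text \<open>The transformation law of Christoffel symbols results from computing the covariant derivative of fields
  that are constant in the chart \<open>c\<close> in both charts.\<close>

lemma christoffel_law_if_represents:
  assumes "represents A G D"
  shows "christoffel_law A G"
  unfolding christoffel_law_def
proof (intro ballI allI)
  fix c d p u v assume c: "c \<in> A" and d: "d \<in> A" and p: "p \<in> cdom c \<inter> cdom d"
  let ?X = "const_field A c u" and ?Y = "const_field A c v"
  note X = smooth_vf_const_field[OF at c, of u] and Y = smooth_vf_const_field[OF at c, of v]
  have pc: "p \<in> cdom c" and pd: "p \<in> cdom d" using p by auto
  note cc = components_const_field[OF at c pc]
  have dc: "components A d p (const_field A c w p) = jac c d p w" for w
    using components_jac[OF at c d pc pd, of "const_field A c w p"] cc by simp
  have "jac c d p (G c (cmap c p) u v) = jac c d p (components A c p (D ?X ?Y p))"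
    using representsD[OF assms X Y c pc pc] cc dd_rep_const_field[OF c pc] by simp
  also have "\<dots> = components A d p (D ?X ?Y p)"
    by (rule components_jac[OF at c d pc pd])
  also have "\<dots> = dd (rep A d ?Y) (cmap d p) (jac c d p u) + G d (cmap d p) (jac c d p u) (jac c d p v)"
    using representsD[OF assms X Y d pc pd] by (simp add: dc)
  also have "dd (rep A d ?Y) (cmap d p) (jac c d p u) = dd (\<lambda>z. dd (transition c d) z v) (cmap c p) u"
    using dd_rep_transition[OF at Y c d pc pc pd] dd_rep_const_field[OF c pc]
      linear_0[OF linear_jac[OF at c d pc pd]] by (simp add: rep_cmap[OF at c pc] cc)
  finally show "jac c d p (G c (cmap c p) u v) = dd (\<lambda>z. dd (transition c d) z v) (cmap c p) u
      + G d (cmap d p) (jac c d p u) (jac c d p v)" .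
qed

text \<open>The bracket is defined through the chart chosen at the point, so torsion-freeness gives the symmetry
  only in that chart. It passes to every other chart because the inhomogeneous term of the
  transformation law is a second derivative and therefore symmetric.\<close>

lemma symmetric_family_if_torsion_free:
  assumes "represents A G D" "torsion_free A D"
  shows "symmetric_family A G"
  unfolding symmetric_family_def
proof (intro ballI allI)
  fix c z u v assume c: "c \<in> A" and "z \<in> cmap c ` cdom c"
  then obtain p where p: "p \<in> cdom c" and z: "z = cmap c p" by blast
  define d where "d = chart_at A p"
  have d: "d \<in> A" and pd: "p \<in> cdom d"
    using chart_at_in[OF at] chart_points[OF at c p] by (auto simp: d_def)
  have sym: "G d (cmap d p) u v = G d (cmap d p) v u" for u v
  proof -
    let ?X = "const_field A d u" and ?Y = "const_field A d v"
    note X = smooth_vf_const_field[OF at d, of u] and Y = smooth_vf_const_field[OF at d, of v]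
    have "lie_bracket A ?X ?Y p = 0"
      using dd_rep_const_field[OF d pd]
      by (simp add: lie_bracket_def Let_def d_def rep_def[abs_def])
    then have "D ?X ?Y p = D ?Y ?X p" using torsion_freeD[OF assms(2) X Y pd] by simp
    then show ?thesis
      using representsD[OF assms(1) X Y d pd pd] representsD[OF assms(1) Y X d pd pd]
        dd_rep_const_field[OF d pd] components_const_field[OF at d pd] by simp
  qed
  note law = christoffel_law_if_represents[OF assms(1), unfolded christoffel_law_def,
      rule_format, OF c d, of p]
  have "jac c d p (G c z u v) = jac c d p (G c z v u)"
    unfolding z using law[of u v] law[of v u] sym[of "jac c d p u" "jac c d p v"] p pd
      second_derivative_symmetric[OF smooth_transition[OF at c d] open_overlap[OF at c d],
        of "cmap c p" u v] by simp
  then show "G c z u v = G c z v u" using jac_inverse[OF at c d p pd] by metis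
qed

text \<open>Torsion-freeness expresses the bracket through the connection; so both its coordinate formula in an
  arbitrary chart and its smoothness are inherited from the connection.\<close>

lemma lie_bracket_components:
  assumes "represents A G D" "torsion_free A D" "smooth_vf A U X" "smooth_vf A U Y"
    "c \<in> A" "p \<in> U" "p \<in> cdom c"
  shows "components A c p (lie_bracket A X Y p) =
    dd (rep A c Y) (cmap c p) (components A c p (X p))
      - dd (rep A c X) (cmap c p) (components A c p (Y p))"
proof -
  have "components A c p (lie_bracket A X Y p)
      = components A c p (D X Y p) - components A c p (D Y X p)"
    by (simp add: torsion_freeD[OF assms(2-4,6), symmetric]
        linear_diff[OF linear_components[OF at assms(5,7)]])
  then show ?thesis
    using representsD[OF assms(1,3,4,5,6,7)] representsD[OF assms(1,4,3,5,6,7)]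
      symmetric_family_if_torsion_free[OF assms(1,2)] assms(5,7)
    by (simp add: symmetric_family_def)
qed

lemma smooth_vf_lie_bracket:
  assumes "connection A D" "torsion_free A D" "smooth_vf A U X" "smooth_vf A U Y"
  shows "smooth_vf A U (lie_bracket A X Y)"
  by (rule smooth_vf_cong[OF at smooth_vf_diff[OF at connection_smooth[OF assms(1,3,4)]
          connection_smooth[OF assms(1,4,3)]]])
    (rule torsion_freeD[OF assms(2-4)])

section \<open>Curvature and Jacobi operators in charts\<close>

lemma second_covariant_derivative:
  assumes G: "represents A G D" "christoffel_family A G" and con: "connection A D"
    and X: "smooth_vf A U X" and Y: "smooth_vf A U Y" and Z: "smooth_vf A U Z"
    and c: "c \<in> A" and p: "p \<in> U" "p \<in> cdom c"
  defines "z \<equiv> cmap c p"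
    and "x \<equiv> components A c p (X p)" and "y \<equiv> components A c p (Y p)"
    and "w \<equiv> components A c p (Z p)"
  shows "components A c p (D X (D Y Z) p) =
    dd (\<lambda>s. dd (rep A c Z) s y) z x + dd (rep A c Z) z (dd (rep A c Y) z x)
     + dd (\<lambda>s. G c s y w) z x + G c z (dd (rep A c Y) z x) w + G c z y (dd (rep A c Z) z x)
     + G c z x (dd (rep A c Z) z y) + G c z x (G c z y w)"
proof -
  let ?S = "cmap c ` (U \<inter> cdom c)"
  let ?Y = "rep A c Y" and ?Z = "rep A c Z"
  have S: "open ?S" by (rule openin_chart_open[OF at smooth_vf_openin[OF at X] c])
  have zS: "z \<in> ?S" using p by (simp add: z_def)
  have bil: "bilinear (G c s)" if "s \<in> ?S" for s
    using christoffel_familyD(1)[OF G(2) c] that by blast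
  have sG: "smooth_on ?S (\<lambda>s. G c s u v)" for u v
    by (rule smooth_on_subset[OF christoffel_familyD(2)[OF G(2) c]]) auto
  note sY = smooth_rep[OF at Y c] and sZ = smooth_rep[OF at Z c]
  have Yz: "?Y z = y" and Zz: "?Z z = w" by (simp_all add: z_def y_def w_def rep_cmap[OF at c p(2)])
  have DYZ: "rep A c (D Y Z) s = dd ?Z s (?Y s) + G c s (?Y s) (?Z s)" if "s \<in> ?S" for s
    using that representsD[OF G(1) Y Z c] by (auto simp: rep_cmap[OF at c])
  have dZ: "\<And>u. (\<lambda>s. dd ?Z s u) differentiable (at z)"
    using smooth_on_differentiable[OF smooth_on_dd[OF sZ] zS] .
  have dG: "\<And>u v. (\<lambda>s. G c s u v) differentiable (at z)"
    using smooth_on_differentiable[OF sG zS] .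
  note dY' = smooth_on_differentiable[OF sY zS] and dZ' = smooth_on_differentiable[OF sZ zS]
  have s1: "smooth_on ?S (\<lambda>s. dd ?Z s (?Y s))"
    by (rule smooth_on_linear_field[OF S smooth_on_linear_dd[OF sZ] smooth_on_dd[OF sZ] sY])
  have s2: "smooth_on ?S (\<lambda>s. G c s (?Y s) (?Z s))"
    by (rule smooth_on_bilinear_field[OF S bil sG sY sZ])
  have "dd (rep A c (D Y Z)) z x = dd (\<lambda>s. dd ?Z s (?Y s) + G c s (?Y s) (?Z s)) z x"
    by (subst dd_cong[OF S zS DYZ]) auto
  also have "\<dots> = dd (\<lambda>s. dd ?Z s (?Y s)) z x + dd (\<lambda>s. G c s (?Y s) (?Z s)) z x"
    by (rule fun_cong[OF dd_eq])
      (intro has_derivative_add dd_works smooth_on_differentiable[OF s1 zS]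
        smooth_on_differentiable[OF s2 zS])
  also have "dd (\<lambda>s. dd ?Z s (?Y s)) z x = dd (\<lambda>s. dd ?Z s y) z x + dd ?Z z (dd ?Y z x)"
    using dd_linear_field[OF S zS smooth_on_linear_dd[OF sZ] dZ dY'] by (simp add: Yz)
  also have "dd (\<lambda>s. G c s (?Y s) (?Z s)) z x =
      dd (\<lambda>s. G c s y w) z x + G c z (dd ?Y z x) w + G c z y (dd ?Z z x)"
    using dd_bilinear_field[OF S zS bil dG dY' dZ'] by (simp add: Yz Zz)
  finally have 1: "dd (rep A c (D Y Z)) z x = dd (\<lambda>s. dd ?Z s y) z x + dd ?Z z (dd ?Y z x)
      + (dd (\<lambda>s. G c s y w) z x + G c z (dd ?Y z x) w + G c z y (dd ?Z z x))" .
  have 2: "components A c p (D X (D Y Z) p)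
      = dd (rep A c (D Y Z)) z x + G c z x (dd ?Z z y + G c z y w)"
    using representsD[OF G(1) X connection_smooth[OF con Y Z] c p] representsD[OF G(1) Y Z c p]
    by (simp add: z_def x_def y_def w_def)
  show ?thesis
    unfolding 2 1 using linear_add[OF bilinear_linear2[OF bil[OF zS]]] by (simp add: algebra_simps)
qed

text \<open>All terms that contain derivatives of the fields cancel, the second derivatives of \<open>Z\<close> by their
  symmetry. What remains depends only on the values of the fields at \<open>p\<close>.\<close>

lemma curvature_components:
  assumes G: "represents A G D" "christoffel_family A G" and con: "connection A D"
    and tf: "torsion_free A D"
    and X: "smooth_vf A U X" and Y: "smooth_vf A U Y" and Z: "smooth_vf A U Z"
    and c: "c \<in> A" and p: "p \<in> U" "p \<in> cdom c"
  shows "components A c p (curvature A D X Y Z p) =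
    local_curv (G c) (cmap c p) (components A c p (X p)) (components A c p (Y p)) (components A c p (Z p))"
proof -
  let ?z = "cmap c p" and ?x = "components A c p (X p)" and ?y = "components A c p (Y p)"
    and ?w = "components A c p (Z p)"
  have bil: "bilinear (G c ?z)" using christoffel_familyD(1)[OF G(2) c] p by blast
  have zS: "?z \<in> cmap c ` (U \<inter> cdom c)" using p by blast
  note sZ = smooth_rep[OF at Z c]
  note lin = linear_components[OF at c p(2)]
  note L = smooth_vf_lie_bracket[OF con tf X Y]
  have 1: "components A c p (D (lie_bracket A X Y) Z p) =
      dd (rep A c Z) ?z (dd (rep A c Y) ?z ?x) - dd (rep A c Z) ?z (dd (rep A c X) ?z ?y)
      + (G c ?z (dd (rep A c Y) ?z ?x) ?w - G c ?z (dd (rep A c X) ?z ?y) ?w)"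
    using representsD[OF G(1) L Z c p] lie_bracket_components[OF G(1) tf X Y c p]
      linear_diff[OF smooth_on_linear_dd[OF sZ zS]] linear_diff[OF bilinear_linear1[OF bil]]
    by simp
  have "components A c p (curvature A D X Y Z p) = components A c p (D X (D Y Z) p)
      - components A c p (D Y (D X Z) p) - components A c p (D (lie_bracket A X Y) Z p)"
    by (simp add: curvature_def linear_diff[OF lin])
  then show ?thesis
    unfolding 1 second_covariant_derivative[OF G con X Y Z c p]
      second_covariant_derivative[OF G con Y X Z c p]
    using second_derivative_symmetric[OF sZ openin_chart_open[OF at smooth_vf_openin[OF at X] c] zS,
        of ?x ?y]
    by (simp add: local_curv_def)
qed

text \<open>Hence the Jacobi operator, defined by a unique choice over all extensions of the two vectors, exists:
  uniqueness holds because extensions with constant components are available.\<close>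

lemma jacobi_components:
  assumes G: "represents A G D" "christoffel_family A G" and con: "connection A D"
    and tf: "torsion_free A D" and c: "c \<in> A" and p: "p \<in> cdom c"
  shows "components A c p (jacobi A D p x y) =
    local_curv (G c) (cmap c p) (components A c p y) (components A c p x) (components A c p x)"
proof -
  define w where "w = const_field A c
    (local_curv (G c) (cmap c p) (components A c p y) (components A c p x) (components A c p x)) p"
  let ?P = "\<lambda>w. \<forall>U X Y. p \<in> U \<and> smooth_vf A U X \<and> smooth_vf A U Y \<and> X p = x \<and> Y p = y \<longrightarrow>
        curvature A D Y X X p = w"
  have w: "components A c p w =
      local_curv (G c) (cmap c p) (components A c p y) (components A c p x) (components A c p x)"
    unfolding w_def by (rule components_const_field[OF at c p])
  have "?P w"
  proof (intro allI impI, elim conjE)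
    fix U X Y
    assume a: "p \<in> U" "smooth_vf A U X" "smooth_vf A U Y" "X p = x" "Y p = y"
    have "components A c p (curvature A D Y X X p) = components A c p w"
      unfolding w using curvature_components[OF G con tf a(3,2,2) c a(1) p] a by simp
    then show "curvature A D Y X X p = w" using components_inject[OF at c p] by blast
  qed
  moreover have "w' = w" if "?P w'" for w'
  proof -
    let ?X = "const_field A c (components A c p x)" and ?Y = "const_field A c (components A c p y)"
    have "p \<in> cdom c \<and> smooth_vf A (cdom c) ?X \<and> smooth_vf A (cdom c) ?Y \<and> ?X p = x \<and> ?Y p = y"
      using p smooth_vf_const_field[OF at c] const_field_components[OF at c p] by blast
    then show ?thesis using that \<open>?P w\<close> by metis
  qed
  ultimately have "jacobi A D p x y = w"
    unfolding jacobi_def by (rule the_equality)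
  then show ?thesis using w by simp
qed

end

section \<open>Connections with prescribed Christoffel maps\<close>

text \<open>The formula is evaluated in the chart chosen at each point. Since nothing is known about how this
  chart varies, smoothness of the result rests on the transformation law of \<open>G\<close>.\<close>

definition connection_of ::
    "('a, 'n::finite) chart set \<Rightarrow> ('a, 'n) christoffel_maps \<Rightarrow> ('a, 'n) cov_deriv" where
  "connection_of A G X Y p =
     (let c = chart_at A p
      in dd (rep A c Y) (cmap c p) (X p) + G c (cmap c p) (X p) (Y p))"

definition gram ::
    "('a, 'n::finite) chart set \<Rightarrow> ('a, 'n) two_tensor \<Rightarrow> ('a, 'n) chart \<Rightarrow>
     real^'n \<Rightarrow> real^'n \<Rightarrow> real^'n \<Rightarrow> real" where
  "gram A g c z u v =
     g (cinv c z) (const_field A c u (cinv c z)) (const_field A c v (cinv c z))"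

definition pseudo_metric :: "('a, 'n::finite) chart set \<Rightarrow> ('a, 'n) two_tensor \<Rightarrow> bool" where
  "pseudo_metric A g \<longleftrightarrow>
     (\<forall>c\<in>A. (\<forall>z\<in>cmap c ` cdom c. bilinear (gram A g c z) \<and>
          (\<forall>u v. gram A g c z u v = gram A g c z v u) \<and>
          (\<forall>u. (\<forall>v. gram A g c z u v = 0) \<longrightarrow> u = 0)) \<and>
        (\<forall>u v. smooth_on (cmap c ` cdom c) (\<lambda>z. gram A g c z u v)))"

definition metric_compatible ::
    "('a, 'n::finite) chart set \<Rightarrow> ('a, 'n) two_tensor \<Rightarrow> ('a, 'n) christoffel_maps \<Rightarrow> bool" where
  "metric_compatible A g G \<longleftrightarrow>
     (\<forall>c\<in>A. \<forall>z\<in>cmap c ` cdom c. \<forall>u v w. dd (\<lambda>s. gram A g c s v w) z u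
        = gram A g c z (G c z u v) w + gram A g c z v (G c z u w))"

lemma pseudo_metricD:
  assumes "pseudo_metric A g" "c \<in> A"
  shows "z \<in> cmap c ` cdom c \<Longrightarrow> bilinear (gram A g c z)"
    and "z \<in> cmap c ` cdom c \<Longrightarrow> gram A g c z u v = gram A g c z v u"
    and "z \<in> cmap c ` cdom c \<Longrightarrow> (\<And>v. gram A g c z u v = 0) \<Longrightarrow> u = 0"
    and "smooth_on (cmap c ` cdom c) (\<lambda>z. gram A g c z u v)"
  using assms unfolding pseudo_metric_def by blast+

context
  fixes A :: "('a, 'n::finite) chart set"
  assumes at: "smooth_atlas A"
begin

text \<open>The inhomogeneous terms in the transformation of \<open>dY(X)\<close> and of \<open>G\<close> cancel, so the defining formula holds in
  every chart as soon as it holds in the chosen one.\<close>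

lemma represents_connection_of:
  assumes G: "christoffel_law A G"
  shows "represents A G (connection_of A G)"
  unfolding represents_def
proof (intro allI impI ballI)
  fix U X Y d p
  assume XY: "smooth_vf A U X \<and> smooth_vf A U Y" and d: "d \<in> A" and p: "p \<in> U \<inter> cdom d"
  have pU: "p \<in> U" and pd: "p \<in> cdom d" using p by auto
  define c where "c = chart_at A p"
  have c: "c \<in> A" and pc: "p \<in> cdom c"
    using chart_at_in[OF at] chart_points[OF at d pd] by (auto simp: c_def)
  have comp: "components A d p v = jac c d p v" for v
    by (simp add: components_eq[OF at] c_def)
  have Yc: "rep A c Y (cmap c p) = Y p"
    unfolding rep_cmap[OF at c pc]
    by (simp add: c_def components_chart_at[OF at chart_points[OF at d pd]])
  have "components A d p (connection_of A G X Y p) =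
      jac c d p (dd (rep A c Y) (cmap c p) (X p)) + jac c d p (G c (cmap c p) (X p) (Y p))"
    by (simp add: connection_of_def Let_def comp linear_add[OF linear_jac[OF at c d pc pd]]
        c_def[symmetric])
  also have "\<dots> = dd (rep A d Y) (cmap d p) (jac c d p (X p))
      + G d (cmap d p) (jac c d p (X p)) (jac c d p (Y p))"
    using G[unfolded christoffel_law_def, rule_format, OF c d, of p "X p" "Y p"] pc pd
      dd_rep_transition[OF at conjunct2[OF XY] c d pU pc pd, of "X p"] by (simp add: Yc)
  finally show "components A d p (connection_of A G X Y p) =
      dd (rep A d Y) (cmap d p) (components A d p (X p)) +
      G d (cmap d p) (components A d p (X p)) (components A d p (Y p))"
    by (simp add: comp)
qed

lemma rep_add:
  assumes "c \<in> A" "z \<in> cmap c ` cdom c"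
  shows "rep A c (\<lambda>q. X q + Y q) z = rep A c X z + rep A c Y z"
  using assms by (auto simp: rep_cmap[OF at] linear_add[OF linear_components[OF at]])

lemma rep_scaleR:
  assumes "c \<in> A" "z \<in> cmap c ` cdom c"
  shows "rep A c (\<lambda>q. f q *\<^sub>R X q) z = (f \<circ> cinv c) z *\<^sub>R rep A c X z"
  using assms by (auto simp: rep_cmap[OF at] cinv_cmap[OF at] linear_cmul[OF linear_components[OF at]])

text \<open>Smoothness is read off from the formula in each chart, and the algebraic properties from the
  formula in the chart chosen at the point.\<close>

lemma connection_connection_of:
  assumes fam: "christoffel_family A G" and law: "christoffel_law A G"
  shows "connection A (connection_of A G)"
proof -
  let ?D = "connection_of A G"
  note R = represents_connection_of[OF law]
  have ch: "chart_at A p \<in> A" "p \<in> cdom (chart_at A p)" "p \<in> points A"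
    if "openin (atlas_topology A) U" "p \<in> U" for p U
    using chart_at_in[OF at] openin_points[OF at that] by auto
  have bil: "bilinear (G (chart_at A p) (cmap (chart_at A p) p))"
    if "openin (atlas_topology A) U" "p \<in> U" for p U
    using christoffel_familyD(1)[OF fam] ch[OF that] by blast
  have repd: "rep A (chart_at A p) Y differentiable (at (cmap (chart_at A p) p))"
    if "smooth_vf A U Y" "p \<in> U" for p U Y
    using ch[OF smooth_vf_openin[OF at that(1)] that(2)]
    by (intro rep_differentiable[OF at that(1) _ that(2)])
  have sm: "smooth_vf A U (?D X Y)" if X: "smooth_vf A U X" and Y: "smooth_vf A U Y" for U X Y
    unfolding smooth_vf_iff[OF at]
  proof (intro conjI ballI)
    show o: "openin (atlas_topology A) U" by (rule smooth_vf_openin[OF at X])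
    fix c assume c: "c \<in> A"
    let ?S = "cmap c ` (U \<inter> cdom c)"
    note S = openin_chart_open[OF at o c]
    note sX = smooth_rep[OF at X c] and sY = smooth_rep[OF at Y c]
    have sub: "?S \<subseteq> cmap c ` cdom c" by blast
    have "smooth_on ?S (\<lambda>z. dd (rep A c Y) z (rep A c X z) + G c z (rep A c X z) (rep A c Y z))"
    proof (rule smooth_on_add[OF S])
      show "smooth_on ?S (\<lambda>z. dd (rep A c Y) z (rep A c X z))"
        by (rule smooth_on_linear_field[OF S smooth_on_linear_dd[OF sY] smooth_on_dd[OF sY] sX])
      show "smooth_on ?S (\<lambda>z. G c z (rep A c X z) (rep A c Y z))"
        by (rule smooth_on_bilinear_field[OF S christoffel_familyD(1)[OF fam c]
              smooth_on_subset[OF christoffel_familyD(2)[OF fam c] sub] sX sY])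
          (use sub in blast)
    qed
    then show "smooth_on ?S (rep A c (?D X Y))"
      by (rule smooth_on_transform[OF S])
        (use representsD[OF at R X Y c] rep_cmap[OF at c] in auto)
  qed
  have cg: "?D X Y p = ?D X' Y' p"
    if "smooth_vf A U X" "\<forall>p\<in>U. X p = X' p \<and> Y p = Y' p" "p \<in> U" for U X X' Y Y' p
  proof -
    have o: "openin (atlas_topology A) U" by (rule smooth_vf_openin[OF at that(1)])
    note c = ch[OF o that(3)]
    have "dd (rep A (chart_at A p) Y) (cmap (chart_at A p) p)
        = dd (rep A (chart_at A p) Y') (cmap (chart_at A p) p)"
      by (rule dd_cong[OF openin_chart_open[OF at o c(1)]])
        (use that c rep_cong[OF at c(1), of U Y Y'] in auto)
    then show ?thesis using that by (simp add: connection_of_def Let_def)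
  qed
  have al: "?D (\<lambda>q. X q + X' q) Y p = ?D X Y p + ?D X' Y p"
    if Y: "smooth_vf A U Y" and p: "p \<in> U" for U X X' Y p
    using linear_add[OF linear_frechet_derivative[OF repd[OF that]]]
      linear_add[OF bilinear_linear1[OF bil[OF smooth_vf_openin[OF at Y] p]]]
    by (simp add: connection_of_def Let_def)
  have sl: "?D (\<lambda>q. f q *\<^sub>R X q) Y p = f p *\<^sub>R ?D X Y p"
    if Y: "smooth_vf A U Y" and p: "p \<in> U" for U f X Y p
    using linear_cmul[OF linear_frechet_derivative[OF repd[OF that]]]
      linear_cmul[OF bilinear_linear1[OF bil[OF smooth_vf_openin[OF at Y] p]]]
    by (simp add: connection_of_def Let_def scaleR_add_right)
  have ar: "?D X (\<lambda>q. Y q + Y' q) p = ?D X Y p + ?D X Y' p"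
    if Y: "smooth_vf A U Y" "smooth_vf A U Y'" and p: "p \<in> U" for U X Y Y' p
  proof -
    let ?c = "chart_at A p"
    let ?z = "cmap ?c p"
    note o = smooth_vf_openin[OF at Y(1)]
    note c = ch[OF o p]
    have "dd (rep A ?c (\<lambda>q. Y q + Y' q)) ?z = dd (\<lambda>z. rep A ?c Y z + rep A ?c Y' z) ?z"
      by (rule dd_cong[OF open_chart[OF at c(1)] _ rep_add[OF c(1)]]) (use c in auto)
    also have "\<dots> = (\<lambda>u. dd (rep A ?c Y) ?z u + dd (rep A ?c Y') ?z u)"
      by (rule dd_eq) (intro has_derivative_add dd_works repd[OF Y(1) p] repd[OF Y(2) p])
    finally show ?thesis
      using linear_add[OF bilinear_linear2[OF bil[OF o p]]]
      by (simp add: connection_of_def Let_def)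
  qed
  have sr: "?D X (\<lambda>q. f q *\<^sub>R Y q) p = dir_deriv A X f p *\<^sub>R Y p + f p *\<^sub>R ?D X Y p"
    if f: "smooth_fun A U f" and Y: "smooth_vf A U Y" and p: "p \<in> U" for U f X Y p
  proof -
    let ?c = "chart_at A p"
    let ?z = "cmap ?c p"
    note o = smooth_vf_openin[OF at Y(1)]
    note c = ch[OF o p]
    have df: "(f \<circ> cinv ?c) differentiable (at ?z)"
      using smooth_on_differentiable[of "cmap ?c ` (U \<inter> cdom ?c)" "f \<circ> cinv ?c" ?z] f c p
      by (auto simp: smooth_fun_def)
    have "dd (rep A ?c (\<lambda>q. f q *\<^sub>R Y q)) ?z = dd (\<lambda>z. (f \<circ> cinv ?c) z *\<^sub>R rep A ?c Y z) ?z"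
      by (rule dd_cong[OF open_chart[OF at c(1)] _ rep_scaleR[OF c(1)]]) (use c in auto)
    also have "\<dots> = (\<lambda>u. (f \<circ> cinv ?c) ?z *\<^sub>R dd (rep A ?c Y) ?z u
        + dd (f \<circ> cinv ?c) ?z u *\<^sub>R rep A ?c Y ?z)"
      by (rule dd_eq[OF has_derivative_scaleR[OF dd_works[OF df] dd_works[OF repd[OF Y p]]]])
    finally show ?thesis
      using linear_cmul[OF bilinear_linear2[OF bil[OF o p]]]
      by (simp add: connection_of_def Let_def dir_deriv_def cinv_cmap[OF at c(1,2)]
          rep_cmap[OF at c(1,2)] components_chart_at[OF at c(3)] algebra_simps)
  qed
  show ?thesis
    unfolding connection_def
  proof (intro conjI allI impI ballI, goal_cases)
    case (1 U X Y) then show ?case by (intro sm) auto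
  next
    case (2 U X X' Y Y' p) then show ?case by (intro cg[of U X]) auto
  next
    case (3 U X X' Y p) then show ?case by (intro al[of U]) auto
  next
    case (4 U f X Y p) then show ?case by (intro sl[of U]) auto
  next
    case (5 U X Y Y' p) then show ?case by (intro ar[of U]) auto
  next
    case (6 U f X Y p) then show ?case by (intro sr[of U]) auto
  qed
qed

lemma torsion_free_connection_of:
  assumes "symmetric_family A G"
  shows "torsion_free A (connection_of A G)"
  unfolding torsion_free_def
proof (intro allI impI ballI)
  fix U X Y p assume XY: "smooth_vf A U X \<and> smooth_vf A U Y" and p: "p \<in> U"
  let ?c = "chart_at A p"
  have "p \<in> points A" using openin_points[OF at smooth_vf_openin[OF at conjunct1[OF XY]] p] .
  then have "G ?c (cmap ?c p) (X p) (Y p) = G ?c (cmap ?c p) (Y p) (X p)"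
    using assms chart_at_in[OF at] by (auto simp: symmetric_family_def)
  then show "connection_of A G X Y p - connection_of A G Y X p = lie_bracket A X Y p"
    by (simp add: connection_of_def lie_bracket_def Let_def rep_def[abs_def])
qed

section \<open>The Levi-Civita connection of a pseudo-Riemannian metric\<close>

lemma gram_components:
  assumes "c \<in> A" "p \<in> cdom c"
  shows "gram A g c (cmap c p) (components A c p u) (components A c p v) = g p u v"
  using assms by (simp add: gram_def cinv_cmap[OF at] const_field_components[OF at])

lemma gram_jac:
  assumes "c \<in> A" "d \<in> A" "p \<in> cdom c" "p \<in> cdom d"
  shows "gram A g d (cmap d p) (jac c d p u) (jac c d p v) = gram A g c (cmap c p) u v"
proof -
  define u' v' where "u' = const_field A c u p" and "v' = const_field A c v p"
  have "u = components A c p u'" "v = components A c p v'"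
    using components_const_field[OF at assms(1,3)] by (simp_all add: u'_def v'_def)
  then show ?thesis
    using gram_components[OF assms(1,3)] gram_components[OF assms(2,4)]
      components_jac[OF at assms] by simp
qed

lemma dd_gram_transition:
  assumes g: "pseudo_metric A g" and c: "c \<in> A" and d: "d \<in> A" and p: "p \<in> cdom c" "p \<in> cdom d"
  shows "dd (\<lambda>s. gram A g c s v w) (cmap c p) u =
    dd (\<lambda>s. gram A g d s (jac c d p v) (jac c d p w)) (cmap d p) (jac c d p u)
    + gram A g d (cmap d p) (dd (\<lambda>s. dd (transition c d) s v) (cmap c p) u) (jac c d p w)
    + gram A g d (cmap d p) (jac c d p v) (dd (\<lambda>s. dd (transition c d) s w) (cmap c p) u)"
proof -
  let ?S = "cmap c ` (cdom c \<inter> cdom d)" and ?f = "transition c d" and ?z = "cmap c p"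
  let ?B = "\<lambda>s. gram A g d (?f s)"
  note S = open_overlap[OF at c d] and sf = smooth_transition[OF at c d]
  have z: "?z \<in> ?S" using p by blast
  have im: "?f ` ?S \<subseteq> cmap d ` cdom d" using c by (auto simp: transition_cmap[OF at])
  have bil: "bilinear (?B s)" if "s \<in> ?S" for s
    using pseudo_metricD(1)[OF g d] im that by blast
  have sB: "smooth_on ?S (\<lambda>s. ?B s a b)" for a b
    by (rule smooth_on_compose[OF S open_chart[OF at d] im sf pseudo_metricD(4)[OF g d]])
  have "dd (\<lambda>s. gram A g c s v w) ?z = dd (\<lambda>s. ?B s (dd ?f s v) (dd ?f s w)) ?z"
    by (rule dd_cong[OF S z]) (use gram_jac[OF c d] transition_cmap[OF at c, of _ d] in auto)
  moreover have "dd (\<lambda>s. ?B s (dd ?f s v) (dd ?f s w)) ?z u = dd (\<lambda>s. ?B s (dd ?f ?z v) (dd ?f ?z w)) ?z u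
      + ?B ?z (dd (\<lambda>s. dd ?f s v) ?z u) (dd ?f ?z w) + ?B ?z (dd ?f ?z v) (dd (\<lambda>s. dd ?f s w) ?z u)"
    by (rule dd_bilinear_field[OF S z bil smooth_on_differentiable[OF sB z]
          smooth_on_differentiable[OF smooth_on_dd[OF sf] z]
          smooth_on_differentiable[OF smooth_on_dd[OF sf] z]])
  moreover have "dd (\<lambda>s. ?B s (dd ?f ?z v) (dd ?f ?z w)) ?z u =
      dd (\<lambda>s. gram A g d s (dd ?f ?z v) (dd ?f ?z w)) (?f ?z) (dd ?f ?z u)"
    by (rule dd_chain[where g = ?f and f = "\<lambda>s. gram A g d s (dd ?f ?z v) (dd ?f ?z w)"])
      (use smooth_on_differentiable[OF sf z]
         smooth_on_differentiable[OF pseudo_metricD(4)[OF g d] subsetD[OF im imageI[OF z]]] in auto)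
  ultimately show ?thesis by (simp add: transition_cmap[OF at c p(1)])
qed

text \<open>The Koszul formula in coordinates. With the nondegeneracy of the metric it determines the Christoffel
  maps, and it is also the source of their transformation law.\<close>

lemma koszul:
  assumes g: "pseudo_metric A g" and G: "symmetric_family A G" "metric_compatible A g G"
    and c: "c \<in> A" and z: "z \<in> cmap c ` cdom c"
  shows "2 * gram A g c z (G c z u v) w = dd (\<lambda>s. gram A g c s v w) z u
    + dd (\<lambda>s. gram A g c s u w) z v - dd (\<lambda>s. gram A g c s u v) z w"
proof -
  note comp = G(2)[unfolded metric_compatible_def, rule_format, OF c z]
  note sym = G(1)[unfolded symmetric_family_def, rule_format, OF c z]
  note gsym = pseudo_metricD(2)[OF g c z]
  show ?thesis
    unfolding comp using sym[of u v] sym[of u w] sym[of v w] gsym[of v "G c z u w"]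
      gsym[of u "G c z v w"] by simp
qed

lemma pseudo_metric_cancel:
  assumes "pseudo_metric A g" "c \<in> A" "z \<in> cmap c ` cdom c"
    and "\<And>w. gram A g c z u w = gram A g c z v w"
  shows "u = v"
proof -
  have "gram A g c z (u - v) w = 0" for w
    using linear_diff[OF bilinear_linear1[OF pseudo_metricD(1)[OF assms(1-3)]]] assms(4) by simp
  then show ?thesis using pseudo_metricD(3)[OF assms(1-3), of "u - v"] by simp
qed

lemma christoffel_unique:
  assumes g: "pseudo_metric A g" and G: "symmetric_family A G" "metric_compatible A g G"
    and G': "symmetric_family A G'" "metric_compatible A g G'"
    and c: "c \<in> A" and z: "z \<in> cmap c ` cdom c"
  shows "G c z u v = G' c z u v"
  using koszul[OF g G c z, of u v] koszul[OF g G' c z, of u v]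
  by (intro pseudo_metric_cancel[OF g c z]) (metis mult_cancel_left zero_neq_numeral)

text \<open>Both sides are tested against vectors of the form \<open>J w\<close>, with \<open>J\<close> the Jacobian. By the Koszul formula in
  \<open>c\<close> and in \<open>d\<close>, the difference comes only from the second derivatives of the transition map in the derivative
  of the metric; of these six terms four cancel in pairs by symmetry and two agree.\<close>

lemma christoffel_law_if_compatible:
  assumes g: "pseudo_metric A g" and G: "symmetric_family A G" "metric_compatible A g G"
  shows "christoffel_law A G"
  unfolding christoffel_law_def
proof (intro ballI allI)
  fix c d p u v assume c: "c \<in> A" and d: "d \<in> A" and "p \<in> cdom c \<inter> cdom d"
  then have pc: "p \<in> cdom c" and pd: "p \<in> cdom d" by auto
  let ?g = "gram A g d (cmap d p)" and ?J = "jac c d p"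
  let ?H = "\<lambda>u v. dd (\<lambda>z. dd (transition c d) z v) (cmap c p) u"
  have zc: "cmap c p \<in> cmap c ` cdom c" and zd: "cmap d p \<in> cmap d ` cdom d" using pc pd by auto
  have H: "?H u v = ?H v u" for u v
    by (rule second_derivative_symmetric[OF smooth_transition[OF at c d] open_overlap[OF at c d]])
      (use pc pd in blast)
  note T = dd_gram_transition[OF g c d pc pd]
  note gsym = pseudo_metricD(2)[OF g d zd]
  show "?J (G c (cmap c p) u v) = ?H u v + G d (cmap d p) (?J u) (?J v)"
  proof (rule pseudo_metric_cancel[OF g d zd])
    fix w'
    define w where "w = jac d c p w'"
    have w: "w' = ?J w" using jac_inverse[OF at d c pd pc] by (simp add: w_def)
    have "2 * ?g (?J (G c (cmap c p) u v)) (?J w) = 2 * gram A g c (cmap c p) (G c (cmap c p) u v) w"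
      using gram_jac[OF c d pc pd] by simp
    also have "\<dots> = 2 * ?g (?H u v) (?J w) + 2 * ?g (G d (cmap d p) (?J u) (?J v)) (?J w)"
      unfolding koszul[OF g G c zc] koszul[OF g G d zd] T
      using H[of u v] H[of u w] H[of v w] gsym[of "?J v" "?H u w"] gsym[of "?J u" "?H v w"]
      by simp
    finally show "?g (?J (G c (cmap c p) u v)) w' = ?g (?H u v + G d (cmap d p) (?J u) (?J v)) w'"
      using linear_add[OF bilinear_linear1[OF pseudo_metricD(1)[OF g d zd]]] by (simp add: w)
  qed
qed

lemma metric_tensor_in_chart:
  assumes "c \<in> A" "z \<in> cmap c ` cdom c"
  shows "((\<lambda>q. g q (Y q) (Z q)) \<circ> cinv c) z = gram A g c z (rep A c Y z) (rep A c Z z)"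
  using assms gram_components[OF assms(1)]
  by (auto simp: cinv_cmap[OF at] rep_cmap[OF at])

lemma metric_connection_if_compatible:
  assumes g: "pseudo_metric A g" and R: "represents A G D" and G: "metric_compatible A g G"
  shows "metric_connection A g D"
  unfolding metric_connection_def
proof (intro allI impI ballI)
  fix U X Y Z p
  assume "smooth_vf A U X \<and> smooth_vf A U Y \<and> smooth_vf A U Z" and p: "p \<in> U"
  then have X: "smooth_vf A U X" and Y: "smooth_vf A U Y" and Z: "smooth_vf A U Z" by auto
  define c where "c = chart_at A p"
  have pA: "p \<in> points A" using openin_points[OF at smooth_vf_openin[OF at X] p] .
  have c: "c \<in> A" and pc: "p \<in> cdom c" using chart_at_in[OF at pA] by (auto simp: c_def)
  have id: "components A c p v = v" for v using components_chart_at[OF at pA] by (simp add: c_def)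
  let ?z = "cmap c p"
  have z: "?z \<in> cmap c ` cdom c" using pc by blast
  note S = open_chart[OF at c]
  have "dir_deriv A X (\<lambda>q. g q (Y q) (Z q)) p = dd ((\<lambda>q. g q (Y q) (Z q)) \<circ> cinv c) ?z (X p)"
    by (simp add: dir_deriv_def Let_def c_def)
  also have "dd ((\<lambda>q. g q (Y q) (Z q)) \<circ> cinv c) ?z
      = dd (\<lambda>s. gram A g c s (rep A c Y s) (rep A c Z s)) ?z"
    by (rule dd_cong[OF S z metric_tensor_in_chart[OF c]])
  also have "\<dots> (X p) = dd (\<lambda>s. gram A g c s (Y p) (Z p)) ?z (X p)
      + gram A g c ?z (dd (rep A c Y) ?z (X p)) (Z p)
      + gram A g c ?z (Y p) (dd (rep A c Z) ?z (X p))"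
    using dd_bilinear_field[OF S z pseudo_metricD(1)[OF g c]
        smooth_on_differentiable[OF pseudo_metricD(4)[OF g c] z]
        rep_differentiable[OF at Y c p pc] rep_differentiable[OF at Z c p pc]]
    by (simp add: rep_cmap[OF at c pc] id)
  also have "\<dots> = gram A g c ?z (D X Y p) (Z p) + gram A g c ?z (Y p) (D X Z p)"
    using G[unfolded metric_compatible_def, rule_format, OF c z, of "Y p" "Z p" "X p"]
      representsD[OF at R X Y c p pc] representsD[OF at R X Z c p pc]
      linear_add[OF bilinear_linear1[OF pseudo_metricD(1)[OF g c z]]]
      linear_add[OF bilinear_linear2[OF pseudo_metricD(1)[OF g c z]]]
    by (simp add: id)
  also have "\<dots> = g p (D X Y p) (Z p) + g p (Y p) (D X Z p)"
    using gram_components[OF c pc] by (simp add: id)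
  finally show "dir_deriv A X (\<lambda>q. g q (Y q) (Z q)) p = g p (D X Y p) (Z p) + g p (Y p) (D X Z p)" .
qed

lemma compatible_if_metric_connection:
  assumes g: "pseudo_metric A g" and R: "represents A G D" and D: "metric_connection A g D"
  shows "metric_compatible A g G"
  unfolding metric_compatible_def
proof (intro ballI allI)
  fix c z u v w assume c: "c \<in> A" and z: "z \<in> cmap c ` cdom c"
  then obtain p where p: "p \<in> cdom c" and zp: "z = cmap c p" by blast
  let ?X = "\<lambda>u. const_field A c u"
  note X = smooth_vf_const_field[OF at c]
  note S = open_chart[OF at c]
  let ?f = "\<lambda>q. g q (?X v q) (?X w q)"
  have f: "(?f \<circ> cinv c) s = gram A g c s v w" if "s \<in> cmap c ` cdom c" for s
    using metric_tensor_in_chart[OF c that, of g "?X v" "?X w"] rep_const_field[OF at c that] by simp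
  have sf: "smooth_fun A (cdom c) ?f"
    by (rule smooth_fun_chart[OF at c openin_cdom[OF at c] order_refl])
      (rule smooth_on_transform[OF S pseudo_metricD(4)[OF g c] f])
  have "dd (\<lambda>s. gram A g c s v w) z = dd (?f \<circ> cinv c) z"
    by (rule dd_cong[OF S z f[symmetric]])
  then have "dd (\<lambda>s. gram A g c s v w) z u = dd (?f \<circ> cinv c) z u" by simp
  also have "\<dots> = dir_deriv A (?X u) ?f p"
    using dir_deriv_chart[OF at sf c p p, of "?X u"] components_const_field[OF at c p]
    by (simp add: zp)
  also have "\<dots> = g p (D (?X u) (?X v) p) (?X w p) + g p (?X v p) (D (?X u) (?X w) p)"
    using D X p unfolding metric_connection_def by blast
  also have "\<dots> = gram A g c z (G c z u v) w + gram A g c z v (G c z u w)"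
    unfolding gram_components[OF c p, symmetric]
    using representsD[OF at R X X c p p] dd_rep_const_field[OF at c p]
      components_const_field[OF at c p] by (simp add: zp)
  finally show "dd (\<lambda>s. gram A g c s v w) z u =
      gram A g c z (G c z u v) w + gram A g c z v (G c z u w)" .
qed

text \<open>The Levi-Civita connection is only a choice among the torsion-free metric connections, so existence
  has to be shown. Existence is reduced to exhibiting smooth Christoffel maps that are compatible with the
  metric chart by chart; they glue to a global connection because the Koszul formula determines them. The
  same uniqueness identifies the Christoffel maps of the chosen connection.\<close>

theorem levi_civita_represented:
  assumes g: "pseudo_metric A g"
    and G: "christoffel_family A G" "symmetric_family A G" "metric_compatible A g G"
  shows "connection A (levi_civita A g)" "torsion_free A (levi_civita A g)"
    and "represents A G (levi_civita A g)"
proof -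
  have law: "christoffel_law A G" by (rule christoffel_law_if_compatible[OF g G(2,3)])
  let ?D = "connection_of A G"
  have "connection A ?D \<and> torsion_free A ?D \<and> metric_connection A g ?D"
    using connection_connection_of[OF G(1) law] torsion_free_connection_of[OF G(2)]
      metric_connection_if_compatible[OF g represents_connection_of[OF law] G(3)] by blast
  then have L: "connection A (levi_civita A g)" "torsion_free A (levi_civita A g)"
    "metric_connection A g (levi_civita A g)"
    unfolding levi_civita_def using someI[of "\<lambda>D. connection A D \<and> torsion_free A D \<and> metric_connection A g D" ?D]
    by blast+
  note R = represents_christoffel_map[OF at L(1)]
  have "christoffel_map A (levi_civita A g) c z u v = G c z u v" if "c \<in> A" "z \<in> cmap c ` cdom c" for c z u v
    by (rule christoffel_unique[OF g symmetric_family_if_torsion_free[OF at R L(2)]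
          compatible_if_metric_connection[OF g R L(3)] G(2,3) that])
  then show "represents A G (levi_civita A g)"
    using R unfolding represents_def by auto
  show "connection A (levi_civita A g)" "torsion_free A (levi_civita A g)" by fact+
qed

end

section \<open>The deformed Riemannian extension in coordinates\<close>

text \<open>A coordinate vector of the cotangent bundle consists of a part in the direction of the base and a part in the
  direction of the fibre. The fibre part is a covector; it is paired with base vectors by the
  inner product of \<open>real^'m\<close>.\<close>

definition base :: "real^('m + 'm) \<Rightarrow> real^'m" where "base z = (\<chi> i. z $ Inl i)"
definition fibre :: "real^('m + 'm) \<Rightarrow> real^'m" where "fibre z = (\<chi> i. z $ Inr i)"
definition join :: "real^'m \<Rightarrow> real^'m \<Rightarrow> real^('m + 'm)"
  where "join x y = (\<chi> k. case k of Inl i \<Rightarrow> x $ i | Inr i \<Rightarrow> y $ i)"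

lemma base_join [simp]: "base (join x y) = x"
  and fibre_join [simp]: "fibre (join x y) = y"
  by (simp_all add: base_def fibre_def join_def vec_eq_iff)

lemma join_base_fibre [simp]: "join (base z) (fibre z) = z"
  by (auto simp: base_def fibre_def join_def vec_eq_iff split: sum.split)

lemma join_eqI: "base z = base w \<Longrightarrow> fibre z = fibre w \<Longrightarrow> z = w"
  by (metis join_base_fibre)

lemma base_add [simp]: "base (u + v) = base u + base v"
  and base_diff [simp]: "base (u - v) = base u - base v"
  and base_scaleR [simp]: "base (r *\<^sub>R u) = r *\<^sub>R base u"
  and fibre_add [simp]: "fibre (u + v) = fibre u + fibre v"
  and fibre_diff [simp]: "fibre (u - v) = fibre u - fibre v"
  and fibre_scaleR [simp]: "fibre (r *\<^sub>R u) = r *\<^sub>R fibre u"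
  by (simp_all add: base_def fibre_def vec_eq_iff)

lemma bounded_linear_base: "bounded_linear (base :: real^('m::finite + 'm) \<Rightarrow> real^'m)"
  and bounded_linear_fibre: "bounded_linear (fibre :: real^('m::finite + 'm) \<Rightarrow> real^'m)"
  by (simp_all add: linear_conv_bounded_linear[symmetric] linear_iff)

lemma smooth_on_base_fibre:
  fixes f :: "'a::euclidean_space \<Rightarrow> real^('m::finite + 'm)"
  assumes "open S" "smooth_on S (\<lambda>x. base (f x))" "smooth_on S (\<lambda>x. fibre (f x))"
  shows "smooth_on S f"
  unfolding smooth_on_vec_iff[OF assms(1)]
proof
  fix k
  show "smooth_on S (\<lambda>x. f x $ k)"
    using assms(2,3)[unfolded smooth_on_vec_iff[OF assms(1)], rule_format, of "case k of Inl i \<Rightarrow> i | Inr i \<Rightarrow> i"]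
    by (cases k) (simp_all add: base_def fibre_def)
qed

lemma has_derivative_comp_base:
  assumes "q differentiable (at (base z))"
  shows "((\<lambda>z. q (base z)) has_derivative (\<lambda>U. dd q (base z) (base U))) (at z)"
  by (rule has_derivative_compose[where f = base and g = q])
    (use assms in \<open>auto intro: dd_works bounded_linear_imp_has_derivative[OF bounded_linear_base]\<close>)

lemma dd_comp_base:
  assumes "q differentiable (at (base z))"
  shows "dd (\<lambda>z. q (base z)) z U = dd q (base z) (base U)"
  using dd_eq[OF has_derivative_comp_base[OF assms]] by simp

lemma has_derivative_fibre_pairing:
  assumes "q differentiable (at (base z))"
  shows "((\<lambda>z. fibre z \<bullet> q (base z)) has_derivative
    (\<lambda>U. fibre z \<bullet> dd q (base z) (base U) + fibre U \<bullet> q (base z))) (at z)"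
  using has_derivative_inner[OF bounded_linear_imp_has_derivative[OF bounded_linear_fibre]
      has_derivative_comp_base[OF assms]] by simp

lemma open_base_vimage: "open S \<Longrightarrow> open {z. base z \<in> S}"
  using open_vimage[OF _ linear_continuous_on[OF bounded_linear_base], of S]
  by (simp add: vimage_def)

lemma bilinear_eqs:
  assumes "bilinear (B :: 'a::real_vector \<Rightarrow> 'b::real_vector \<Rightarrow> 'c::real_vector)"
  shows "B (u + u') v = B u v + B u' v" "B u (v + v') = B u v + B u v'"
    "B (r *\<^sub>R u) v = r *\<^sub>R B u v" "B u (r *\<^sub>R v) = r *\<^sub>R B u v" "B 0 v = 0" "B u 0 = 0"
  using assms by (simp_all add: bilinear_ladd bilinear_radd bilinear_lmul bilinear_rmul
      bilinear_lzero bilinear_rzero)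

lemma dd_bilinear_family_eqs:
  fixes B :: "'a::euclidean_space \<Rightarrow> 'b::euclidean_space \<Rightarrow> 'd::euclidean_space \<Rightarrow> 'c::real_normed_vector"
  assumes "open S" "x \<in> S" "\<And>x. x \<in> S \<Longrightarrow> bilinear (B x)" and s: "\<And>u v. smooth_on S (\<lambda>x. B x u v)"
  defines "d \<equiv> \<lambda>u v w. dd (\<lambda>x. B x v w) x u"
  shows "d (u + u') v w = d u v w + d u' v w" "d u (v + v') w = d u v w + d u v' w"
    "d u v (w + w') = d u v w + d u v w'" "d (r *\<^sub>R u) v w = r *\<^sub>R d u v w"
    "d u (r *\<^sub>R v) w = r *\<^sub>R d u v w" "d u v (r *\<^sub>R w) = r *\<^sub>R d u v w"
    "d 0 v w = 0" "d u 0 w = 0" "d u v 0 = 0"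
proof -
  have l: "linear (\<lambda>u. d u v w)" "linear (\<lambda>v. d u v w)" "linear (d u v)" for u v w
    unfolding d_def
    using smooth_on_linear_dd[OF s assms(2)]
      linear_dd_family[OF assms(1,2) bilinear_linear1[OF assms(3)] smooth_on_differentiable[OF s assms(2)]]
      linear_dd_family[OF assms(1,2) bilinear_linear2[OF assms(3)] smooth_on_differentiable[OF s assms(2)]]
    by blast+
  show "d (u + u') v w = d u v w + d u' v w" "d u (v + v') w = d u v w + d u v' w"
    "d u v (w + w') = d u v w + d u v w'" "d (r *\<^sub>R u) v w = r *\<^sub>R d u v w"
    "d u (r *\<^sub>R v) w = r *\<^sub>R d u v w" "d u v (r *\<^sub>R w) = r *\<^sub>R d u v w"
    "d 0 v w = 0" "d u 0 w = 0" "d u v 0 = 0"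
    by (simp_all add: l[THEN linear_add] l[THEN linear_cmul] l[THEN linear_0])
qed

text \<open>The data of one chart: a symmetric Christoffel map \<open>\<Gamma>\<close> of the base and the symmetric form \<open>\<Phi>\<close>.\<close>

locale local_extension =
  fixes S :: "(real^'m::finite) set" and \<Gamma> :: "real^'m \<Rightarrow> real^'m \<Rightarrow> real^'m \<Rightarrow> real^'m"
    and \<Phi> :: "real^'m \<Rightarrow> real^'m \<Rightarrow> real^'m \<Rightarrow> real"
  assumes open_S: "open S"
    and bilinear_\<Gamma>: "x \<in> S \<Longrightarrow> bilinear (\<Gamma> x)"
    and sym_\<Gamma>: "x \<in> S \<Longrightarrow> \<Gamma> x u v = \<Gamma> x v u"
    and smooth_\<Gamma>: "smooth_on S (\<lambda>x. \<Gamma> x u v)"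
    and bilinear_\<Phi>: "x \<in> S \<Longrightarrow> bilinear (\<Phi> x)"
    and sym_\<Phi>: "x \<in> S \<Longrightarrow> \<Phi> x u v = \<Phi> x v u"
    and smooth_\<Phi>: "smooth_on S (\<lambda>x. \<Phi> x u v)"
begin

definition d\<Gamma> where "d\<Gamma> x u v w = dd (\<lambda>x. \<Gamma> x v w) x u"
definition d\<Phi> where "d\<Phi> x u v w = dd (\<lambda>x. \<Phi> x v w) x u"

definition metric :: "real^('m + 'm) \<Rightarrow> real^('m + 'm) \<Rightarrow> real^('m + 'm) \<Rightarrow> real" where
  "metric z U V = fibre U \<bullet> base V + fibre V \<bullet> base U - 2 * (fibre z \<bullet> \<Gamma> (base z) (base U) (base V))
     + \<Phi> (base z) (base U) (base V)"

text \<open>The Christoffel map of the extension has base part \<open>\<Gamma>(u,v)\<close>; its fibre part, evaluated on a base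
  vector \<open>w\<close>, is the form \<open>fibre_form\<close>, which is what the Koszul formula yields for vectors with base
  parts \<open>u\<close> and \<open>v\<close>. It is affine in the fibre coordinate, with a slope that depends only on \<open>\<Gamma>\<close>. This split into
  slope and constant part makes its derivatives easy to compute.\<close>

definition form_slope where "form_slope x u v w = d\<Gamma> x u v w + d\<Gamma> x v u w - d\<Gamma> x w u v - 2 *\<^sub>R \<Gamma> x (\<Gamma> x u v) w"

definition form_const :: "real^'m \<Rightarrow> real^('m + 'm) \<Rightarrow> real^('m + 'm) \<Rightarrow> real^'m \<Rightarrow> real" where
  "form_const x U V w = - (fibre U \<bullet> \<Gamma> x (base V) w) - fibre V \<bullet> \<Gamma> x (base U) w
     - \<Phi> x (\<Gamma> x (base U) (base V)) w
     + (d\<Phi> x (base U) (base V) w + d\<Phi> x (base V) (base U) w - d\<Phi> x w (base U) (base V)) / 2"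

definition fibre_form where
  "fibre_form z U V w = form_const (base z) U V w - fibre z \<bullet> form_slope (base z) (base U) (base V) w"

definition christ :: "real^('m + 'm) \<Rightarrow> real^('m + 'm) \<Rightarrow> real^('m + 'm) \<Rightarrow> real^('m + 'm)" where
  "christ z U V = join (\<Gamma> (base z) (base U) (base V)) (\<chi> i. fibre_form z U V (axis i 1))"

abbreviation "T \<equiv> {z. base z \<in> S}"

lemma open_T: "open T"
  by (rule open_base_vimage[OF open_S])

lemmas \<Gamma>_lin = bilinear_eqs[OF bilinear_\<Gamma>]
lemmas \<Phi>_lin = bilinear_eqs[OF bilinear_\<Phi>, unfolded real_scaleR_def]
lemmas d\<Gamma>_lin = dd_bilinear_family_eqs[OF open_S _ bilinear_\<Gamma> smooth_\<Gamma>, folded d\<Gamma>_def]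
lemmas d\<Phi>_lin = dd_bilinear_family_eqs[OF open_S _ bilinear_\<Phi> smooth_\<Phi>, folded d\<Phi>_def,
    unfolded real_scaleR_def]

lemma d\<Gamma>_sym: "x \<in> S \<Longrightarrow> d\<Gamma> x u v w = d\<Gamma> x u w v"
  using dd_cong[OF open_S, of x "\<lambda>x. \<Gamma> x v w" "\<lambda>x. \<Gamma> x w v"] sym_\<Gamma> by (simp add: d\<Gamma>_def)

lemma d\<Phi>_sym: "x \<in> S \<Longrightarrow> d\<Phi> x u v w = d\<Phi> x u w v"
  using dd_cong[OF open_S, of x "\<lambda>x. \<Phi> x v w" "\<lambda>x. \<Phi> x w v"] sym_\<Phi> by (simp add: d\<Phi>_def)

lemmas lins = \<Gamma>_lin \<Phi>_lin d\<Gamma>_lin d\<Phi>_lin inner_add_left inner_add_right inner_diff_right inner_diff_left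
lemmas form_simps = fibre_form_def form_const_def form_slope_def lins algebra_simps
  add_divide_distrib diff_divide_distrib

lemma linear_fibre_form: "z \<in> T \<Longrightarrow> linear (fibre_form z U V)"
  by (rule linearI) (simp_all add: form_simps)

lemma fibre_form_lin:
  assumes "z \<in> T"
  shows "fibre_form z (U + U') V w = fibre_form z U V w + fibre_form z U' V w"
    "fibre_form z (r *\<^sub>R U) V w = r * fibre_form z U V w"
  using assms by (simp_all add: form_simps)

lemma fibre_form_sym: "z \<in> T \<Longrightarrow> fibre_form z U V w = fibre_form z V U w"
  by (simp add: fibre_form_def form_const_def form_slope_def sym_\<Gamma>[of _ "base U" "base V"]
      d\<Gamma>_sym[of _ _ "base U" "base V"] d\<Phi>_sym[of _ _ "base U" "base V"] add.commute)

lemma base_christ [simp]: "base (christ z U V) = \<Gamma> (base z) (base U) (base V)"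
  by (simp add: christ_def)

lemma fibre_christ:
  assumes "z \<in> T"
  shows "fibre (christ z U V) \<bullet> w = fibre_form z U V w"
proof -
  have "fibre_form z U V w = fibre_form z U V (\<Sum>i\<in>UNIV. w $ i *\<^sub>R axis i 1)"
    using basis_expansion[of w] by (simp add: scalar_mult_eq_scaleR)
  also have "\<dots> = (\<Sum>i\<in>UNIV. w $ i * fibre_form z U V (axis i 1))"
    by (simp add: linear_sum[OF linear_fibre_form[OF assms]] linear_cmul[OF linear_fibre_form[OF assms]])
  finally show ?thesis by (simp add: christ_def inner_vec_def mult.commute)
qed

lemma christ_sym: "z \<in> T \<Longrightarrow> christ z U V = christ z V U"
  by (auto simp: christ_def fibre_form_sym[of z U V] sym_\<Gamma>[of _ "base U" "base V"])

lemma bilinear_christ: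
  assumes "z \<in> T"
  shows "bilinear (christ z)"
proof -
  have l: "linear (\<lambda>U. christ z U V)" for V
    by (rule linearI; rule join_eqI)
      (use assms in \<open>simp_all add: christ_def fibre_form_lin lins vec_eq_iff\<close>)
  moreover have "linear (christ z U)" for U
  proof -
    have "christ z U = (\<lambda>V. christ z V U)" by (rule ext) (rule christ_sym[OF assms])
    then show ?thesis using l[of U] by simp
  qed
  ultimately show ?thesis by (simp add: bilinear_def)
qed

lemma smooth_comp_base:
  fixes q :: "real^'m \<Rightarrow> 'c::real_normed_vector"
  assumes "smooth_on S q"
  shows "smooth_on T (\<lambda>z. q (base z))"
  by (rule smooth_on_compose[OF open_T open_S _ _ assms])
    (auto intro: smooth_on_bounded_linear[OF open_T bounded_linear_base smooth_on_id])

lemma smooth_fibre: "smooth_on T fibre"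
  by (rule smooth_on_bounded_linear[OF open_T bounded_linear_fibre smooth_on_id])

lemma smooth_d\<Gamma>: "smooth_on S (\<lambda>x. d\<Gamma> x u v w)"
  unfolding d\<Gamma>_def by (rule smooth_on_dd[OF smooth_\<Gamma>])

lemma smooth_d\<Phi>: "smooth_on S (\<lambda>x. d\<Phi> x u v w)"
  unfolding d\<Phi>_def by (rule smooth_on_dd[OF smooth_\<Phi>])

lemma smooth_form_slope: "smooth_on S (\<lambda>x. form_slope x u v w)"
proof -
  have "smooth_on S (\<lambda>x. \<Gamma> x (\<Gamma> x u v) w)"
    by (rule smooth_on_bilinear_field[OF open_S bilinear_\<Gamma> smooth_\<Gamma> smooth_\<Gamma> smooth_on_const])
  then show ?thesis
    unfolding form_slope_def
    by (intro smooth_on_diff smooth_on_add smooth_on_scaleR smooth_on_const open_S smooth_d\<Gamma>)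
qed

lemma smooth_form_const: "smooth_on S (\<lambda>x. form_const x U V w)"
proof -
  have "smooth_on S (\<lambda>x. \<Phi> x (\<Gamma> x u v) w)" for u v
    by (rule smooth_on_bilinear_field[OF open_S bilinear_\<Phi> smooth_\<Phi> smooth_\<Gamma> smooth_on_const])
  then show ?thesis
    unfolding form_const_def divide_inverse
    by (intro smooth_on_diff smooth_on_add smooth_on_mult smooth_on_uminus smooth_on_inner
        smooth_on_const open_S smooth_d\<Phi> smooth_\<Gamma>)
qed

lemma smooth_fibre_form: "smooth_on T (\<lambda>z. fibre_form z U V w)"
  unfolding fibre_form_def
  by (intro smooth_on_diff smooth_on_inner open_T smooth_fibre smooth_comp_base smooth_form_const smooth_form_slope)

lemma smooth_christ: "smooth_on T (\<lambda>z. christ z U V)"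
proof (rule smooth_on_base_fibre[OF open_T])
  show "smooth_on T (\<lambda>z. base (christ z U V))"
    using smooth_comp_base[OF smooth_\<Gamma>] by simp
  show "smooth_on T (\<lambda>z. fibre (christ z U V))"
    unfolding smooth_on_vec_iff[OF open_T] using smooth_fibre_form by (simp add: christ_def)
qed

lemma smooth_metric: "smooth_on T (\<lambda>z. metric z U V)"
  unfolding metric_def
  by (intro smooth_on_diff smooth_on_add smooth_on_mult smooth_on_inner smooth_fibre smooth_on_const
      open_T smooth_comp_base smooth_\<Gamma> smooth_\<Phi>)

lemma metric_sym: "z \<in> T \<Longrightarrow> metric z U V = metric z V U"
  by (simp add: metric_def sym_\<Gamma>[of _ "base U" "base V"] sym_\<Phi>[of _ "base U" "base V"])

lemma bilinear_metric:
  assumes "z \<in> T"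
  shows "bilinear (metric z)"
  unfolding bilinear_def
  by (intro conjI allI linearI) (use assms in \<open>simp_all add: metric_def lins algebra_simps\<close>)

lemma metric_nondegenerate:
  assumes "z \<in> T" "\<And>V. metric z U V = 0"
  shows "U = 0"
proof -
  have b: "base U = 0"
    using assms(2)[of "join 0 (base U)"] assms(1) by (simp add: metric_def lins)
  have "fibre U = 0"
    using assms(2)[of "join (fibre U) 0"] assms(1) b by (simp add: metric_def lins)
  then show ?thesis using b by (intro join_eqI) (simp_all add: base_def fibre_def vec_eq_iff)
qed

text \<open>After all forms are expanded, this is a linear identity in the values of \<open>\<Gamma>\<close>, \<open>\<Phi>\<close> and of their
  derivatives, up to the symmetry of these in their last two arguments.\<close>

lemma metric_compatible_christ:
  assumes "z \<in> T"
  shows "dd (\<lambda>s. metric s V W) z U = metric z (christ z U V) W + metric z V (christ z U W)"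
proof -
  have x: "base z \<in> S" using assms by simp
  have "((\<lambda>s. metric s V W) has_derivative
      (\<lambda>U. (0 + 0 - 2 * (fibre z \<bullet> dd (\<lambda>x. \<Gamma> x (base V) (base W)) (base z) (base U)
          + fibre U \<bullet> \<Gamma> (base z) (base V) (base W)))
        + dd (\<lambda>x. \<Phi> x (base V) (base W)) (base z) (base U))) (at z)"
    unfolding metric_def
    by (intro has_derivative_add has_derivative_diff has_derivative_const has_derivative_mult_right
        has_derivative_fibre_pairing[where q = "\<lambda>x. \<Gamma> x (base V) (base W)"] smooth_on_differentiable[OF smooth_\<Gamma> x]
        has_derivative_comp_base[where q = "\<lambda>x. \<Phi> x (base V) (base W)"]
        smooth_on_differentiable[OF smooth_\<Phi> x])
  from dd_eq[OF this] have D1: "dd (\<lambda>s. metric s V W) z U =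
      - 2 * (fibre z \<bullet> d\<Gamma> (base z) (base U) (base V) (base W)
          + fibre U \<bullet> \<Gamma> (base z) (base V) (base W)) + d\<Phi> (base z) (base U) (base V) (base W)"
    by (simp add: d\<Gamma>_def d\<Phi>_def)
  have M: "metric z (christ z U V) W = fibre_form z U V (base W) + fibre W \<bullet> \<Gamma> (base z) (base U) (base V)
      - 2 * (fibre z \<bullet> \<Gamma> (base z) (\<Gamma> (base z) (base U) (base V)) (base W))
      + \<Phi> (base z) (\<Gamma> (base z) (base U) (base V)) (base W)" for V W
    by (simp add: metric_def fibre_christ[OF assms])
  show ?thesis
    unfolding D1 metric_sym[OF assms, of V "christ z U W"] M[of V W] M[of W V]
    using sym_\<Gamma>[OF x, of "base W" "base V"] d\<Gamma>_sym[OF x, of _ "base W" "base V"]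
      d\<Phi>_sym[OF x, of _ "base W" "base V"] d\<Gamma>_sym[OF x, of _ "base V" "base U"]
      d\<Phi>_sym[OF x, of _ "base V" "base U"] d\<Gamma>_sym[OF x, of _ "base W" "base U"]
      d\<Phi>_sym[OF x, of _ "base W" "base U"]
    by (simp add: form_simps)
qed

lemma fibre_pairing_dd:
  assumes f: "f differentiable (at z)" and eq: "\<And>x. x \<in> T \<Longrightarrow> fibre (f x) \<bullet> w = h x" and z: "z \<in> T"
  shows "fibre (dd f z U) \<bullet> w = dd h z U"
proof -
  have "bounded_linear (\<lambda>u. fibre u \<bullet> w)"
    by (rule bounded_linear_compose[OF bounded_linear_inner_left bounded_linear_fibre])
  then have "fibre (dd f z U) \<bullet> w = dd (\<lambda>x. fibre (f x) \<bullet> w) z U"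
    by (rule dd_linear_comp[OF _ f, symmetric])
  also have "dd (\<lambda>x. fibre (f x) \<bullet> w) z = dd h z"
    by (rule dd_cong[OF open_T z eq])
  finally show ?thesis .
qed

text \<open>The base part of the Christoffel map depends on base parts only, so the projection to the base
  carries the curvature of the extension to the curvature of the base.\<close>

lemma base_local_curv_christ:
  assumes "z \<in> T"
  shows "base (local_curv christ z U V W) = local_curv \<Gamma> (base z) (base U) (base V) (base W)"
proof -
  have x: "base z \<in> S" using assms by simp
  have "base (dd (\<lambda>x. christ x V W) z U) = dd (\<lambda>x. \<Gamma> x (base V) (base W)) (base z) (base U)" for U V W
  proof -
    have "base (dd (\<lambda>x. christ x V W) z U) = dd (\<lambda>x. base (christ x V W)) z U"
      by (rule dd_linear_comp[OF bounded_linear_base smooth_on_differentiable[OF smooth_christ assms], symmetric])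
    also have "\<dots> = dd (\<lambda>x. \<Gamma> x (base V) (base W)) (base z) (base U)"
      using dd_comp_base[of "\<lambda>x. \<Gamma> x (base V) (base W)"] smooth_on_differentiable[OF smooth_\<Gamma> x] by simp
    finally show ?thesis .
  qed
  then show ?thesis by (simp add: local_curv_def)
qed

text \<open>On vertical vectors the Jacobi operator of the extension is dual to the one of the base. The four
  terms of the curvature are computed in turn: the derivative of the fibre form in the vertical direction \<open>U\<close> is
  its slope paired with \<open>fibre U\<close>, and the form with one vertical argument \<open>U\<close> reduces to the single term
  \<open>- fibre U \<bullet> \<Gamma>(v,w)\<close>. So \<open>fibre U\<close> is paired with an expression in \<open>\<Gamma>\<close> alone, which is the curvature of the
  base.\<close>

lemma fibre_local_curv_christ_vertical:
  assumes z: "z \<in> T" and U: "base U = 0"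
  shows "fibre (local_curv christ z U V V) \<bullet> w = fibre U \<bullet> local_curv \<Gamma> (base z) w (base V) (base V)"
proof -
  have x: "base z \<in> S" using z by simp
  let ?x = "base z" and ?v = "base V"
  have "((\<lambda>x. fibre_form x V V w) has_derivative
      (\<lambda>U. dd (\<lambda>x. form_const x V V w) ?x (base U)
        - (fibre z \<bullet> dd (\<lambda>x. form_slope x ?v ?v w) ?x (base U) + fibre U \<bullet> form_slope ?x ?v ?v w))) (at z)"
    unfolding fibre_form_def
    by (intro has_derivative_diff has_derivative_comp_base[where q = "\<lambda>x. form_const x V V w"]
        has_derivative_fibre_pairing[where q = "\<lambda>x. form_slope x ?v ?v w"]
        smooth_on_differentiable[OF smooth_form_const x] smooth_on_differentiable[OF smooth_form_slope x])
  from dd_eq[OF this] have "dd (\<lambda>x. fibre_form x V V w) z U = - (fibre U \<bullet> form_slope ?x ?v ?v w)"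
    using linear_0[OF smooth_on_linear_dd[OF smooth_form_const x]]
      linear_0[OF smooth_on_linear_dd[OF smooth_form_slope x]] by (simp add: U)
  then have t1: "fibre (dd (\<lambda>x. christ x V V) z U) \<bullet> w = - (fibre U \<bullet> form_slope ?x ?v ?v w)"
    using fibre_pairing_dd[OF smooth_on_differentiable[OF smooth_christ z] fibre_christ z] by simp
  have kU: "fibre_form x U V w = - (fibre U \<bullet> \<Gamma> (base x) (base V) w)" if "x \<in> T" for x V w
    using that by (simp add: fibre_form_def form_const_def form_slope_def U lins)
  have "fibre (dd (\<lambda>x. christ x U V) z V) \<bullet> w = dd (\<lambda>x. - (fibre U \<bullet> \<Gamma> (base x) ?v w)) z V"
    using kU by (intro fibre_pairing_dd[OF smooth_on_differentiable[OF smooth_christ z] _ z])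
      (simp add: fibre_christ)
  also have "\<dots> = dd (\<lambda>x. - (fibre U \<bullet> \<Gamma> x ?v w)) ?x ?v"
    by (rule dd_comp_base[where q = "\<lambda>x. - (fibre U \<bullet> \<Gamma> x ?v w)"])
      (intro smooth_on_differentiable[OF _ x] smooth_on_uminus smooth_on_inner smooth_on_const
        smooth_\<Gamma> open_S)
  also have "\<dots> = - (fibre U \<bullet> d\<Gamma> ?x ?v ?v w)"
    unfolding d\<Gamma>_def
    by (rule dd_linear_comp[where L = "\<lambda>a. - (fibre U \<bullet> a)"])
      (intro bounded_linear_minus bounded_linear_inner_right smooth_on_differentiable[OF smooth_\<Gamma> x])+
  finally have t2: "fibre (dd (\<lambda>x. christ x U V) z V) \<bullet> w = - (fibre U \<bullet> d\<Gamma> ?x ?v ?v w)" .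
  have t3: "fibre (christ z U (christ z V V)) \<bullet> w = - (fibre U \<bullet> \<Gamma> ?x (\<Gamma> ?x ?v ?v) w)"
    using kU[OF z, of "christ z V V"] by (simp add: fibre_christ[OF z])
  have "fibre (christ z V (christ z U V)) \<bullet> w = fibre_form z (christ z U V) V w"
    by (simp add: fibre_christ[OF z] fibre_form_sym[OF z, of V])
  also have "\<dots> = - (fibre (christ z U V) \<bullet> \<Gamma> ?x ?v w)"
    using x by (simp add: fibre_form_def form_const_def form_slope_def U lins)
  also have "\<dots> = fibre U \<bullet> \<Gamma> ?x ?v (\<Gamma> ?x ?v w)"
    by (simp add: fibre_christ[OF z] kU[OF z])
  finally have t4: "fibre (christ z V (christ z U V)) \<bullet> w = fibre U \<bullet> \<Gamma> ?x ?v (\<Gamma> ?x ?v w)" .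
  have "local_curv \<Gamma> ?x w ?v ?v = d\<Gamma> ?x w ?v ?v - d\<Gamma> ?x ?v ?v w
      + \<Gamma> ?x (\<Gamma> ?x ?v ?v) w - \<Gamma> ?x ?v (\<Gamma> ?x ?v w)"
    using d\<Gamma>_sym[OF x, of ?v w ?v] sym_\<Gamma>[OF x, of w]
    by (simp add: local_curv_def d\<Gamma>_def[symmetric])
  moreover have "fibre (local_curv christ z U V V) \<bullet> w = - (fibre U \<bullet> form_slope ?x ?v ?v w)
      + fibre U \<bullet> d\<Gamma> ?x ?v ?v w - fibre U \<bullet> \<Gamma> ?x (\<Gamma> ?x ?v ?v) w - fibre U \<bullet> \<Gamma> ?x ?v (\<Gamma> ?x ?v w)"
    unfolding local_curv_def by (simp add: inner_diff_left inner_add_left t1 t2 t3 t4)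
  moreover have "fibre U \<bullet> form_slope ?x ?v ?v w = 2 * (fibre U \<bullet> d\<Gamma> ?x ?v ?v w) - fibre U \<bullet> d\<Gamma> ?x w ?v ?v
      - 2 * (fibre U \<bullet> \<Gamma> ?x (\<Gamma> ?x ?v ?v) w)"
    unfolding form_slope_def inner_diff_right inner_add_right inner_scaleR_right by simp
  ultimately show ?thesis by (simp add: inner_diff_right inner_add_right)
qed

end

section \<open>The cotangent bundle\<close>

lemma cdom_cotangent [simp]: "cdom (cotangent_chart A c) = cdom c \<times> UNIV"
  by (simp add: cotangent_chart_def)

lemma base_cotangent [simp]: "base (cmap (cotangent_chart A c) \<xi>) = cmap c (fst \<xi>)"
  by (cases \<xi>) (simp add: cotangent_chart_def base_def vec_eq_iff)

lemma fibre_cotangent: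
  "fibre (cmap (cotangent_chart A c) \<xi>) $ i = blinfun_apply (snd \<xi>) (const_field A c (axis i 1) (fst \<xi>))"
  by (cases \<xi>) (simp add: cotangent_chart_def fibre_def coord_field_eq)

context
  fixes A :: "('a, 'm::finite) chart set"
  assumes at: "smooth_atlas A"
begin

lemma linear_const_field: "c \<in> A \<Longrightarrow> p \<in> cdom c \<Longrightarrow> linear (\<lambda>u. const_field A c u p)"
  unfolding const_field_def
  using linear_jac[OF at] chart_at_in[OF at] chart_points[OF at] by blast

lemma fibre_cotangent_pairing:
  assumes "c \<in> A" "fst \<xi> \<in> cdom c"
  shows "fibre (cmap (cotangent_chart A c) \<xi>) \<bullet> v = blinfun_apply (snd \<xi>) (const_field A c v (fst \<xi>))"
proof -
  have "linear (\<lambda>v. blinfun_apply (snd \<xi>) (const_field A c v (fst \<xi>)))"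
    using linear_compose[OF linear_const_field[OF assms]
        bounded_linear.linear[OF blinfun.bounded_linear_right[of "snd \<xi>"]]] by (simp add: o_def)
  from linear_eq_sum_axis[OF this, of v] show ?thesis
    by (simp add: inner_vec_def fibre_cotangent mult.commute)
qed

lemma covector_eq_fibre_components:
  assumes "c \<in> A" "fst \<xi> \<in> cdom c"
  shows "blinfun_apply (snd \<xi>) v = fibre (cmap (cotangent_chart A c) \<xi>) \<bullet> components A c (fst \<xi>) v"
  by (simp add: fibre_cotangent_pairing[OF assms] const_field_components[OF at assms])

lemma components_const_field_jac:
  assumes "c \<in> A" "d \<in> A" "p \<in> cdom c" "p \<in> cdom d"
  shows "components A d p (const_field A c u p) = jac c d p u"
  using components_jac[OF at assms, of "const_field A c u p"]
  by (simp add: components_const_field[OF at assms(1,3)])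

text \<open>A covector with prescribed fibre coordinates is obtained by pairing these with the components of a
  vector; so a chart of the bundle is onto all of the fibre over its base domain.\<close>

lemma image_cotangent:
  assumes c: "c \<in> A" and U: "U \<subseteq> cdom c"
  shows "cmap (cotangent_chart A c) ` (U \<times> UNIV) = {z. base z \<in> cmap c ` U}"
proof (intro equalityI subsetI)
  fix z assume "z \<in> {z. base z \<in> cmap c ` U}"
  then obtain p where p: "p \<in> U" "base z = cmap c p" by blast
  then have pc: "p \<in> cdom c" using U by blast
  define \<omega> where "\<omega> = Blinfun (\<lambda>v. fibre z \<bullet> components A c p v)"
  have "linear (\<lambda>v. fibre z \<bullet> components A c p v)"
    using linear_compose[OF linear_components[OF at c pc]
        bounded_linear.linear[OF bounded_linear_inner_right[of "fibre z"]]] by (simp add: o_def)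
  then have \<omega>: "blinfun_apply \<omega> v = fibre z \<bullet> components A c p v" for v
    unfolding \<omega>_def by (simp add: bounded_linear_Blinfun_apply linear_conv_bounded_linear)
  have "cmap (cotangent_chart A c) (p, \<omega>) = z"
    by (rule join_eqI)
      (use p in \<open>simp_all add: vec_eq_iff fibre_cotangent \<omega> components_const_field[OF at c pc] inner_axis\<close>)
  then show "z \<in> cmap (cotangent_chart A c) ` (U \<times> UNIV)" using p by force
qed auto

lemma inj_cotangent:
  assumes c: "c \<in> A"
  shows "inj_on (cmap (cotangent_chart A c)) (cdom (cotangent_chart A c))"
proof (rule inj_onI)
  fix \<xi> \<eta> assume \<xi>: "\<xi> \<in> cdom (cotangent_chart A c)" and \<eta>: "\<eta> \<in> cdom (cotangent_chart A c)" and eq: "cmap (cotangent_chart A c) \<xi> = cmap (cotangent_chart A c) \<eta>"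
  have d: "fst \<xi> \<in> cdom c" "fst \<eta> \<in> cdom c" using \<xi> \<eta> by auto
  have "cmap c (fst \<xi>) = cmap c (fst \<eta>)" using base_cotangent eq by metis
  then have 1: "fst \<xi> = fst \<eta>" using cinv_cmap[OF at c] d by metis
  have "snd \<xi> = snd \<eta>"
    by (rule blinfun_eqI) (simp add: covector_eq_fibre_components[OF c d(1)]
        covector_eq_fibre_components[OF c d(2)] eq 1)
  with 1 show "\<xi> = \<eta>" by (simp add: prod_eq_iff)
qed

lemma transition_cotangent:
  assumes "c \<in> A" "fst \<xi> \<in> cdom c"
  shows "transition (cotangent_chart A c) (cotangent_chart A d) (cmap (cotangent_chart A c) \<xi>) = cmap (cotangent_chart A d) \<xi>"
  using inv_into_f_f[OF inj_cotangent[OF assms(1)], of \<xi>] assms(2)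
  by (simp add: transition_def cinv_def mem_Times_iff)

lemma cotangent_overlap:
  assumes "c \<in> A"
  shows "cmap (cotangent_chart A c) ` (cdom (cotangent_chart A c) \<inter> cdom (cotangent_chart A d)) = {z. base z \<in> cmap c ` (cdom c \<inter> cdom d)}"
proof -
  have "cdom (cotangent_chart A c) \<inter> cdom (cotangent_chart A d) = (cdom c \<inter> cdom d) \<times> UNIV" by auto
  then show ?thesis using image_cotangent[OF assms, of "cdom c \<inter> cdom d"] by simp
qed

text \<open>The fibre coordinates transform contragrediently. The second identity is explicit and gives
  smoothness; the third one is implicit but involves only the transition map in one direction, which
  makes it the better one to differentiate.\<close>

lemma transition_cotangent_coords:
  assumes c: "c \<in> A" and d: "d \<in> A" and z: "base z \<in> cmap c ` (cdom c \<inter> cdom d)"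
  shows "base (transition (cotangent_chart A c) (cotangent_chart A d) z) = transition c d (base z)"
    and "fibre (transition (cotangent_chart A c) (cotangent_chart A d) z) $ i
      = fibre z \<bullet> dd (transition d c) (transition c d (base z)) (axis i 1)"
    and "fibre (transition (cotangent_chart A c) (cotangent_chart A d) z) \<bullet> dd (transition c d) (base z) e = fibre z \<bullet> e"
proof -
  have "z \<in> cmap (cotangent_chart A c) ` (cdom (cotangent_chart A c) \<inter> cdom (cotangent_chart A d))" using cotangent_overlap[OF c, of d] z by simp
  then obtain \<xi> where \<xi>: "fst \<xi> \<in> cdom c" "fst \<xi> \<in> cdom d" and zx: "z = cmap (cotangent_chart A c) \<xi>" by auto
  have t: "transition c d (cmap c (fst \<xi>)) = cmap d (fst \<xi>)"
    by (rule transition_cmap[OF at c \<xi>(1)])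
  show "base (transition (cotangent_chart A c) (cotangent_chart A d) z) = transition c d (base z)"
    by (simp add: zx transition_cotangent[OF c \<xi>(1)] t)
  show "fibre (transition (cotangent_chart A c) (cotangent_chart A d) z) $ i
      = fibre z \<bullet> dd (transition d c) (transition c d (base z)) (axis i 1)"
    by (simp add: zx transition_cotangent[OF c \<xi>(1)] t fibre_cotangent
        covector_eq_fibre_components[OF c \<xi>(1)] components_const_field_jac[OF d c \<xi>(2,1)])
  have "const_field A d (jac c d (fst \<xi>) e) (fst \<xi>) = const_field A c e (fst \<xi>)"
    unfolding const_field_def
    using jac_comp[OF at c d _ \<xi>] chart_at_in[OF at chart_points[OF at c \<xi>(1)]] by simp
  then show "fibre (transition (cotangent_chart A c) (cotangent_chart A d) z) \<bullet> dd (transition c d) (base z) e = fibre z \<bullet> e"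
    by (simp add: zx transition_cotangent[OF c \<xi>(1)] fibre_cotangent_pairing[OF d \<xi>(2)]
        fibre_cotangent_pairing[OF c \<xi>(1)])
qed

lemma smooth_transition_cotangent:
  assumes c: "c \<in> A" and d: "d \<in> A"
  shows "smooth_on {z. base z \<in> cmap c ` (cdom c \<inter> cdom d)} (transition (cotangent_chart A c) (cotangent_chart A d))"
    (is "smooth_on ?T _")
proof -
  let ?S = "cmap c ` (cdom c \<inter> cdom d)" and ?S' = "cmap d ` (cdom d \<inter> cdom c)"
  note S = open_overlap[OF at c d] and S' = open_overlap[OF at d c]
  have T: "open ?T" by (rule open_base_vimage[OF S])
  have sb: "smooth_on ?T base"
    by (rule smooth_on_bounded_linear[OF T bounded_linear_base smooth_on_id])
  have sf: "smooth_on ?T fibre"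
    by (rule smooth_on_bounded_linear[OF T bounded_linear_fibre smooth_on_id])
  have s1: "smooth_on ?T (\<lambda>z. transition c d (base z))"
    by (rule smooth_on_compose[OF T S _ sb smooth_transition[OF at c d]]) auto
  have im: "(\<lambda>z. transition c d (base z)) ` ?T \<subseteq> ?S'"
    using transition_cmap[OF at c, of _ d] by auto
  have s2: "smooth_on ?T (\<lambda>z. fibre z \<bullet> dd (transition d c) (transition c d (base z)) (axis i 1))" for i
    by (rule smooth_on_inner[OF T sf
          smooth_on_compose[OF T S' im s1 smooth_on_dd[OF smooth_transition[OF at d c]]]])
  show ?thesis
  proof (rule smooth_on_base_fibre[OF T])
    show "smooth_on ?T (\<lambda>z. base (transition (cotangent_chart A c) (cotangent_chart A d) z))"
      by (rule smooth_on_transform[OF T s1]) (use transition_cotangent_coords(1)[OF c d] in simp)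
    show "smooth_on ?T (\<lambda>z. fibre (transition (cotangent_chart A c) (cotangent_chart A d) z))"
      unfolding smooth_on_vec_iff[OF T]
    proof
      fix i
      show "smooth_on ?T (\<lambda>z. fibre (transition (cotangent_chart A c) (cotangent_chart A d) z) $ i)"
        by (rule smooth_on_transform[OF T s2[of i]])
          (use transition_cotangent_coords(2)[OF c d] in simp)
    qed
  qed
qed

lemma smooth_atlas_cotangent: "smooth_atlas (cotangent_bundle A)"
proof -
  have "open (cmap (cotangent_chart A c) ` cdom (cotangent_chart A c))" if "c \<in> A" for c
    using image_cotangent[OF that order_refl] open_base_vimage[OF open_chart[OF at that]] by simp
  moreover have "open (cmap (cotangent_chart A c) ` (cdom (cotangent_chart A c) \<inter> cdom (cotangent_chart A d)))
      \<and> smooth_on (cmap (cotangent_chart A c) ` (cdom (cotangent_chart A c) \<inter> cdom (cotangent_chart A d))) (transition (cotangent_chart A c) (cotangent_chart A d))"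
    if "c \<in> A" "d \<in> A" for c d
    unfolding cotangent_overlap[OF that(1)]
    using open_base_vimage[OF open_overlap[OF at that]] smooth_transition_cotangent[OF that] by blast
  ultimately show ?thesis
    unfolding smooth_atlas_def cotangent_bundle_def using inj_cotangent by blast
qed

lemma cotangent_chart_in: "c \<in> A \<Longrightarrow> cotangent_chart A c \<in> cotangent_bundle A"
  by (simp add: cotangent_bundle_def)

lemma points_cotangent: "points (cotangent_bundle A) = points A \<times> UNIV"
  by (auto simp: points_def cotangent_bundle_def)

lemma base_jac_cotangent:
  assumes c: "c \<in> A" and d: "d \<in> A" and \<xi>: "fst \<xi> \<in> cdom c" "fst \<xi> \<in> cdom d"
  shows "base (jac (cotangent_chart A c) (cotangent_chart A d) \<xi> U) = jac c d (fst \<xi>) (base U)"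
proof -
  let ?T = "{z. base z \<in> cmap c ` (cdom c \<inter> cdom d)}" and ?z = "cmap (cotangent_chart A c) \<xi>"
  have T: "open ?T" by (rule open_base_vimage[OF open_overlap[OF at c d]])
  have z: "?z \<in> ?T" using \<xi> by simp
  have "base (jac (cotangent_chart A c) (cotangent_chart A d) \<xi> U) = dd (\<lambda>z. base (transition (cotangent_chart A c) (cotangent_chart A d) z)) ?z U"
    by (rule dd_linear_comp[OF bounded_linear_base
          smooth_on_differentiable[OF smooth_transition_cotangent[OF c d] z], symmetric])
  also have "dd (\<lambda>z. base (transition (cotangent_chart A c) (cotangent_chart A d) z)) ?z = dd (\<lambda>z. transition c d (base z)) ?z"
    by (rule dd_cong[OF T z]) (use transition_cotangent_coords(1)[OF c d] in simp)
  also have "dd (\<lambda>z. transition c d (base z)) ?z U = jac c d (fst \<xi>) (base U)"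
    using dd_comp_base[of "transition c d" ?z] transition_differentiable[OF at c d \<xi>] by simp
  finally show ?thesis .
qed

text \<open>Obtained by differentiating the invariance of the pairing of covectors and vectors. The correction
  term is the second derivative of the base transition map paired with the covector; it is the term which the
  Christoffel symbols in the metric absorb.\<close>

lemma fibre_jac_cotangent:
  assumes c: "c \<in> A" and d: "d \<in> A" and \<xi>: "fst \<xi> \<in> cdom c" "fst \<xi> \<in> cdom d"
  shows "fibre (jac (cotangent_chart A c) (cotangent_chart A d) \<xi> U) \<bullet> jac c d (fst \<xi>) e
    = fibre U \<bullet> e
      - fibre (cmap (cotangent_chart A d) \<xi>) \<bullet> dd (\<lambda>s. dd (transition c d) s e) (cmap c (fst \<xi>)) (base U)"
proof -
  let ?T = "{z. base z \<in> cmap c ` (cdom c \<inter> cdom d)}" and ?z = "cmap (cotangent_chart A c) \<xi>"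
  let ?f = "transition c d" and ?F = "transition (cotangent_chart A c) (cotangent_chart A d)"
  have T: "open ?T" by (rule open_base_vimage[OF open_overlap[OF at c d]])
  have z: "?z \<in> ?T" using \<xi> by simp
  have F: "(?F has_derivative dd ?F ?z) (at ?z)"
    by (rule dd_works[OF smooth_on_differentiable[OF smooth_transition_cotangent[OF c d] z]])
  have "((\<lambda>z. fibre (?F z) \<bullet> dd ?f (base z) e) has_derivative
      (\<lambda>U. fibre (?F ?z) \<bullet> dd (\<lambda>s. dd ?f s e) (base ?z) (base U) + fibre (dd ?F ?z U) \<bullet> dd ?f (base ?z) e))
      (at ?z)"
    using \<xi> smooth_on_differentiable[OF smooth_on_dd[OF smooth_transition[OF at c d]], of "base ?z" e]
    by (intro has_derivative_inner bounded_linear.has_derivative[OF bounded_linear_fibre F]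
        has_derivative_comp_base[where q = "\<lambda>s. dd ?f s e"]) simp
  from dd_eq[OF this] have "dd (\<lambda>z. fibre (?F z) \<bullet> dd ?f (base z) e) ?z U =
      fibre (cmap (cotangent_chart A d) \<xi>) \<bullet> dd (\<lambda>s. dd ?f s e) (cmap c (fst \<xi>)) (base U)
      + fibre (dd ?F ?z U) \<bullet> jac c d (fst \<xi>) e"
    by (simp add: transition_cotangent[OF c \<xi>(1)])
  moreover have "dd (\<lambda>z. fibre (?F z) \<bullet> dd ?f (base z) e) ?z = dd (\<lambda>z. fibre z \<bullet> e) ?z"
    by (rule dd_cong[OF T z]) (use transition_cotangent_coords(3)[OF c d] in simp)
  moreover have "dd (\<lambda>z. fibre z \<bullet> e) ?z = (\<lambda>U. fibre U \<bullet> e)"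
    by (rule dd_eq) (intro has_derivative_inner_left
        bounded_linear_imp_has_derivative[OF bounded_linear_fibre])
  ultimately show ?thesis by simp
qed

end

section \<open>The deformed Riemannian extension as a metric on the cotangent bundle\<close>

abbreviation ext_metric ::
    "('a, 'm::finite) chart set \<Rightarrow> ('a, 'm) cov_deriv \<Rightarrow> ('a, 'm) two_tensor \<Rightarrow> ('a, 'm) chart \<Rightarrow>
     real^('m + 'm) \<Rightarrow> real^('m + 'm) \<Rightarrow> real^('m + 'm) \<Rightarrow> real" where
  "ext_metric A D \<Phi> c \<equiv> local_extension.metric (christoffel_map A D c) (gram A \<Phi> c)"

abbreviation ext_christ ::
    "('a, 'm::finite) chart set \<Rightarrow> ('a, 'm) cov_deriv \<Rightarrow> ('a, 'm) two_tensor \<Rightarrow> ('a, 'm) chart \<Rightarrow>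
     real^('m + 'm) \<Rightarrow> real^('m + 'm) \<Rightarrow> real^('m + 'm) \<Rightarrow> real^('m + 'm)" where
  "ext_christ A D \<Phi> c \<equiv> local_extension.christ (christoffel_map A D c) (gram A \<Phi> c)"

abbreviation ext_jacobi ::
    "('a, 'm::finite) chart set \<Rightarrow> ('a, 'm) cov_deriv \<Rightarrow> ('a, 'm) two_tensor \<Rightarrow> ('a, 'm) cotangent \<Rightarrow>
     real^('m + 'm) \<Rightarrow> real^('m + 'm) \<Rightarrow> real^('m + 'm)" where
  "ext_jacobi A D \<Phi> \<equiv> jacobi (cotangent_bundle A)
     (levi_civita (cotangent_bundle A) (riemannian_extension A D \<Phi>))"

text \<open>A family of Christoffel maps on the bundle is indexed by charts of the bundle, while the formulas are
  indexed by charts of the base; this function selects a base chart that induces the given one.\<close>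

definition base_chart ::
    "('a, 'm::finite) chart set \<Rightarrow> (('a, 'm) cotangent, 'm + 'm) chart \<Rightarrow> ('a, 'm) chart" where
  "base_chart A K = (SOME c. c \<in> A \<and> cotangent_chart A c = K)"

lemma base_chart:
  assumes "K \<in> cotangent_bundle A"
  shows "base_chart A K \<in> A" "cotangent_chart A (base_chart A K) = K"
proof -
  have "\<exists>c. c \<in> A \<and> cotangent_chart A c = K" using assms by (auto simp: cotangent_bundle_def)
  from someI_ex[OF this] show "base_chart A K \<in> A" "cotangent_chart A (base_chart A K) = K"
    unfolding base_chart_def by blast+
qed

lemma sum_UNIV_Plus:
  fixes f :: "'m::finite + 'n::finite \<Rightarrow> 'b::comm_monoid_add"
  shows "(\<Sum>a\<in>UNIV. f a) = (\<Sum>i\<in>UNIV. f (Inl i)) + (\<Sum>i\<in>UNIV. f (Inr i))"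
  by (simp add: UNIV_Plus_UNIV[symmetric] sum.Plus del: UNIV_Plus_UNIV)

context
  fixes A :: "('a, 'm::finite) chart set" and D :: "('a, 'm) cov_deriv" and \<Phi> :: "('a, 'm) two_tensor"
  assumes at: "smooth_atlas A" and con: "connection A D" and tf: "torsion_free A D"
    and \<Phi>: "smooth_symmetric_tensor A \<Phi>"
begin

lemma local_extension_chart:
  assumes c: "c \<in> A"
  shows "local_extension (cmap c ` cdom c) (christoffel_map A D c) (gram A \<Phi> c)"
proof
  show "open (cmap c ` cdom c)" by (rule open_chart[OF at c])
  note R = represents_christoffel_map[OF at con]
  show "bilinear (christoffel_map A D c x)" for x by (rule bilinear_christoffel_map)
  show "christoffel_map A D c x u v = christoffel_map A D c x v u" if "x \<in> cmap c ` cdom c" for x u v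
    using symmetric_family_if_torsion_free[OF at R tf] c that by (auto simp: symmetric_family_def)
  show "smooth_on (cmap c ` cdom c) (\<lambda>x. christoffel_map A D c x u v)" for u v
    by (rule christoffel_familyD(2)[OF christoffel_family_christoffel_map[OF at con] c])
  show "bilinear (gram A \<Phi> c x)" if "x \<in> cmap c ` cdom c" for x
  proof -
    from that obtain p where p: "p \<in> cdom c" "cinv c x = p" using cinv_cmap[OF at c] by auto
    have b: "bilinear (\<Phi> p)"
      using \<Phi> chart_points[OF at c p(1)] unfolding smooth_symmetric_tensor_def by blast
    show ?thesis
      unfolding bilinear_def gram_def p(2)
      using linear_compose[OF linear_const_field[OF at c p(1)] bilinear_linear1[OF b]]
        linear_compose[OF linear_const_field[OF at c p(1)] bilinear_linear2[OF b]]
      by (simp add: o_def)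
  qed
  show "gram A \<Phi> c x u v = gram A \<Phi> c x v u" if "x \<in> cmap c ` cdom c" for x u v
  proof -
    have "cinv c x \<in> points A" using that chart_points[OF at c] cinv_cmap[OF at c] by auto
    then show ?thesis using \<Phi> unfolding smooth_symmetric_tensor_def gram_def by blast
  qed
  show "smooth_on (cmap c ` cdom c) (\<lambda>x. gram A \<Phi> c x u v)" for u v
  proof -
    have "smooth_fun A (cdom c) (\<lambda>p. \<Phi> p (const_field A c u p) (const_field A c v p))"
      using \<Phi> smooth_vf_const_field[OF at c] unfolding smooth_symmetric_tensor_def by blast
    then have "smooth_on (cmap c ` (cdom c \<inter> cdom c))
        ((\<lambda>p. \<Phi> p (const_field A c u p) (const_field A c v p)) \<circ> cinv c)"
      using c unfolding smooth_fun_def by blast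
    then show ?thesis by (simp add: gram_def o_def)
  qed
qed

lemma ext_metric_eq:
  assumes "c \<in> A"
  shows "ext_metric A D \<Phi> c z U V = fibre U \<bullet> base V + fibre V \<bullet> base U
    - 2 * (fibre z \<bullet> christoffel_map A D c (base z) (base U) (base V)) + gram A \<Phi> c (base z) (base U) (base V)"
  by (rule local_extension.metric_def[OF local_extension_chart[OF assms]])

lemma extension_coeff_sum:
  assumes c: "c \<in> A" and p: "fst \<xi> \<in> cdom c"
  shows "(\<Sum>a\<in>UNIV. \<Sum>b\<in>UNIV. extension_coeff A D \<Phi> c \<xi> a b * U $ a * V $ b)
    = ext_metric A D \<Phi> c (cmap (cotangent_chart A c) \<xi>) U V"
proof -
  let ?z = "cmap (cotangent_chart A c) \<xi>" and ?p = "fst \<xi>"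
  let ?E = "coord_field A c"
  let ?G = "\<lambda>i j. components A c ?p (D (?E i) (?E j) ?p)"
  have x: "cmap c ?p \<in> cmap c ` cdom c" using p by blast
  note bil = local_extension.bilinear_\<Phi>[OF local_extension_chart[OF c] x]
  have G: "fibre ?z \<bullet> christoffel_map A D c (cmap c ?p) u v = (\<Sum>i\<in>UNIV. \<Sum>j\<in>UNIV. u $ i * v $ j * (fibre ?z \<bullet> ?G i j))"
    for u v by (simp add: christoffel_map_def cinv_cmap[OF at c p] inner_sum_right)
  have P: "gram A \<Phi> c (cmap c ?p) u v = (\<Sum>i\<in>UNIV. \<Sum>j\<in>UNIV. u $ i * v $ j * \<Phi> ?p (?E i ?p) (?E j ?p))"
    for u v
  proof -
    have "gram A \<Phi> c (cmap c ?p) u v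
        = (\<Sum>i\<in>UNIV. u $ i *\<^sub>R gram A \<Phi> c (cmap c ?p) (axis i 1) v)"
      by (rule linear_eq_sum_axis[OF bilinear_linear1[OF bil]])
    also have "\<dots> = (\<Sum>i\<in>UNIV. u $ i *\<^sub>R (\<Sum>j\<in>UNIV. v $ j *\<^sub>R gram A \<Phi> c (cmap c ?p) (axis i 1) (axis j 1)))"
      by (subst linear_eq_sum_axis[OF bilinear_linear2[OF bil]]) (rule refl)
    finally show ?thesis
      by (simp add: gram_def cinv_cmap[OF at c p] coord_field_eq sum_distrib_left mult.assoc)
  qed
  have LL: "extension_coeff A D \<Phi> c \<xi> (Inl i) (Inl j) = - 2 * (fibre ?z \<bullet> ?G i j) + \<Phi> ?p (?E i ?p) (?E j ?p)"
    for i j by (simp add: extension_coeff_def christoffel_def inner_vec_def fibre_def)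
  have LR: "extension_coeff A D \<Phi> c \<xi> (Inl i) (Inr j) = (if i = j then 1 else 0)"
    and RL: "extension_coeff A D \<Phi> c \<xi> (Inr i) (Inl j) = (if i = j then 1 else 0)"
    and RR: "extension_coeff A D \<Phi> c \<xi> (Inr i) (Inr j) = 0" for i j
    by (simp_all add: extension_coeff_def)
  have "(\<Sum>a\<in>UNIV. \<Sum>b\<in>UNIV. extension_coeff A D \<Phi> c \<xi> a b * U $ a * V $ b) =
      (\<Sum>i\<in>UNIV. \<Sum>j\<in>UNIV. (- 2 * (fibre ?z \<bullet> ?G i j) + \<Phi> ?p (?E i ?p) (?E j ?p)) * base U $ i * base V $ j)
      + (\<Sum>i\<in>UNIV. \<Sum>j\<in>UNIV. (if i = j then 1 else 0) * base U $ i * fibre V $ j)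
      + (\<Sum>i\<in>UNIV. \<Sum>j\<in>UNIV. (if i = j then 1 else 0) * fibre U $ i * base V $ j)"
    unfolding sum_UNIV_Plus LL LR RL RR by (simp add: sum.distrib base_def fibre_def)
  also have "(\<Sum>i\<in>UNIV. \<Sum>j\<in>UNIV. (if i = j then 1 else 0) * base U $ i * fibre V $ j) = base U \<bullet> fibre V"
    by (simp add: if_distrib[of "\<lambda>x. x * _"] inner_vec_def cong: if_cong)
  also have "(\<Sum>i\<in>UNIV. \<Sum>j\<in>UNIV. (if i = j then 1 else 0) * fibre U $ i * base V $ j) = fibre U \<bullet> base V"
    by (simp add: if_distrib[of "\<lambda>x. x * _"] inner_vec_def cong: if_cong)
  also have "(\<Sum>i\<in>UNIV. \<Sum>j\<in>UNIV. (- 2 * (fibre ?z \<bullet> ?G i j) + \<Phi> ?p (?E i ?p) (?E j ?p)) * base U $ i * base V $ j)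
      = - 2 * (fibre ?z \<bullet> christoffel_map A D c (cmap c ?p) (base U) (base V)) + gram A \<Phi> c (cmap c ?p) (base U) (base V)"
    unfolding G P sum_distrib_left sum.distrib[symmetric] by (simp add: algebra_simps)
  finally show ?thesis by (simp add: ext_metric_eq[OF c] inner_commute)
qed

text \<open>Under a change of chart, the pairings of fibre and base parts pick up \<open>- 2 y(H(u,v))\<close>, with \<open>H\<close> the second
  derivative of the transition map; the transformation law of the Christoffel map contributes \<open>+ 2 y(H(u,v))\<close>
  and restores the invariance.\<close>

lemma ext_metric_invariant:
  assumes c: "c \<in> A" and d: "d \<in> A" and \<xi>: "fst \<xi> \<in> cdom c" "fst \<xi> \<in> cdom d"
  defines "J \<equiv> jac (cotangent_chart A c) (cotangent_chart A d) \<xi>"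
  shows "ext_metric A D \<Phi> d (cmap (cotangent_chart A d) \<xi>) (J U) (J V)
    = ext_metric A D \<Phi> c (cmap (cotangent_chart A c) \<xi>) U V"
proof -
  let ?f = "transition c d" and ?p = "fst \<xi>" and ?y = "fibre (cmap (cotangent_chart A d) \<xi>)"
  let ?H = "\<lambda>u v. dd (\<lambda>s. dd ?f s v) (cmap c ?p) u"
  have J: "base (J U) = jac c d ?p (base U)"
    "fibre (J U) \<bullet> jac c d ?p e = fibre U \<bullet> e - ?y \<bullet> ?H (base U) e" for U e
    unfolding J_def by (rule base_jac_cotangent[OF at c d \<xi>], rule fibre_jac_cotangent[OF at c d \<xi>])
  have y: "?y \<bullet> jac c d ?p e = fibre (cmap (cotangent_chart A c) \<xi>) \<bullet> e" for e
    using transition_cotangent_coords(3)[OF at c d, of "cmap (cotangent_chart A c) \<xi>" e] \<xi>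
    by (simp add: transition_cotangent[OF at c \<xi>(1)])
  have "jac c d ?p (christoffel_map A D c (cmap c ?p) u v)
      = ?H u v + christoffel_map A D d (cmap d ?p) (jac c d ?p u) (jac c d ?p v)" for u v
    using christoffel_law_if_represents[OF at represents_christoffel_map[OF at con], unfolded christoffel_law_def] c d \<xi>
    by blast
  then have G: "?y \<bullet> christoffel_map A D d (cmap d ?p) (jac c d ?p u) (jac c d ?p v) =
      fibre (cmap (cotangent_chart A c) \<xi>) \<bullet> christoffel_map A D c (cmap c ?p) u v - ?y \<bullet> ?H u v" for u v
    unfolding y[symmetric] by (simp add: inner_add_right)
  have "?H u v = ?H v u" for u v
    by (rule second_derivative_symmetric[OF smooth_transition[OF at c d] open_overlap[OF at c d]])
      (use \<xi> in blast)
  then show ?thesis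
    using gram_jac[OF at c d \<xi>, of \<Phi> "base U" "base V"]
    by (simp add: ext_metric_eq[OF c] ext_metric_eq[OF d] J G)
qed

lemma gram_extension:
  assumes c: "c \<in> A" and z: "base z \<in> cmap c ` cdom c"
  shows "gram (cotangent_bundle A) (riemannian_extension A D \<Phi>) (cotangent_chart A c) z
    = ext_metric A D \<Phi> c z"
proof (intro ext)
  fix U V
  let ?B = "cotangent_bundle A" and ?C = "cotangent_chart A"
  note bat = smooth_atlas_cotangent[OF at]
  have "z \<in> cmap (?C c) ` cdom (?C c)"
    using image_cotangent[OF at c order_refl] z by simp
  then obtain \<xi> where \<xi>: "\<xi> \<in> cdom (?C c)" and zx: "z = cmap (?C c) \<xi>" by (rule imageE)
  have pc: "fst \<xi> \<in> cdom c" using \<xi> by auto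
  \<comment> \<open>The metric is defined through the chart chosen at the base point, which need not induce the chart
    chosen at the point of the bundle.\<close>
  define d where "d = chart_at A (fst \<xi>)"
  have d: "d \<in> A" "fst \<xi> \<in> cdom d"
    using chart_at_in[OF at chart_points[OF at c pc]] by (auto simp: d_def)
  have \<xi>d: "\<xi> \<in> cdom (?C d)" using d by (simp add: mem_Times_iff)
  note Cc = cotangent_chart_in[OF at c] and Cd = cotangent_chart_in[OF at d(1)]
  have "gram ?B (riemannian_extension A D \<Phi>) (?C c) z U V
      = riemannian_extension A D \<Phi> \<xi> (const_field ?B (?C c) U \<xi>) (const_field ?B (?C c) V \<xi>)"
    by (simp add: gram_def zx cinv_cmap[OF bat Cc \<xi>])
  also have "\<dots> = ext_metric A D \<Phi> d (cmap (?C d) \<xi>)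
      (components ?B (?C d) \<xi> (const_field ?B (?C c) U \<xi>))
      (components ?B (?C d) \<xi> (const_field ?B (?C c) V \<xi>))"
    by (simp add: riemannian_extension_def Let_def d_def[symmetric] extension_coeff_sum[OF d])
  also have "\<dots> = ext_metric A D \<Phi> c z U V"
    unfolding components_const_field_jac[OF bat Cc Cd \<xi> \<xi>d] zx
    by (rule ext_metric_invariant[OF c d(1) pc d(2)])
  finally show "gram ?B (riemannian_extension A D \<Phi>) (?C c) z U V = ext_metric A D \<Phi> c z U V" .
qed

lemma cotangent_chart_cases:
  assumes "K \<in> cotangent_bundle A"
  obtains c where "c \<in> A" "c = base_chart A K" "K = cotangent_chart A c"
    "cmap K ` cdom K = {z. base z \<in> cmap c ` cdom c}"
  using base_chart[OF assms] image_cotangent[OF at _ order_refl] by (metis cdom_cotangent)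

lemma extension_christoffel:
  shows "pseudo_metric (cotangent_bundle A) (riemannian_extension A D \<Phi>)"
    and "christoffel_family (cotangent_bundle A) (\<lambda>K. ext_christ A D \<Phi> (base_chart A K))"
    and "symmetric_family (cotangent_bundle A) (\<lambda>K. ext_christ A D \<Phi> (base_chart A K))"
    and "metric_compatible (cotangent_bundle A) (riemannian_extension A D \<Phi>)
      (\<lambda>K. ext_christ A D \<Phi> (base_chart A K))"
proof -
  let ?g = "gram (cotangent_bundle A) (riemannian_extension A D \<Phi>)"
    and ?G = "\<lambda>K. ext_christ A D \<Phi> (base_chart A K)"
  have m: "(\<forall>z\<in>cmap K ` cdom K. bilinear (?g K z) \<and> (\<forall>u v. ?g K z u v = ?g K z v u) \<and>
        (\<forall>u. (\<forall>v. ?g K z u v = 0) \<longrightarrow> u = 0)) \<and>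
      (\<forall>u v. smooth_on (cmap K ` cdom K) (\<lambda>z. ?g K z u v))"
    and f: "(\<forall>z\<in>cmap K ` cdom K. bilinear (?G K z)) \<and>
      (\<forall>u v. smooth_on (cmap K ` cdom K) (\<lambda>z. ?G K z u v))"
    and s: "\<forall>z\<in>cmap K ` cdom K. \<forall>u v. ?G K z u v = ?G K z v u"
    and co: "\<forall>z\<in>cmap K ` cdom K. \<forall>u v w. dd (\<lambda>s. ?g K s v w) z u
        = ?g K z (?G K z u v) w + ?g K z v (?G K z u w)"
    if KB: "K \<in> cotangent_bundle A" for K
  proof -
    obtain c where c: "c \<in> A" and b: "c = base_chart A K" and K: "K = cotangent_chart A c"
      and im: "cmap K ` cdom K = {z. base z \<in> cmap c ` cdom c}"
      by (rule cotangent_chart_cases[OF KB])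
    interpret local_extension "cmap c ` cdom c" "christoffel_map A D c" "gram A \<Phi> c"
      by (rule local_extension_chart[OF c])
    have g: "?g K z = metric z" if "z \<in> T" for z
      unfolding K using gram_extension[OF c] that by blast
    have "smooth_on T (\<lambda>z. ?g K z u v)" for u v
      by (rule smooth_on_transform[OF open_T smooth_metric[of u v]]) (simp add: g)
    then show "(\<forall>z\<in>cmap K ` cdom K. bilinear (?g K z) \<and> (\<forall>u v. ?g K z u v = ?g K z v u) \<and>
        (\<forall>u. (\<forall>v. ?g K z u v = 0) \<longrightarrow> u = 0)) \<and>
      (\<forall>u v. smooth_on (cmap K ` cdom K) (\<lambda>z. ?g K z u v))"
      unfolding im using g bilinear_metric metric_sym metric_nondegenerate by metis
    show "(\<forall>z\<in>cmap K ` cdom K. bilinear (?G K z)) \<and>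
      (\<forall>u v. smooth_on (cmap K ` cdom K) (\<lambda>z. ?G K z u v))"
      unfolding im b[symmetric] using bilinear_christ smooth_christ by blast
    show "\<forall>z\<in>cmap K ` cdom K. \<forall>u v. ?G K z u v = ?G K z v u"
      unfolding im b[symmetric] using christ_sym by blast
    show "\<forall>z\<in>cmap K ` cdom K. \<forall>u v w. dd (\<lambda>s. ?g K s v w) z u
        = ?g K z (?G K z u v) w + ?g K z v (?G K z u w)"
      unfolding im b[symmetric]
    proof (intro ballI allI)
      fix z u v w assume z: "z \<in> T"
      have "dd (\<lambda>s. ?g K s v w) z = dd (\<lambda>s. metric s v w) z"
        by (rule dd_cong[OF open_T z]) (simp add: g)
      then show "dd (\<lambda>s. ?g K s v w) z u = ?g K z (christ z u v) w + ?g K z v (christ z u w)"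
        using metric_compatible_christ[OF z] by (simp add: g[OF z])
    qed
  qed
  show "pseudo_metric (cotangent_bundle A) (riemannian_extension A D \<Phi>)"
    unfolding pseudo_metric_def using m by (rule ballI)
  show "christoffel_family (cotangent_bundle A) ?G"
    unfolding christoffel_family_def using f by (rule ballI)
  show "symmetric_family (cotangent_bundle A) ?G"
    unfolding symmetric_family_def using s by (rule ballI)
  show "metric_compatible (cotangent_bundle A) (riemannian_extension A D \<Phi>) ?G"
    unfolding metric_compatible_def using co by (rule ballI)
qed

lemma extension_jacobi:
  assumes \<xi>: "\<xi> \<in> points (cotangent_bundle A)"
  defines "c \<equiv> base_chart A (chart_at (cotangent_bundle A) \<xi>)"
  defines "z \<equiv> cmap (cotangent_chart A c) \<xi>"
  shows "c \<in> A" "fst \<xi> \<in> cdom c"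
    and "riemannian_extension A D \<Phi> \<xi> U V = ext_metric A D \<Phi> c z U V"
    and "ext_jacobi A D \<Phi> \<xi> U V
      = local_curv (ext_christ A D \<Phi> c) z V U U"
proof -
  let ?B = "cotangent_bundle A"
  let ?K = "chart_at ?B \<xi>"
  note bat = smooth_atlas_cotangent[OF at]
  have K: "?K \<in> ?B" "\<xi> \<in> cdom ?K" using chart_at_in[OF bat \<xi>] by auto
  show c: "c \<in> A" using base_chart[OF K(1)] by (simp add: c_def)
  have Kc: "?K = cotangent_chart A c" using base_chart[OF K(1)] by (simp add: c_def)
  show pc: "fst \<xi> \<in> cdom c" using K(2) unfolding Kc by auto
  have id: "components ?B ?K \<xi> v = v" for v by (rule components_chart_at[OF bat \<xi>])
  have "riemannian_extension A D \<Phi> \<xi> U V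
      = gram ?B (riemannian_extension A D \<Phi>) ?K (cmap ?K \<xi>) U V"
    using gram_components[OF bat K, of "riemannian_extension A D \<Phi>" U V] by (simp add: id)
  then show "riemannian_extension A D \<Phi> \<xi> U V = ext_metric A D \<Phi> c z U V"
    using gram_extension[OF c, of z] pc by (simp add: Kc z_def)
  note L = levi_civita_represented[OF bat extension_christoffel]
  have "base_chart A ?K = c" by (simp only: c_def)
  moreover have "cmap ?K \<xi> = z" unfolding z_def by (simp only: Kc)
  ultimately show "ext_jacobi A D \<Phi> \<xi> U V
      = local_curv (ext_christ A D \<Phi> c) z V U U"
    using jacobi_components[OF bat L(3) extension_christoffel(2) L(1,2) K, of U V]
    by (simp only: id)
qed

end

section \<open>Spectra\<close>

text \<open>Spectra are compared through eigenvectors, as only the set of eigenvalues matters; this avoids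
  the determinants of block matrices.\<close>

lemma det_eq_0_iff_eigenvector:
  fixes X :: "'k::field^'n::finite^'n"
  shows "det X = 0 \<longleftrightarrow> (\<exists>v. v \<noteq> 0 \<and> X *v v = 0)"
  using invertible_det_nz[of X] invertible_left_inverse[of X] matrix_left_invertible_ker[of X] by blast

definition cmatrix :: "(real^'n \<Rightarrow> real^'n) \<Rightarrow> complex^'n^'n::finite" where
  "cmatrix T = (\<chi> i j. complex_of_real (matrix T $ i $ j))"

lemma Spec_iff: "\<mu> \<in> Spec T \<longleftrightarrow> det (cmatrix T - mat \<mu>) = 0"
  by (simp add: Spec_def cmatrix_def)

lemma cmatrix_compose:
  assumes "linear S" "linear T"
  shows "cmatrix (S \<circ> T) = cmatrix S ** cmatrix T"
  by (simp add: cmatrix_def matrix_compose[OF assms(2,1)] matrix_matrix_mult_def vec_eq_iff)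

lemma cmatrix_id: "cmatrix (\<lambda>v. v) = mat 1"
  by (simp add: cmatrix_def matrix_def mat_def axis_def vec_eq_iff)

lemma Spec_conjugate:
  fixes S T P Q :: "real^'n::finite \<Rightarrow> real^'n"
  assumes lin: "linear S" "linear T" "linear P" "linear Q"
    and inv: "\<And>v. Q (P v) = v" and conj: "\<And>v. P (S v) = T (P v)"
  shows "Spec S = Spec T"
proof -
  have "Q \<circ> P = (\<lambda>v. v)" using inv by (simp add: fun_eq_iff)
  then have "cmatrix Q ** cmatrix P = mat 1"
    using cmatrix_compose[OF lin(4,3)] cmatrix_id by metis
  then have "det (cmatrix Q) * det (cmatrix P) = 1"
    by (metis det_mul det_I)
  then have P: "det (cmatrix P) \<noteq> 0" by auto
  have "P \<circ> S = T \<circ> P" using conj by (simp add: fun_eq_iff)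
  then have "cmatrix P ** cmatrix S = cmatrix T ** cmatrix P"
    using cmatrix_compose[OF lin(3,1)] cmatrix_compose[OF lin(2,3)] by simp
  then have "cmatrix P ** (cmatrix S - mat \<mu>) = (cmatrix T - mat \<mu>) ** cmatrix P" for \<mu>
    by (simp add: vec_eq_iff matrix_matrix_mult_def mat_def right_diff_distrib left_diff_distrib
        sum_subtractf if_distrib[of "\<lambda>x. x * _"] if_distrib[of "\<lambda>x. _ * x"] mult.commute cong: if_cong)
  then have "det (cmatrix P) * det (cmatrix S - mat \<mu>) = det (cmatrix T - mat \<mu>) * det (cmatrix P)" for \<mu>
    by (metis det_mul)
  then have "det (cmatrix S - mat \<mu>) = 0 \<longleftrightarrow> det (cmatrix T - mat \<mu>) = 0" for \<mu>
    using P by (metis mult_eq_0_iff)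
  then show ?thesis by (auto simp: Spec_iff)
qed

text \<open>A kernel vector of the block matrix has either a nonzero upper part, which is in the kernel of \<open>N\<close>,
  or it is purely lower and then in the kernel of the transpose of \<open>N\<close>. Conversely a kernel vector of
  the transpose extends by zero. A matrix and its transpose have the same determinant.\<close>

lemma det_block_lower_triangular_eq_0_iff:
  fixes M :: "'k::field^('m::finite + 'm)^('m + 'm)" and N :: "'k^'m^'m"
  assumes ll: "\<And>i j. M $ Inl i $ Inl j = N $ i $ j" and lr: "\<And>i j. M $ Inl i $ Inr j = 0"
    and rr: "\<And>i j. M $ Inr i $ Inr j = N $ j $ i"
  shows "det M = 0 \<longleftrightarrow> det N = 0"
proof
  assume "det M = 0"
  then obtain v where v: "v \<noteq> 0" "M *v v = 0" using det_eq_0_iff_eigenvector by blast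
  define p q where "p = (\<chi> i. v $ Inl i)" and "q = (\<chi> i. v $ Inr i)"
  have "N *v p = 0"
  proof -
    have "(N *v p) $ i = (M *v v) $ Inl i" for i
      by (simp add: matrix_vector_mult_def sum_UNIV_Plus ll lr p_def)
    then show ?thesis using v by (simp add: vec_eq_iff)
  qed
  moreover have "transpose N *v q = 0" if "p = 0"
  proof -
    have "v $ Inl i = 0" for i using that by (simp add: p_def vec_eq_iff)
    then have "(transpose N *v q) $ i = (M *v v) $ Inr i" for i
      by (simp add: matrix_vector_mult_def sum_UNIV_Plus rr q_def transpose_def)
    then show ?thesis using v by (simp add: vec_eq_iff)
  qed
  moreover have "p \<noteq> 0 \<or> q \<noteq> 0"
  proof (rule ccontr)
    assume "\<not> (p \<noteq> 0 \<or> q \<noteq> 0)"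
    then have "v $ k = 0" for k by (cases k) (simp_all add: p_def q_def vec_eq_iff)
    then show False using v by (simp add: vec_eq_iff)
  qed
  ultimately show "det N = 0"
    using det_eq_0_iff_eigenvector[of N] det_eq_0_iff_eigenvector[of "transpose N"]
    by (metis det_transpose)
next
  assume "det N = 0"
  then obtain q where q: "q \<noteq> 0" "transpose N *v q = 0"
    using det_eq_0_iff_eigenvector[of "transpose N"] by auto
  define v :: "'k^('m + 'm)" where "v = (\<chi> k. case k of Inl i \<Rightarrow> 0 | Inr i \<Rightarrow> q $ i)"
  have "(M *v v) $ k = 0" for k
  proof (cases k)
    case (Inl i)
    then show ?thesis by (simp add: matrix_vector_mult_def sum_UNIV_Plus lr v_def)
  next
    case (Inr i)
    have "(M *v v) $ Inr i = (transpose N *v q) $ i"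
      by (simp add: matrix_vector_mult_def sum_UNIV_Plus rr v_def transpose_def)
    then show ?thesis using q Inr by simp
  qed
  moreover have "v \<noteq> 0"
  proof -
    obtain i where "q $ i \<noteq> 0" using q by (auto simp: vec_eq_iff)
    then have "v $ Inr i \<noteq> 0" by (simp add: v_def)
    then show ?thesis by force
  qed
  ultimately show "det M = 0" using det_eq_0_iff_eigenvector by (metis vec_eq_iff zero_index)
qed

text \<open>This applies when \<open>J\<close> is a Jacobi operator of the extension: it induces \<open>K\<close> on the base and the dual
  of \<open>K\<close> on the fibre.\<close>

lemma Spec_dual_block:
  fixes J :: "real^('m::finite + 'm) \<Rightarrow> real^('m + 'm)" and K :: "real^'m \<Rightarrow> real^'m"
  assumes K: "linear K" and base: "\<And>U. base (J U) = K (base U)"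
    and fibre: "\<And>U w. base U = 0 \<Longrightarrow> fibre (J U) \<bullet> w = fibre U \<bullet> K w"
  shows "Spec J = Spec K"
proof -
  have bl: "base (axis (Inl j) 1) = axis j 1" and br: "base (axis (Inr j) 1) = 0"
    and fr: "fibre (axis (Inr j) 1) = axis j 1" for j :: 'm
    by (auto simp: base_def fibre_def axis_def vec_eq_iff)
  have ll: "matrix J $ Inl i $ Inl j = matrix K $ i $ j" for i j
    using base[of "axis (Inl j) 1"] bl[of j] by (simp add: matrix_def base_def vec_eq_iff)
  have lr: "matrix J $ Inl i $ Inr j = 0" for i j
  proof -
    have "base (J (axis (Inr j) 1)) = 0" by (simp add: base br linear_0[OF K])
    then show ?thesis by (simp add: matrix_def base_def vec_eq_iff)
  qed
  have rr: "matrix J $ Inr i $ Inr j = matrix K $ j $ i" for i j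
    using fibre[OF br, of j "axis i 1"] fr[of j]
    by (simp add: matrix_def fibre_def inner_axis inner_axis' )
  have "det (cmatrix J - mat \<mu>) = 0 \<longleftrightarrow> det (cmatrix K - mat \<mu>) = 0" for \<mu>
    by (rule det_block_lower_triangular_eq_0_iff) (auto simp: cmatrix_def mat_def ll lr rr)
  then show ?thesis by (auto simp: Spec_iff)
qed

section \<open>Projective Osserman manifolds\<close>

lemma linear_local_curv:
  assumes "open S" "z \<in> S" and bil: "\<And>x. x \<in> S \<Longrightarrow> bilinear (G x)"
    and s: "\<And>u v. smooth_on S (\<lambda>x. G x u v)"
  shows "linear (\<lambda>u. local_curv G z u v w)"
proof -
  note b = bil[OF assms(2)]
  have 1: "linear (\<lambda>u. dd (\<lambda>x. G x v w) z u)"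
    by (rule smooth_on_linear_dd[OF s assms(2)])
  have 2: "linear (\<lambda>u. dd (\<lambda>x. G x u w) z v)"
    by (rule linear_dd_family[OF assms(1,2), where L = "\<lambda>x u. G x u w"])
      (auto intro: bilinear_linear1 bil smooth_on_differentiable[OF s assms(2)])
  have 3: "linear (\<lambda>u. G z u (G z v w))" by (rule bilinear_linear1[OF b])
  have 4: "linear (\<lambda>u. G z v (G z u w))"
    using linear_compose[OF bilinear_linear1[OF b] bilinear_linear2[OF b]] by (simp add: o_def)
  show ?thesis
    unfolding local_curv_def by (intro linear_compose_sub linear_compose_add 1 2 3 4)
qed

context
  fixes A :: "('a, 'm::finite) chart set" and D :: "('a, 'm) cov_deriv"
  assumes at: "smooth_atlas A" and con: "connection A D" and tf: "torsion_free A D"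
begin

lemma linear_local_curv_christoffel_map:
  assumes "c \<in> A" "p \<in> cdom c"
  shows "linear (\<lambda>v. local_curv (christoffel_map A D c) (cmap c p) v u u)"
  using assms
  by (intro linear_local_curv[OF open_chart[OF at assms(1)]] bilinear_christoffel_map
      christoffel_familyD(2)[OF christoffel_family_christoffel_map[OF at con] assms(1)]) auto

lemma Spec_jacobi:
  assumes c: "c \<in> A" and p: "p \<in> cdom c"
  shows "Spec (jacobi A D p x) = Spec (\<lambda>v. local_curv (christoffel_map A D c) (cmap c p) v (components A c p x) (components A c p x))"
proof -
  let ?K = "\<lambda>v. local_curv (christoffel_map A D c) (cmap c p) v (components A c p x) (components A c p x)"
  let ?P = "components A c p" and ?Q = "\<lambda>v. const_field A c v p"
  have J: "?P (jacobi A D p x v) = ?K (?P v)" for v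
    by (rule jacobi_components[OF at represents_christoffel_map[OF at con] christoffel_family_christoffel_map[OF at con] con tf c p])
  have "jacobi A D p x = ?Q \<circ> (?K \<circ> ?P)"
  proof
    fix v
    show "jacobi A D p x v = (?Q \<circ> (?K \<circ> ?P)) v"
      using const_field_components[OF at c p, of "jacobi A D p x v"] unfolding J by simp
  qed
  then have "linear (jacobi A D p x)"
    using linear_compose[OF linear_compose[OF linear_components[OF at c p] linear_local_curv_christoffel_map[OF c p]]
        linear_const_field[OF at c p]] by simp
  then show ?thesis
    by (rule Spec_conjugate[OF _ linear_local_curv_christoffel_map[OF c p] linear_components[OF at c p]
          linear_const_field[OF at c p]]) (rule const_field_components[OF at c p], rule J)
qed

end

context
  fixes A :: "('a, 'm::finite) chart set" and D :: "('a, 'm) cov_deriv" and \<Phi> :: "('a, 'm) two_tensor"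
  assumes at: "smooth_atlas A" and con: "connection A D" and tf: "torsion_free A D"
    and \<Phi>: "smooth_symmetric_tensor A \<Phi>"
begin

text \<open>The components of \<open>U\<close> refer to the chart chosen at \<open>\<xi>\<close>, and those of the projected vector to the chart
  chosen at the base point; \<open>const_field\<close> converts between the two, which conjugates the Jacobi operator by a
  Jacobian and preserves its spectrum.\<close>

lemma Spec_extension_jacobi:
  assumes \<xi>: "\<xi> \<in> points (cotangent_bundle A)"
  defines "c \<equiv> base_chart A (chart_at (cotangent_bundle A) \<xi>)"
  shows "Spec (ext_jacobi A D \<Phi> \<xi> U)
    = Spec (jacobi A D (fst \<xi>) (const_field A c (base U) (fst \<xi>)))"
proof -
  note E = extension_jacobi[OF at con tf \<Phi> \<xi>, folded c_def]
  let ?z = "cmap (cotangent_chart A c) \<xi>"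
  interpret local_extension "cmap c ` cdom c" "christoffel_map A D c" "gram A \<Phi> c"
    by (rule local_extension_chart[OF at con tf \<Phi> E(1)])
  have z: "?z \<in> T" using E(2) by simp
  let ?K = "\<lambda>v. local_curv (christoffel_map A D c) (cmap c (fst \<xi>)) v (base U) (base U)"
  have "Spec (\<lambda>V. local_curv christ ?z V U U) = Spec ?K"
    by (rule Spec_dual_block[OF linear_local_curv_christoffel_map[OF at con tf E(1,2)]])
      (use base_local_curv_christ[OF z] fibre_local_curv_christ_vertical[OF z] in auto)
  also have "\<dots> = Spec (jacobi A D (fst \<xi>) (const_field A c (base U) (fst \<xi>)))"
    using Spec_jacobi[OF at con tf E(1,2)] by (simp add: components_const_field[OF at E(1,2)])
  finally show ?thesis using E(4) by presburger
qed

text \<open>Vertical vectors are null, so a vector that is not null has a nonzero projection.\<close>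

lemma Spec_jacobi_base_vector:
  assumes \<xi>: "\<xi> \<in> points (cotangent_bundle A)" and U: "riemannian_extension A D \<Phi> \<xi> U U \<noteq> 0"
  shows "\<exists>x. x \<noteq> 0 \<and> Spec (ext_jacobi A D \<Phi> \<xi> U) = Spec (jacobi A D (fst \<xi>) x)"
proof -
  define c where "c = base_chart A (chart_at (cotangent_bundle A) \<xi>)"
  note E = extension_jacobi[OF at con tf \<Phi> \<xi>, folded c_def]
  interpret local_extension "cmap c ` cdom c" "christoffel_map A D c" "gram A \<Phi> c"
    by (rule local_extension_chart[OF at con tf \<Phi> E(1)])
  have x: "cmap c (fst \<xi>) \<in> cmap c ` cdom c" using E(2) by blast
  have "base U \<noteq> 0"
  proof
    assume "base U = 0"
    then show False
      using U \<Phi>_lin(5)[OF x] \<Gamma>_lin(5)[OF x] unfolding E(3) metric_def by simp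
  qed
  then have "const_field A c (base U) (fst \<xi>) \<noteq> 0"
    using components_const_field[OF at E(1,2)] linear_0[OF linear_components[OF at E(1,2)]] by metis
  then show ?thesis using Spec_extension_jacobi[OF \<xi>, of U] unfolding c_def by blast
qed

text \<open>Changing the fibre part of \<open>U\<close> by \<open>t u\<close>, where \<open>u\<close> is its base part, changes the length \<open>g(U,U)\<close> by \<open>2 t (u \<bullet> u)\<close>. So every
  nonzero vector of the base lifts to a vector of any given length.\<close>

lemma Spec_jacobi_lift:
  assumes p: "p \<in> points A" and x: "x \<noteq> 0"
  shows "\<exists>\<xi> U. \<xi> \<in> points (cotangent_bundle A) \<and> riemannian_extension A D \<Phi> \<xi> U U = \<epsilon> \<and>
    Spec (ext_jacobi A D \<Phi> \<xi> U) = Spec (jacobi A D p x)"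
proof -
  define \<xi> :: "('a, 'm) cotangent" where "\<xi> = (p, 0)"
  have \<xi>: "\<xi> \<in> points (cotangent_bundle A)" using p by (simp add: \<xi>_def points_cotangent[OF at])
  define c where "c = base_chart A (chart_at (cotangent_bundle A) \<xi>)"
  note E = extension_jacobi[OF at con tf \<Phi> \<xi>, folded c_def]
  interpret local_extension "cmap c ` cdom c" "christoffel_map A D c" "gram A \<Phi> c"
    by (rule local_extension_chart[OF at con tf \<Phi> E(1)])
  define u where "u = components A c p x"
  have pc: "p \<in> cdom c" using E(2) by (simp add: \<xi>_def)
  have xu: "const_field A c u p = x"
    unfolding u_def by (rule const_field_components[OF at E(1) pc])
  have u: "u \<noteq> 0"
    using x xu linear_0[OF linear_const_field[OF at E(1) pc]] by auto
  define q where "q = metric (cmap (cotangent_chart A c) \<xi>) (join u 0) (join u 0)"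
  define U where "U = join u (((\<epsilon> - q) / (2 * (u \<bullet> u))) *\<^sub>R u)"
  have "riemannian_extension A D \<Phi> \<xi> U U = q + 2 * ((\<epsilon> - q) / (2 * (u \<bullet> u)) * (u \<bullet> u))"
    unfolding E(3) by (simp add: U_def q_def metric_def)
  then have "riemannian_extension A D \<Phi> \<xi> U U = \<epsilon>" using u by (simp add: field_simps)
  moreover have "Spec (ext_jacobi A D \<Phi> \<xi> U) = Spec (jacobi A D p x)"
  proof -
    have "base U = u" "fst \<xi> = p" by (simp_all add: U_def \<xi>_def)
    then show ?thesis using Spec_extension_jacobi[OF \<xi>, of U, folded c_def] xu by simp
  qed
  ultimately show ?thesis using \<xi> by blast
qed

text \<open>Both conditions compare all pairs of spectra from a family, and the two families consist of the same
  sets. The common relation is abstracted as \<open>R\<close>, and \<open>\<epsilon> \<noteq> 0\<close> excludes the vertical vectors; the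
  spacelike and the timelike case are the values \<open>1\<close> and \<open>-1\<close>.\<close>

lemma affine_iff_projective_Osserman_on:
  assumes \<epsilon>: "\<epsilon> \<noteq> 0"
  shows "affine_projective_Osserman A D \<longleftrightarrow> projective_Osserman_on (cotangent_bundle A)
    (riemannian_extension A D \<Phi>)
    (pseudo_sphere_bundle (cotangent_bundle A) (riemannian_extension A D \<Phi>) \<epsilon>)"
proof -
  define R where "R = (\<lambda>X Y :: complex set. \<exists>s::real. s \<noteq> 0 \<and> Y = (\<lambda>z. of_real s * z) ` X \<and>
    (\<lambda>z. of_real s * z) ` X \<noteq> {0})"
  let ?B = "cotangent_bundle A" and ?g = "riemannian_extension A D \<Phi>"
  let ?J = "\<lambda>\<xi> U. Spec (ext_jacobi A D \<Phi> \<xi> U)"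
  have 1: "affine_projective_Osserman A D \<longleftrightarrow>
      (\<forall>p q x y. p \<in> points A \<and> q \<in> points A \<and> x \<noteq> 0 \<and> y \<noteq> 0
        \<longrightarrow> R (Spec (jacobi A D p x)) (Spec (jacobi A D q y)))"
    unfolding affine_projective_Osserman_def R_def by blast
  have ball: "(\<forall>(p, x)\<in>{(p, x). P p x}. \<forall>(q, y)\<in>{(p, x). P p x}. Q p x q y)
      \<longleftrightarrow> (\<forall>p x q y. P p x \<and> P q y \<longrightarrow> Q p x q y)"
    for P :: "('a, 'm) cotangent \<Rightarrow> real^('m + 'm) \<Rightarrow> bool" and Q
    by auto
  have 2: "projective_Osserman_on ?B ?g (pseudo_sphere_bundle ?B ?g \<epsilon>) \<longleftrightarrow>
      (\<forall>\<xi> U \<eta> V. \<xi> \<in> points ?B \<and> ?g \<xi> U U = \<epsilon> \<and> \<eta> \<in> points ?B \<and> ?g \<eta> V V = \<epsilon>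
        \<longrightarrow> R (?J \<xi> U) (?J \<eta> V))"
    unfolding projective_Osserman_on_def pseudo_sphere_bundle_def R_def ball by (simp only: conj_assoc)
  have fst: "fst \<xi> \<in> points A" if "\<xi> \<in> points ?B" for \<xi>
    using that by (auto simp: points_cotangent[OF at])
  show ?thesis
    unfolding 1 2
  proof (intro iffI allI impI)
    fix \<xi> U \<eta> V
    assume a: "\<forall>p q x y. p \<in> points A \<and> q \<in> points A \<and> x \<noteq> 0 \<and> y \<noteq> 0
        \<longrightarrow> R (Spec (jacobi A D p x)) (Spec (jacobi A D q y))"
      and b: "\<xi> \<in> points ?B \<and> ?g \<xi> U U = \<epsilon> \<and> \<eta> \<in> points ?B \<and> ?g \<eta> V V = \<epsilon>"
    from b have \<xi>: "\<xi> \<in> points ?B" "?g \<xi> U U \<noteq> 0" and \<eta>: "\<eta> \<in> points ?B" "?g \<eta> V V \<noteq> 0"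
      using \<epsilon> by simp_all
    obtain x where x: "x \<noteq> 0" "?J \<xi> U = Spec (jacobi A D (fst \<xi>) x)"
      using Spec_jacobi_base_vector[OF \<xi>] by (elim exE conjE)
    obtain y where y: "y \<noteq> 0" "?J \<eta> V = Spec (jacobi A D (fst \<eta>) y)"
      using Spec_jacobi_base_vector[OF \<eta>] by (elim exE conjE)
    show "R (?J \<xi> U) (?J \<eta> V)"
      unfolding x(2) y(2)
      by (rule a[rule_format]) (intro conjI fst \<xi>(1) \<eta>(1) x(1) y(1))
  next
    fix p q and x y :: "real^'m"
    assume a: "\<forall>\<xi> U \<eta> V. \<xi> \<in> points ?B \<and> ?g \<xi> U U = \<epsilon> \<and> \<eta> \<in> points ?B \<and> ?g \<eta> V V = \<epsilon>
        \<longrightarrow> R (?J \<xi> U) (?J \<eta> V)"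
      and "p \<in> points A \<and> q \<in> points A \<and> x \<noteq> 0 \<and> y \<noteq> 0"
    then have p: "p \<in> points A" "x \<noteq> 0" and q: "q \<in> points A" "y \<noteq> 0" by simp_all
    obtain \<xi> U where \<xi>: "\<xi> \<in> points ?B" "?g \<xi> U U = \<epsilon>" "?J \<xi> U = Spec (jacobi A D p x)"
      using Spec_jacobi_lift[OF p, of \<epsilon>] by (elim exE conjE)
    obtain \<eta> V where \<eta>: "\<eta> \<in> points ?B" "?g \<eta> V V = \<epsilon>" "?J \<eta> V = Spec (jacobi A D q y)"
      using Spec_jacobi_lift[OF q, of \<epsilon>] by (elim exE conjE)
    show "R (Spec (jacobi A D p x)) (Spec (jacobi A D q y))"
      unfolding \<xi>(3)[symmetric] \<eta>(3)[symmetric]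
      by (rule a[rule_format]) (intro conjI \<xi>(1,2) \<eta>(1,2))
  qed
qed

end

theorem theorem1p8:
  fixes A :: "('a, 'm::finite) chart set"
    and D :: "('a, 'm) cov_deriv"
    and \<Phi> :: "('a, 'm) two_tensor"
  assumes "affine_manifold A D"
    and "smooth_symmetric_tensor A \<Phi>"
  shows "(affine_projective_Osserman A D \<longleftrightarrow>
            spacelike_projective_Osserman (cotangent_bundle A) (riemannian_extension A D \<Phi>)) \<and>
         (spacelike_projective_Osserman (cotangent_bundle A) (riemannian_extension A D \<Phi>) \<longleftrightarrow>
            timelike_projective_Osserman (cotangent_bundle A) (riemannian_extension A D \<Phi>))"
proof -
  have "smooth_atlas A" "connection A D" "torsion_free A D"
    using assms(1) by (auto simp: affine_manifold_def smooth_manifold_def)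
  note eq = affine_iff_projective_Osserman_on[OF this assms(2)]
  show ?thesis
    using eq[of 1] eq[of "- 1"]
    unfolding spacelike_projective_Osserman_def timelike_projective_Osserman_def by simp
qed

end
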